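(* Let $Q$ be a Dynkin quiver with vertices $1,\dots,n$, $k$ a source of $Q$, and ${\boldsymbol\nu}=(\nu^i)$ with $\nu^i\vdash d_i$. Let $\lambda=\nu^k$ and $\mu=\nu^{\mathrm{adj}(k)}$, and suppose $\lambda$ and $\mu$ are $t$-interlaced for some $t\ge0$. Suppose $V$ is a representation of $Q$ with $V\simeq\operatorname{GenRep}({\boldsymbol\nu})$ and ${\boldsymbol\nu}=\operatorname{GenJF}(V)$. Then $\operatorname{GenJF}(R^-_k(V))=\sigma_k({\boldsymbol\nu})$.
   Context: $\Bbbk$ algebraically closed; Dynkin quiver: underlying graph a simply-laced Dynkin diagram. $\operatorname{GenJF}(X)$: the tuple of Jordan types (at each vertex) of a generic nilpotent endomorphism of $X$, i.e. the value of the Jordan-type function on a dense open subset of the variety of nilpotent endomorphisms, which is the maximum in componentwise dominance order. For ${\boldsymbol\nu}\vdash\mathbf d$, fixing nilpotent operators $N_i$ of Jordan types $\nu^i$ on spaces of dimension $d_i$, the representations compatible with $N$ ($N_{t(a)}f_a=f_aN_{s(a)}$) contain a dense open subset of pairwise isomorphic representations, whose class is $\operatorname{GenRep}({\boldsymbol\nu})$. $R^-_k$ is the BGP reflection functor at the source $k$ (to $\sigma_k(Q)$; at $k$ it takes the cokernel of $V_k\to\bigoplus_{a:k\to t(a)}V_{t(a)}$). $\nu^{\mathrm{adj}(k)}$: partition whose parts are the union over arrows $a:k\to t(a)$ of the parts of $\nu^{t(a)}$. For $t\ge0$, $t$-interlaced means $\mu_1\ge\dots\ge\mu_{t+1}\ge\lambda_1\ge\mu_{t+2}\ge\mu_{t+3}\ge\lambda_2\ge\mu_{t+4}\ge\mu_{t+5}\ge\lambda_3\ge\cdots$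 (padding with zeros), and $\operatorname{diff}(\mu,\lambda)=(\mu_1,\dots,\mu_t,\mu_{t+1}+\mu_{t+2}-\lambda_1,\mu_{t+3}+\mu_{t+4}-\lambda_2,\dots)$. $\sigma_k({\boldsymbol\nu})$ equals ${\boldsymbol\nu}$ except that $\nu^k$ is replaced by $\operatorname{diff}(\nu^{\mathrm{adj}(k)},\nu^k)$. *)

theory Defs
  imports "HOL-Computational_Algebra.Polynomial" "Jordan_Normal_Form.Jordan_Normal_Form"
    "HOL-Library.Multiset"
begin

definition quiver :: "nat \<Rightarrow> 'a set \<Rightarrow> ('a \<Rightarrow> nat) \<Rightarrow> ('a \<Rightarrow> nat) \<Rightarrow> bool" where
  "quiver n A s t \<longleftrightarrow> finite A \<and> (\<forall>a\<in>A. s a < n \<and> t a < n)"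

definition dynkin_A_edges :: "nat \<Rightarrow> nat set set" where
  "dynkin_A_edges n = {{i, Suc i} | i. Suc i < n}"

definition dynkin_D_edges :: "nat \<Rightarrow> nat set set" where
  "dynkin_D_edges n = {{i, Suc i} | i. Suc i < n - 1} \<union> {{n - 3, n - 1}}"

definition dynkin_E_edges :: "nat \<Rightarrow> nat set set" where
  "dynkin_E_edges n = {{i, Suc i} | i. Suc i < n - 1} \<union> {{2, n - 1}}"

definition dynkin_diagram :: "nat \<Rightarrow> nat set set \<Rightarrow> bool" where
  "dynkin_diagram n E \<longleftrightarrow>
     (n \<ge> 1 \<and> E = dynkin_A_edges n) \<or>
     (n \<ge> 4 \<and> E = dynkin_D_edges n) \<or>
     (n \<in> {6, 7, 8} \<and> E = dynkin_E_edges n)"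

definition dynkin_quiver :: "nat \<Rightarrow> 'a set \<Rightarrow> ('a \<Rightarrow> nat) \<Rightarrow> ('a \<Rightarrow> nat) \<Rightarrow> bool" where
  "dynkin_quiver n A s t \<longleftrightarrow> quiver n A s t \<and>
     (\<forall>a\<in>A. s a \<noteq> t a) \<and> inj_on (\<lambda>a. {s a, t a}) A \<and>
     (\<exists>\<pi> E. bij_betw \<pi> {..<n} {..<n} \<and> dynkin_diagram n E \<and>
            (\<lambda>a. {\<pi> (s a), \<pi> (t a)}) ` A = E)"

definition is_source :: "'a set \<Rightarrow> ('a \<Rightarrow> nat) \<Rightarrow> nat \<Rightarrow> bool" where
  "is_source A t k \<longleftrightarrow> (\<forall>a\<in>A. t a \<noteq> k)"

definition refl_src :: "('a \<Rightarrow> nat) \<Rightarrow> ('a \<Rightarrow> nat) \<Rightarrow> nat \<Rightarrow> 'a \<Rightarrow> nat" where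
  "refl_src s t k a = (if s a = k \<or> t a = k then t a else s a)"

definition refl_tgt :: "('a \<Rightarrow> nat) \<Rightarrow> ('a \<Rightarrow> nat) \<Rightarrow> nat \<Rightarrow> 'a \<Rightarrow> nat" where
  "refl_tgt s t k a = (if s a = k \<or> t a = k then s a else t a)"

definition rep :: "'a set \<Rightarrow> ('a \<Rightarrow> nat) \<Rightarrow> ('a \<Rightarrow> nat) \<Rightarrow> (nat \<Rightarrow> nat)
                   \<Rightarrow> ('a \<Rightarrow> 'k::field mat) \<Rightarrow> bool" where
  "rep A s t d f \<longleftrightarrow> (\<forall>a\<in>A. f a \<in> carrier_mat (d (t a)) (d (s a)))"

definition rep_iso :: "nat \<Rightarrow> 'a set \<Rightarrow> ('a \<Rightarrow> nat) \<Rightarrow> ('a \<Rightarrow> nat)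
     \<Rightarrow> (nat \<Rightarrow> nat) \<Rightarrow> ('a \<Rightarrow> 'k::field mat) \<Rightarrow> (nat \<Rightarrow> nat) \<Rightarrow> ('a \<Rightarrow> 'k mat) \<Rightarrow> bool" where
  "rep_iso n A s t d f d' g \<longleftrightarrow>
     (\<forall>i<n. d i = d' i) \<and>
     (\<exists>\<phi>. (\<forall>i<n. \<phi> i \<in> carrier_mat (d i) (d i) \<and> invertible_mat (\<phi> i)) \<and>
          (\<forall>a\<in>A. \<phi> (t a) * f a = g a * \<phi> (s a)))"

definition partition :: "(nat \<Rightarrow> nat) \<Rightarrow> bool" where
  "partition p \<longleftrightarrow> (\<forall>i. p (Suc i) \<le> p i) \<and> finite {i. p i \<noteq> 0}"

definition num_parts :: "(nat \<Rightarrow> nat) \<Rightarrow> nat" where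
  "num_parts p = card {i. p i \<noteq> 0}"

definition partition_of :: "(nat \<Rightarrow> nat) \<Rightarrow> nat \<Rightarrow> bool" where
  "partition_of p d \<longleftrightarrow> partition p \<and> (\<Sum>i<num_parts p. p i) = d"

definition parts_mset :: "(nat \<Rightarrow> nat) \<Rightarrow> nat multiset" where
  "parts_mset p = mset (map p [0..<num_parts p])"

definition partition_of_mset :: "nat multiset \<Rightarrow> nat \<Rightarrow> nat" where
  "partition_of_mset M i = (if i < size M then rev (sorted_list_of_multiset M) ! i else 0)"

definition adj_partition :: "'a set \<Rightarrow> ('a \<Rightarrow> nat) \<Rightarrow> ('a \<Rightarrow> nat) \<Rightarrow> (nat \<Rightarrow> nat \<Rightarrow> nat)
                              \<Rightarrow> nat \<Rightarrow> nat \<Rightarrow> nat" where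
  "adj_partition A s t \<nu> k = partition_of_mset (\<Sum>a\<in>{a\<in>A. s a = k}. parts_mset (\<nu> (t a)))"

(* t-interlacing (0-indexed): mu_0 >= ... >= mu_t >= lambda_0 >= mu_{t+1} >= mu_{t+2}
   >= lambda_1 >= mu_{t+3} >= ... *)
definition interlaced :: "nat \<Rightarrow> (nat \<Rightarrow> nat) \<Rightarrow> (nat \<Rightarrow> nat) \<Rightarrow> bool" where
  "interlaced tt \<mu> lam \<longleftrightarrow>
     (\<forall>i. \<mu> (Suc i) \<le> \<mu> i) \<and>
     (\<forall>i. lam i \<le> \<mu> (tt + 2 * i) \<and> \<mu> (tt + 2 * i + 1) \<le> lam i)"

definition pdiff :: "nat \<Rightarrow> (nat \<Rightarrow> nat) \<Rightarrow> (nat \<Rightarrow> nat) \<Rightarrow> nat \<Rightarrow> nat" where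
  "pdiff tt \<mu> lam i = (if i < tt then \<mu> i
      else \<mu> (tt + 2 * (i - tt)) + \<mu> (tt + 2 * (i - tt) + 1) - lam (i - tt))"

definition sigma_part :: "'a set \<Rightarrow> ('a \<Rightarrow> nat) \<Rightarrow> ('a \<Rightarrow> nat) \<Rightarrow> nat \<Rightarrow> nat
                          \<Rightarrow> (nat \<Rightarrow> nat \<Rightarrow> nat) \<Rightarrow> nat \<Rightarrow> nat \<Rightarrow> nat" where
  "sigma_part A s t k tt \<nu> i =
     (if i = k then pdiff tt (adj_partition A s t \<nu> k) (\<nu> k) else \<nu> i)"

definition nilpotent_mat :: "nat \<Rightarrow> 'k::field mat \<Rightarrow> bool" where
  "nilpotent_mat m N \<longleftrightarrow> N \<in> carrier_mat m m \<and> (\<exists>e. N ^\<^sub>m e = 0\<^sub>m m m)"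

definition jordan_type :: "'k::field mat \<Rightarrow> (nat \<Rightarrow> nat) \<Rightarrow> bool" where
  "jordan_type N p \<longleftrightarrow> partition p \<and>
     jordan_nf N (map (\<lambda>i. (p i, 0)) [0..<num_parts p])"

inductive_set poly_fun :: "(('v \<Rightarrow> 'k::field) \<Rightarrow> 'k) set" where
  pf_const: "(\<lambda>x. c) \<in> poly_fun"
| pf_var: "(\<lambda>x. x v) \<in> poly_fun"
| pf_add: "p \<in> poly_fun \<Longrightarrow> q \<in> poly_fun \<Longrightarrow> (\<lambda>x. p x + q x) \<in> poly_fun"
| pf_mult: "p \<in> poly_fun \<Longrightarrow> q \<in> poly_fun \<Longrightarrow> (\<lambda>x. p x * q x) \<in> poly_fun"

definition zariski_closed :: "('v \<Rightarrow> 'k::field) set \<Rightarrow> bool" where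
  "zariski_closed S \<longleftrightarrow> (\<exists>P \<subseteq> poly_fun. S = {x. \<forall>p\<in>P. p x = 0})"

definition zariski_open :: "('v \<Rightarrow> 'k::field) set \<Rightarrow> bool" where
  "zariski_open U \<longleftrightarrow> zariski_closed (- U)"

(* Subspace topology on a set X of objects, embedded in affine space via
   the coordinate map c. *)
definition open_in_via :: "('x \<Rightarrow> 'v \<Rightarrow> 'k::field) \<Rightarrow> 'x set \<Rightarrow> 'x set \<Rightarrow> bool" where
  "open_in_via c X U \<longleftrightarrow> (\<exists>W. zariski_open W \<and> U = {x\<in>X. c x \<in> W})"

definition dense_open_in_via :: "('x \<Rightarrow> 'v \<Rightarrow> 'k::field) \<Rightarrow> 'x set \<Rightarrow> 'x set \<Rightarrow> bool" where
  "dense_open_in_via c X U \<longleftrightarrow> open_in_via c X U \<and>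
     (\<forall>U'. open_in_via c X U' \<and> U' \<noteq> {} \<longrightarrow> U \<inter> U' \<noteq> {})"

definition nil_ends :: "nat \<Rightarrow> 'a set \<Rightarrow> ('a \<Rightarrow> nat) \<Rightarrow> ('a \<Rightarrow> nat)
     \<Rightarrow> (nat \<Rightarrow> nat) \<Rightarrow> ('a \<Rightarrow> 'k::field mat) \<Rightarrow> (nat \<Rightarrow> 'k mat) set" where
  "nil_ends n A s t d f = {N. (\<forall>i<n. nilpotent_mat (d i) (N i)) \<and>
                              (\<forall>a\<in>A. N (t a) * f a = f a * N (s a))}"

definition end_coords :: "nat \<Rightarrow> (nat \<Rightarrow> nat) \<Rightarrow> (nat \<Rightarrow> 'k::field mat) \<Rightarrow> nat \<times> nat \<times> nat \<Rightarrow> 'k" where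
  "end_coords n d N = (\<lambda>(i, r, c). if i < n \<and> r < d i \<and> c < d i then N i $$ (r, c) else 0)"

(* nu = GenJF(V): the Jordan-type tuple of a generic nilpotent endomorphism,
   i.e. the constant value of the Jordan-type function on a dense open subset
   of the variety of nilpotent endomorphisms of V. *)
definition is_GenJF :: "nat \<Rightarrow> 'a set \<Rightarrow> ('a \<Rightarrow> nat) \<Rightarrow> ('a \<Rightarrow> nat)
     \<Rightarrow> (nat \<Rightarrow> nat) \<Rightarrow> ('a \<Rightarrow> 'k::field mat) \<Rightarrow> (nat \<Rightarrow> nat \<Rightarrow> nat) \<Rightarrow> bool" where
  "is_GenJF n A s t d f \<nu> \<longleftrightarrow>
     (\<exists>U. dense_open_in_via (end_coords n d) (nil_ends n A s t d f) U \<and>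
          (\<forall>N\<in>U. \<forall>i<n. jordan_type (N i) (\<nu> i)))"

definition compat_reps :: "'a set \<Rightarrow> ('a \<Rightarrow> nat) \<Rightarrow> ('a \<Rightarrow> nat) \<Rightarrow> (nat \<Rightarrow> nat)
     \<Rightarrow> (nat \<Rightarrow> 'k::field mat) \<Rightarrow> ('a \<Rightarrow> 'k mat) set" where
  "compat_reps A s t d N = {f. rep A s t d f \<and> (\<forall>a\<in>A. N (t a) * f a = f a * N (s a))}"

definition rep_coords :: "'a set \<Rightarrow> ('a \<Rightarrow> nat) \<Rightarrow> ('a \<Rightarrow> nat) \<Rightarrow> (nat \<Rightarrow> nat)
     \<Rightarrow> ('a \<Rightarrow> 'k::field mat) \<Rightarrow> 'a \<times> nat \<times> nat \<Rightarrow> 'k" where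
  "rep_coords A s t d f = (\<lambda>(a, r, c).
      if a \<in> A \<and> r < d (t a) \<and> c < d (s a) then f a $$ (r, c) else 0)"

(* V is isomorphic to GenRep(nu): fixing nilpotent operators N_i of Jordan
   types nu^i on k^(d_i), the representations compatible with N contain a
   dense open subset of representations all isomorphic to V. *)
definition is_GenRep :: "nat \<Rightarrow> 'a set \<Rightarrow> ('a \<Rightarrow> nat) \<Rightarrow> ('a \<Rightarrow> nat)
     \<Rightarrow> (nat \<Rightarrow> nat) \<Rightarrow> ('a \<Rightarrow> 'k::field mat) \<Rightarrow> (nat \<Rightarrow> nat \<Rightarrow> nat) \<Rightarrow> bool" where
  "is_GenRep n A s t d f \<nu> \<longleftrightarrow>
     (\<exists>N. (\<forall>i<n. nilpotent_mat (d i) (N i) \<and> jordan_type (N i) (\<nu> i)) \<and>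
          (\<exists>U. dense_open_in_via (rep_coords A s t d) (compat_reps A s t d N) U \<and>
               (\<forall>g\<in>U. rep_iso n A s t d g d f)))"

(* The BGP reflection functor R^-_k at a source k.  (d', g), a representation
   of sigma_k(Q), is (a model of) R^-_k(V) iff it agrees with V away from k and
   W_k together with the maps g_a : V_{t(a)} -> W_k (a : k -> t(a) in Q)
   is a cokernel of the map V_k -> (+)_{a : k -> t(a)} V_{t(a)}.             *)

definition is_reflection_minus :: "nat \<Rightarrow> 'a set \<Rightarrow> ('a \<Rightarrow> nat) \<Rightarrow> ('a \<Rightarrow> nat) \<Rightarrow> nat
     \<Rightarrow> (nat \<Rightarrow> nat) \<Rightarrow> ('a \<Rightarrow> 'k::field mat) \<Rightarrow> (nat \<Rightarrow> nat) \<Rightarrow> ('a \<Rightarrow> 'k mat) \<Rightarrow> bool" where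
  "is_reflection_minus n A s t k d f d' g \<longleftrightarrow>
     rep A (refl_src s t k) (refl_tgt s t k) d' g \<and>
     (\<forall>i<n. i \<noteq> k \<longrightarrow> d' i = d i) \<and>
     (\<forall>a\<in>A. s a \<noteq> k \<longrightarrow> g a = f a) \<and>
     (let Out = {a\<in>A. s a = k};
          G = (\<lambda>x. vec (d' k) (\<lambda>r. \<Sum>a\<in>Out. (g a *\<^sub>v x a) $ r))
      in (\<forall>w\<in>carrier_vec (d' k). \<exists>x. (\<forall>a\<in>Out. x a \<in> carrier_vec (d (t a))) \<and> G x = w) \<and>
         (\<forall>x. (\<forall>a\<in>Out. x a \<in> carrier_vec (d (t a))) \<longrightarrow>
              (G x = 0\<^sub>v (d' k) \<longleftrightarrow>
               (\<exists>v\<in>carrier_vec (d k). \<forall>a\<in>Out. x a = f a *\<^sub>v v))))"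

end

theory Submission
  imports Defs "Jordan_Normal_Form.Jordan_Normal_Form_Existence"
begin

text \<open>Write \<open>M\<close> for the sum of the spaces \<open>V\<^bsub>t(a)\<^esub>\<close> over the arrows \<open>a\<close> starting at \<open>k\<close>, \<open>\<Phi>\<close> for the map from
  \<open>V\<^sub>k\<close> to \<open>M\<close>, and \<open>W\<close> for its cokernel. If \<open>\<Phi>\<close> is injective, the nilpotent endomorphisms of \<open>V\<close> and of the
  reflected representation correspond linearly to each other and agree away from \<open>k\<close>, so only the Jordan type on \<open>W\<close>
  matters. It is bounded above: the ranks of powers are superadditive in the sequence \<open>V\<^sub>k \<rightarrow> M \<rightarrow> W\<close>, and for
  \<open>t\<close>-interlaced partitions this forces the type on \<open>W\<close> to be dominated by \<open>diff(\<mu>, \<lambda>)\<close>. The bound is attained by an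
  explicit \<open>k[x]\<close>-linear map, hence on a nonempty open set of the representations compatible with fixed operators
  \<open>N\<close> of types \<open>\<nu>\<close>, which meets the isomorphism class of \<open>V\<close> because \<open>V\<close> is \<open>GenRep(\<nu>)\<close>.
  For density inside the nilpotent endomorphisms of \<open>V\<close>, let \<open>N'\<close> be one of types \<open>\<nu>\<close>; conjugation by some \<open>h\<close> makes it
  the fixed \<open>N\<close> and \<open>V\<close> a point of the space of compatible representations. Join this point to a good one by a line.
  Almost all points of the line are isomorphic to \<open>V\<close>, so the space of intertwiners from \<open>V\<close> has constant dimension there and
  \<open>h\<close> extends to a family of intertwiners that is regular in the parameter. Pulling \<open>N\<close> back along it
  deforms \<open>N'\<close> into endomorphisms of \<open>V\<close> with the required type on \<open>W\<close>.\<close>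

section \<open>Matrices with entries in a ring of functions\<close>

definition mat_over :: "('x \<Rightarrow> 'k) set \<Rightarrow> ('x \<Rightarrow> 'k mat) \<Rightarrow> bool" where
  "mat_over R M \<longleftrightarrow> (\<exists>nr nc. (\<forall>x. M x \<in> carrier_mat nr nc) \<and>
     (\<forall>i<nr. \<forall>j<nc. (\<lambda>x. M x $$ (i, j)) \<in> R))"

lemma mat_overI:
  assumes "\<And>x. M x \<in> carrier_mat nr nc"
    and "\<And>i j. i < nr \<Longrightarrow> j < nc \<Longrightarrow> (\<lambda>x. M x $$ (i, j)) \<in> R"
  shows "mat_over R M"
  using assms unfolding mat_over_def by blast

lemma mat_overD:
  assumes "mat_over R M" "M x0 \<in> carrier_mat nr nc"
  shows "M x \<in> carrier_mat nr nc"
    and "i < nr \<Longrightarrow> j < nc \<Longrightarrow> (\<lambda>x. M x $$ (i, j)) \<in> R"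
proof -
  obtain nr' nc' where *: "\<forall>x. M x \<in> carrier_mat nr' nc'"
    "\<forall>i<nr'. \<forall>j<nc'. (\<lambda>x. M x $$ (i, j)) \<in> R"
    using assms(1) unfolding mat_over_def by blast
  have eq: "nr' = nr" "nc' = nc" using *(1) assms(2) carrier_matD by metis+
  show "M x \<in> carrier_mat nr nc" using * eq by blast
  show "i < nr \<Longrightarrow> j < nc \<Longrightarrow> (\<lambda>x. M x $$ (i, j)) \<in> R" using * eq by blast
qed

locale function_ring =
  fixes R :: "('x \<Rightarrow> 'k::field) set"
  assumes const: "(\<lambda>x. c) \<in> R"
    and add: "p \<in> R \<Longrightarrow> q \<in> R \<Longrightarrow> (\<lambda>x. p x + q x) \<in> R"
    and mult: "p \<in> R \<Longrightarrow> q \<in> R \<Longrightarrow> (\<lambda>x. p x * q x) \<in> R"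
begin

lemma sum: "(\<And>i. i \<in> I \<Longrightarrow> p i \<in> R) \<Longrightarrow> (\<lambda>x. \<Sum>i\<in>I. p i x) \<in> R"
  by (induction I rule: infinite_finite_induct) (auto intro: const add)

lemma prod: "(\<And>i. i \<in> I \<Longrightarrow> p i \<in> R) \<Longrightarrow> (\<lambda>x. \<Prod>i\<in>I. p i x) \<in> R"
  by (induction I rule: infinite_finite_induct) (auto intro: const mult)

lemma mat_const: "mat_over R (\<lambda>x. C)"
  by (rule mat_overI[of _ "dim_row C" "dim_col C"]) (auto intro: const)

lemma mat_mult:
  assumes "mat_over R M" "mat_over R N" "dim_col (M x0) = dim_row (N x0)"
  shows "mat_over R (\<lambda>x. M x * N x)"
proof -
  define n1 n2 n3 where d: "n1 = dim_row (M x0)" "n2 = dim_col (M x0)" "n3 = dim_col (N x0)"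
  have M0: "M x0 \<in> carrier_mat n1 n2" and N0: "N x0 \<in> carrier_mat n2 n3" using assms(3) d by auto
  note MD = mat_overD[OF assms(1) M0] and ND = mat_overD[OF assms(2) N0]
  have eq: "(M x * N x) $$ (i, j) = (\<Sum>l<n2. M x $$ (i, l) * N x $$ (l, j))"
    if "i < n1" "j < n3" for x i j
    using MD(1)[of x] ND(1)[of x] that
    by (auto simp: scalar_prod_def atLeast0LessThan intro!: sum.cong)
  show ?thesis
  proof (rule mat_overI)
    show "M x * N x \<in> carrier_mat n1 n3" for x using MD(1)[of x] ND(1)[of x] by auto
    show "(\<lambda>x. (M x * N x) $$ (i, j)) \<in> R" if "i < n1" "j < n3" for i j
      unfolding eq[OF that] using that by (intro sum mult MD(2) ND(2)) auto
  qed
qed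

lemma mat_add:
  assumes "mat_over R M" "mat_over R N"
    "dim_row (M x0) = dim_row (N x0)" "dim_col (M x0) = dim_col (N x0)"
  shows "mat_over R (\<lambda>x. M x + N x)"
proof -
  define n1 n2 where d: "n1 = dim_row (M x0)" "n2 = dim_col (M x0)"
  have M0: "M x0 \<in> carrier_mat n1 n2" and N0: "N x0 \<in> carrier_mat n1 n2" using assms(3,4) d by auto
  note MD = mat_overD[OF assms(1) M0] and ND = mat_overD[OF assms(2) N0]
  show ?thesis
  proof (rule mat_overI)
    show "M x + N x \<in> carrier_mat n1 n2" for x using ND(1)[of x] by auto
    show "(\<lambda>x. (M x + N x) $$ (i, j)) \<in> R" if "i < n1" "j < n2" for i j
      using add[OF MD(2)[OF that] ND(2)[OF that]] that
      by (simp add: carrier_matD[OF ND(1)])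
  qed
qed

lemma mat_pow:
  assumes "mat_over R M" "M x0 \<in> carrier_mat n n"
  shows "mat_over R (\<lambda>x. M x ^\<^sub>m j)"
proof (induction j)
  case 0
  have "dim_row (M x) = n" for x using mat_overD(1)[OF assms] by auto
  thus ?case using mat_const[of "1\<^sub>m n"] by simp
next
  case (Suc j)
  show ?case unfolding pow_mat.simps
    by (rule mat_mult[OF Suc assms(1), of x0]) (use assms(2) in auto)
qed

lemma det:
  assumes "mat_over R M" "M x0 \<in> carrier_mat n n"
  shows "(\<lambda>x. det (M x)) \<in> R"
proof -
  note MD = mat_overD[OF assms]
  have eq: "det (M x) = (\<Sum>p\<in>{p. p permutes {0..<n}}. signof p * (\<Prod>i = 0..<n. M x $$ (i, p i)))" for x
    using MD(1)[of x] unfolding det_def by auto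
  show ?thesis unfolding eq
  proof (intro sum mult const prod)
    fix p i assume "p \<in> {p. p permutes {0..<n}}" "i \<in> {0..<n}"
    thus "(\<lambda>x. M x $$ (i, p i)) \<in> R"
      using MD(2) permutes_in_image[of p "{0..<n}" i] by auto
  qed
qed

end

section \<open>Regular functions of one variable\<close>

lemma infinite_UNIV_alg_closed: "infinite (UNIV :: 'a::alg_closed_field set)"
proof
  assume fin: "finite (UNIV :: 'a set)"
  define q :: "'a poly" where "q = (\<Prod>a\<in>UNIV. [:- a, 1:])"
  have dq: "degree q = card (UNIV :: 'a set)"
    unfolding q_def by (subst degree_prod_eq_sum_degree) auto
  have "card (UNIV :: 'a set) > 0" using fin by (simp add: card_gt_0_iff)
  hence "degree (q + 1) > 0" using dq
    by (subst degree_add_eq_left) auto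
  then obtain x where "poly (q + 1) x = 0" using alg_closed_imp_poly_has_root by blast
  moreover have "poly q x = 0" using fin by (simp add: q_def poly_prod)
  ultimately show False by simp
qed

definition regular_at :: "'k::field \<Rightarrow> ('k \<Rightarrow> 'k) \<Rightarrow> bool" where
  "regular_at e \<phi> \<longleftrightarrow>
     (\<exists>q s. poly s e \<noteq> 0 \<and> (\<forall>x. poly s x \<noteq> 0 \<longrightarrow> \<phi> x = poly q x / poly s x))"

lemma regular_at_poly [simp, intro]: "regular_at e (\<lambda>x. poly q x)"
  unfolding regular_at_def by (rule exI[of _ q], rule exI[of _ 1]) auto

lemma regular_at_const [simp, intro]: "regular_at e (\<lambda>x. c)"
  using regular_at_poly[of e "[:c:]"] by simp

lemma regular_at_id [simp, intro]: "regular_at e (\<lambda>x. x)"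
  using regular_at_poly[of e "[:0,1:]"] by simp

lemma regular_at_add [intro]:
  assumes "regular_at e \<phi>" "regular_at e \<psi>"
  shows "regular_at e (\<lambda>x. \<phi> x + \<psi> x)"
proof -
  obtain q s where 1: "poly s e \<noteq> 0" "\<And>x. poly s x \<noteq> 0 \<Longrightarrow> \<phi> x = poly q x / poly s x"
    using assms(1) unfolding regular_at_def by blast
  obtain q' s' where 2: "poly s' e \<noteq> 0" "\<And>x. poly s' x \<noteq> 0 \<Longrightarrow> \<psi> x = poly q' x / poly s' x"
    using assms(2) unfolding regular_at_def by blast
  show ?thesis unfolding regular_at_def
    by (rule exI[of _ "q * s' + q' * s"], rule exI[of _ "s * s'"])
       (use 1 2 in \<open>auto simp: add_frac_eq\<close>)
qed

lemma regular_at_mult [intro]: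
  assumes "regular_at e \<phi>" "regular_at e \<psi>"
  shows "regular_at e (\<lambda>x. \<phi> x * \<psi> x)"
proof -
  obtain q s where 1: "poly s e \<noteq> 0" "\<And>x. poly s x \<noteq> 0 \<Longrightarrow> \<phi> x = poly q x / poly s x"
    using assms(1) unfolding regular_at_def by blast
  obtain q' s' where 2: "poly s' e \<noteq> 0" "\<And>x. poly s' x \<noteq> 0 \<Longrightarrow> \<psi> x = poly q' x / poly s' x"
    using assms(2) unfolding regular_at_def by blast
  show ?thesis unfolding regular_at_def
    by (rule exI[of _ "q * q'"], rule exI[of _ "s * s'"])
       (use 1 2 in auto)
qed

lemma regular_at_diff [intro]:
  assumes "regular_at e \<phi>" "regular_at e \<psi>"
  shows "regular_at e (\<lambda>x. \<phi> x - \<psi> x)"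
  using regular_at_add[OF assms(1) regular_at_mult[OF regular_at_const[of e "-1"] assms(2)]] by simp

lemma regular_at_inverse:
  assumes "regular_at e \<phi>" "\<phi> e \<noteq> 0"
  shows "regular_at e (\<lambda>x. inverse (\<phi> x))"
proof -
  obtain q s where 1: "poly s e \<noteq> 0" "\<And>x. poly s x \<noteq> 0 \<Longrightarrow> \<phi> x = poly q x / poly s x"
    using assms(1) unfolding regular_at_def by blast
  have "poly q e \<noteq> 0" using 1(2)[OF 1(1)] assms(2) by auto
  moreover have "inverse (\<phi> x) = poly (s * s) x / poly (s * q) x" if "poly (s * q) x \<noteq> 0" for x
    using 1(2)[of x] that by simp
  ultimately show ?thesis unfolding regular_at_def using 1(1)
    by (intro exI[where x = "s * s"] exI[where x = "s * q"] conjI allI impI) auto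
qed

lemma regular_at_sum [intro]:
  assumes "\<And>i. i \<in> I \<Longrightarrow> regular_at e (\<phi> i)"
  shows "regular_at e (\<lambda>x. \<Sum>i\<in>I. \<phi> i x)"
  using assms by (induction I rule: infinite_finite_induct) auto

lemma regular_at_nonzero_cofinite:
  assumes "regular_at e \<phi>" "\<phi> e \<noteq> 0"
  shows "\<forall>\<^sub>F x in cofinite. \<phi> x \<noteq> 0"
proof -
  obtain q s where 1: "poly s e \<noteq> 0" "\<And>x. poly s x \<noteq> 0 \<Longrightarrow> \<phi> x = poly q x / poly s x"
    using assms(1) unfolding regular_at_def by blast
  have q: "poly q e \<noteq> 0" using 1(2)[OF 1(1)] assms(2) by auto
  have "finite {x. poly (q * s) x = 0}" using 1(1) q by (intro poly_roots_finite) auto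
  moreover have "{x. \<not> \<phi> x \<noteq> 0} \<subseteq> {x. poly (q * s) x = 0}" using 1(2) by auto
  ultimately show ?thesis unfolding eventually_cofinite using finite_subset by blast
qed

lemma regular_at_poly_fun:
  assumes "p \<in> poly_fun" "\<And>v. regular_at e (\<lambda>x. c x v)"
  shows "regular_at e (\<lambda>x. p (c x))"
  using assms(1) by induction (auto intro: assms(2))

abbreviation regular_mat_at :: "'k::field \<Rightarrow> ('k \<Rightarrow> 'k mat) \<Rightarrow> bool" where
  "regular_mat_at e \<equiv> mat_over {\<phi>. regular_at e \<phi>}"

lemma function_ring_regular_at: "function_ring {\<phi>. regular_at e \<phi>}"
  by unfold_locales auto

lemmas regular_mat_atI = mat_overI[of _ _ _ "{\<phi>. regular_at e \<phi>}", unfolded mem_Collect_eq] for e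
lemmas regular_mat_atD = mat_overD[of "{\<phi>. regular_at e \<phi>}", unfolded mem_Collect_eq] for e
lemmas regular_mat_at_const = function_ring.mat_const[OF function_ring_regular_at]
lemmas regular_mat_at_mult = function_ring.mat_mult[OF function_ring_regular_at[of e], where ?x0.0 = e] for e
lemmas regular_mat_at_add = function_ring.mat_add[OF function_ring_regular_at[of e], where ?x0.0 = e] for e
lemmas regular_at_det = function_ring.det[OF function_ring_regular_at[of e], where ?x0.0 = e, unfolded mem_Collect_eq] for e

definition mat_inv :: "'k::field mat \<Rightarrow> 'k mat" where
  "mat_inv M = inverse (det M) \<cdot>\<^sub>m adj_mat M"

lemma mat_inv:
  assumes "M \<in> carrier_mat n n" "det M \<noteq> 0"
  shows "mat_inv M \<in> carrier_mat n n" "M * mat_inv M = 1\<^sub>m n" "mat_inv M * M = 1\<^sub>m n"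
proof -
  note a = adj_mat[OF assms(1)]
  show "mat_inv M \<in> carrier_mat n n" unfolding mat_inv_def using a by auto
  show "M * mat_inv M = 1\<^sub>m n" unfolding mat_inv_def
    using a assms by (subst mult_smult_distrib[OF assms(1) a(1)]) auto
  show "mat_inv M * M = 1\<^sub>m n" unfolding mat_inv_def
    using a assms by (subst mult_smult_assoc_mat[OF a(1) assms(1)]) auto
qed

lemma regular_mat_at_inv:
  assumes "regular_mat_at e M" "M e \<in> carrier_mat n n" "det (M e) \<noteq> 0"
  shows "regular_mat_at e (\<lambda>x. mat_inv (M x))"
proof -
  note MD = regular_mat_atD[OF assms(1,2)]
  have dims: "dim_row (M x) = n" "dim_col (M x) = n" for x using MD(1)[of x] by auto
  show ?thesis
  proof (rule regular_mat_atI)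
    show "mat_inv (M x) \<in> carrier_mat n n" for x
      unfolding mat_inv_def using adj_mat(1)[OF MD(1)] by auto
    fix i j assume ij: "i < n" "j < n"
    have eq: "mat_inv (M x) $$ (i, j) = inverse (det (M x)) * ((-1)^(j+i) * det (mat_delete (M x) j i))" for x
      using ij by (simp add: mat_inv_def adj_mat_def dims cofactor_def)
    have "regular_mat_at e (\<lambda>x. mat_delete (M x) j i)"
    proof (rule regular_mat_atI[of _ "n - 1" "n - 1"])
      show "mat_delete (M x) j i \<in> carrier_mat (n - 1) (n - 1)" for x
        using MD(1) by (rule mat_delete_carrier)
      fix a b assume ab: "a < n - 1" "b < n - 1"
      have "mat_delete (M x) j i $$ (a, b) = M x $$ (if a < j then a else Suc a, if b < i then b else Suc b)" for x
        using ab by (simp add: mat_delete_def dims)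
      thus "regular_at e (\<lambda>x. mat_delete (M x) j i $$ (a, b))"
        using MD(2) ab ij by (auto simp del: One_nat_def)
    qed
    moreover have "mat_delete (M e) j i \<in> carrier_mat (n - 1) (n - 1)"
      using MD(1) by (rule mat_delete_carrier)
    ultimately have "regular_at e (\<lambda>x. det (mat_delete (M x) j i))" by (rule regular_at_det)
    thus "regular_at e (\<lambda>x. mat_inv (M x) $$ (i, j))" unfolding eq
      by (intro regular_at_mult regular_at_inverse regular_at_det[OF assms(1,2)] assms(3) regular_at_const)
  qed
qed

section \<open>Zariski topology\<close>

lemma function_ring_poly_fun: "function_ring poly_fun"
  by unfold_locales (auto intro: poly_fun.intros)

lemmas poly_fun_prod = function_ring.prod[OF function_ring_poly_fun]

lemma poly_fun_comp:
  assumes "p \<in> poly_fun" "\<And>v. (\<lambda>x. \<rho> x v) \<in> poly_fun"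
  shows "(\<lambda>x. p (\<rho> x)) \<in> poly_fun"
  using assms(1) by induction (auto intro: poly_fun.intros assms(2))

abbreviation poly_mat :: "(('v \<Rightarrow> 'k::field) \<Rightarrow> 'k mat) \<Rightarrow> bool" where
  "poly_mat \<equiv> mat_over poly_fun"

lemmas poly_matI = mat_overI[of _ _ _ poly_fun]
lemmas poly_matD = mat_overD[of poly_fun]
lemmas poly_mat_const = function_ring.mat_const[OF function_ring_poly_fun]
lemmas poly_mat_mult = function_ring.mat_mult[OF function_ring_poly_fun]
lemmas poly_mat_add = function_ring.mat_add[OF function_ring_poly_fun]
lemmas poly_mat_pow = function_ring.mat_pow[OF function_ring_poly_fun]
lemmas poly_fun_det = function_ring.det[OF function_ring_poly_fun]

lemma open_in_via_iff:
  "open_in_via c X U \<longleftrightarrow> U \<subseteq> X \<and>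
     (\<forall>x\<in>U. \<exists>p\<in>poly_fun. p (c x) \<noteq> 0 \<and> (\<forall>z\<in>X. p (c z) \<noteq> 0 \<longrightarrow> z \<in> U))"
proof (intro iffI conjI)
  assume "open_in_via c X U"
  then obtain W P where W: "P \<subseteq> poly_fun" "- W = {x. \<forall>p\<in>P. p x = 0}" "U = {x\<in>X. c x \<in> W}"
    unfolding open_in_via_def zariski_open_def zariski_closed_def by blast
  show "U \<subseteq> X" using W by auto
  show "\<forall>x\<in>U. \<exists>p\<in>poly_fun. p (c x) \<noteq> 0 \<and> (\<forall>z\<in>X. p (c z) \<noteq> 0 \<longrightarrow> z \<in> U)"
  proof
    fix x assume "x \<in> U"
    hence "c x \<notin> - W" using W(3) by auto
    then obtain p where p: "p \<in> P" "p (c x) \<noteq> 0" unfolding W(2) by auto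
    have "z \<in> U" if "z \<in> X" "p (c z) \<noteq> 0" for z
    proof -
      have "c z \<notin> - W" using that p W(2) by auto
      thus ?thesis using W(3) that by auto
    qed
    thus "\<exists>p\<in>poly_fun. p (c x) \<noteq> 0 \<and> (\<forall>z\<in>X. p (c z) \<noteq> 0 \<longrightarrow> z \<in> U)" using p W(1) by blast
  qed
next
  assume *: "U \<subseteq> X \<and>
     (\<forall>x\<in>U. \<exists>p\<in>poly_fun. p (c x) \<noteq> 0 \<and> (\<forall>z\<in>X. p (c z) \<noteq> 0 \<longrightarrow> z \<in> U))"
  define P where "P = {p\<in>poly_fun. \<forall>z\<in>X. p (c z) \<noteq> 0 \<longrightarrow> z \<in> U}"
  define W where "W = - {x. \<forall>p\<in>P. p x = 0}"
  have "zariski_open W" unfolding zariski_open_def zariski_closed_def W_def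
    by (rule exI[of _ P]) (auto simp: P_def)
  moreover have "U = {x\<in>X. c x \<in> W}" using * unfolding W_def P_def by auto
  ultimately show "open_in_via c X U" unfolding open_in_via_def by blast
qed

section \<open>Rank of matrices\<close>

lemma mat_assoc: "dim_col A = dim_row B \<Longrightarrow> dim_col B = dim_row C \<Longrightarrow> (A * B) * C = A * (B * (C :: 'k::semiring_0 mat))"
  by (rule assoc_mult_mat[of _ "dim_row A" "dim_col A" _ "dim_col B" _ "dim_col C"]) auto

lemma index_mult_sum:
  assumes "i < dim_row A" "j < dim_col B" "dim_row B = dim_col A"
  shows "(A * B) $$ (i, j) = (\<Sum>l<dim_col A. A $$ (i, l) * (B :: 'k::semiring_0 mat) $$ (l, j))"
  using assms by (auto simp: scalar_prod_def atLeast0LessThan intro!: sum.cong)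

lemma sum_mult_delta:
  fixes f :: "'a \<Rightarrow> 'k::semiring_1"
  assumes "finite S"
  shows "(\<Sum>i\<in>S. f i * (if i = j then 1 else 0)) = (if j \<in> S then f j else 0)"
    "(\<Sum>i\<in>S. f i * (if j = i then 1 else 0)) = (if j \<in> S then f j else 0)"
    "(\<Sum>i\<in>S. (if i = j then 1 else 0) * f i) = (if j \<in> S then f j else 0)"
    "(\<Sum>i\<in>S. (if j = i then 1 else 0) * f i) = (if j \<in> S then f j else 0)"
  using assms by (simp_all add: if_distrib[of "\<lambda>x. _ * x"] if_distrib[of "\<lambda>x. x * _"] cong: if_cong)

lemma mat_distrib_left: "dim_col A = dim_row B \<Longrightarrow> dim_row B = dim_row C \<Longrightarrow> dim_col B = dim_col C \<Longrightarrow>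
  A * (B + C) = A * B + A * (C :: 'k::semiring_0 mat)"
  by (rule mult_add_distrib_mat[of _ "dim_row A" "dim_col A" _ "dim_col B"]) auto

lemma mat_distrib_right: "dim_col A = dim_row C \<Longrightarrow> dim_row A = dim_row B \<Longrightarrow> dim_col A = dim_col B \<Longrightarrow>
  (A + B) * C = A * C + B * (C :: 'k::semiring_0 mat)"
  by (rule add_mult_distrib_mat[of _ "dim_row A" "dim_col A" _ _ "dim_col C"]) auto

lemma mat_diff_left: "dim_col A = dim_row B \<Longrightarrow> dim_row B = dim_row C \<Longrightarrow> dim_col B = dim_col C \<Longrightarrow>
  A * (B - C) = A * B - A * (C :: 'k::ring mat)"
  by (rule mult_minus_distrib_mat[of _ "dim_row A" "dim_col A" _ "dim_col B"]) auto

lemma mat_diff_right: "dim_col A = dim_row C \<Longrightarrow> dim_row A = dim_row B \<Longrightarrow> dim_col A = dim_col B \<Longrightarrow>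
  (A - B) * C = A * C - B * (C :: 'k::ring mat)"
  by (rule minus_mult_distrib_mat[of _ "dim_row A" "dim_col A" _ _ "dim_col C"]) auto

lemmas mat_ring = mat_assoc mat_distrib_left mat_distrib_right mat_diff_left mat_diff_right

lemma mat_cancel:
  assumes "A * B = C" "dim_col A = dim_row B" "dim_col B = dim_row D"
  shows "A * (B * D) = C * (D :: 'k::semiring_0 mat)"
  using mat_assoc[OF assms(2,3)] assms(1) by simp

definition vst :: "'k mat \<Rightarrow> 'k mat \<Rightarrow> 'k mat" where
  "vst A B = mat (dim_row A + dim_row B) (dim_col A)
     (\<lambda>(i, j). if i < dim_row A then A $$ (i, j) else B $$ (i - dim_row A, j))"

definition hst :: "'k mat \<Rightarrow> 'k mat \<Rightarrow> 'k mat" where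
  "hst A B = mat (dim_row A) (dim_col A + dim_col B)
     (\<lambda>(i, j). if j < dim_col A then A $$ (i, j) else B $$ (i, j - dim_col A))"

lemma vst_dim [simp]: "dim_row (vst A B) = dim_row A + dim_row B" "dim_col (vst A B) = dim_col A"
  by (auto simp: vst_def)

lemma hst_dim [simp]: "dim_row (hst A B) = dim_row A" "dim_col (hst A B) = dim_col A + dim_col B"
  by (auto simp: hst_def)

lemma vst_mult:
  assumes "dim_col A = dim_row C" "dim_col B = dim_row C"
  shows "vst A B * C = vst (A * C) (B * (C :: 'k::semiring_0 mat))"
  by (rule eq_matI) (use assms in \<open>auto simp: vst_def scalar_prod_def\<close>)

lemma mult_hst:
  assumes "dim_col C = dim_row A" "dim_col C = dim_row B"
  shows "C * hst A B = hst (C * A) (C * (B :: 'k::semiring_0 mat))"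
  by (rule eq_matI) (use assms in \<open>auto simp: hst_def scalar_prod_def\<close>)

lemma vst_hst_mult:
  assumes "dim_col A = dim_row C" "dim_col B = dim_row C" "dim_row D = dim_row C"
  shows "vst A B * hst C D = four_block_mat (A * C) (A * D) (B * C) (B * (D :: 'k::semiring_0 mat))"
  by (rule eq_matI) (use assms in \<open>auto simp: hst_def vst_def scalar_prod_def\<close>)

lemma hst_vst_mult:
  assumes "dim_col A = dim_row C" "dim_col B = dim_row D" "dim_row B = dim_row A" "dim_col D = dim_col C"
  shows "hst A B * vst C D = A * C + B * (D :: 'k::semiring_0 mat)"
proof (rule eq_matI)
  fix i j assume "i < dim_row (A * C + B * D)" "j < dim_col (A * C + B * D)"
  hence ij: "i < dim_row A" "j < dim_col C" using assms by auto
  define m n where mn: "m = dim_col A" "n = dim_col B"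
  have "(hst A B * vst C D) $$ (i, j) = (\<Sum>l<m + n. hst A B $$ (i, l) * vst C D $$ (l, j))"
    using ij assms mn by (auto simp: scalar_prod_def atLeast0LessThan intro!: sum.cong)
  also have "\<dots> = (\<Sum>l<m. hst A B $$ (i, l) * vst C D $$ (l, j)) +
      (\<Sum>l<n. hst A B $$ (i, m + l) * vst C D $$ (m + l, j))"
  proof -
    have "{..<m + n} = {..<m} \<union> (\<lambda>l. m + l) ` {..<n}"
      by (auto simp: image_iff intro: le_Suc_ex) (metis add.commute add_less_cancel_left le_Suc_ex lessThan_iff linorder_not_less)
    moreover have "{..<m} \<inter> (\<lambda>l. m + l) ` {..<n} = {}" by auto
    ultimately show ?thesis by (simp add: sum.union_disjoint sum.reindex)
  qed
  also have "\<dots> = (A * C + B * D) $$ (i, j)"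
    using ij assms mn by (simp add: scalar_prod_def atLeast0LessThan hst_def vst_def)
  finally show "(hst A B * vst C D) $$ (i, j) = (A * C + B * D) $$ (i, j)" .
qed (use assms in auto)

lemma mult_one_imp_le:
  fixes A B :: "'k::field mat"
  assumes "A \<in> carrier_mat r r'" "B \<in> carrier_mat r' r" "A * B = 1\<^sub>m r"
  shows "r \<le> r'"
proof (rule ccontr)
  assume "\<not> r \<le> r'"
  hence lt: "r' < r" by simp
  define A' where "A' = mat r r (\<lambda>(i, j). if j < r' then A $$ (i, j) else 0)"
  define B' where "B' = mat r r (\<lambda>(i, j). if i < r' then B $$ (i, j) else 0)"
  have "A' * B' = A * B"
  proof (rule eq_matI)
    fix i j assume "i < dim_row (A * B)" "j < dim_col (A * B)"
    hence ij: "i < r" "j < r" using assms by auto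
    have "(A' * B') $$ (i, j) = (\<Sum>l<r. if l < r' then A $$ (i, l) * B $$ (l, j) else 0)"
      using ij by (auto simp: A'_def B'_def scalar_prod_def atLeast0LessThan intro!: sum.cong)
    also have "\<dots> = (\<Sum>l<r'. A $$ (i, l) * B $$ (l, j))"
      using lt by (intro sum.mono_neutral_cong_right) auto
    also have "\<dots> = (A * B) $$ (i, j)"
      using ij assms(1,2) by (subst index_mult_sum) auto
    finally show "(A' * B') $$ (i, j) = (A * B) $$ (i, j)" .
  qed (use assms in \<open>auto simp: A'_def B'_def\<close>)
  hence "B' * A' = 1\<^sub>m r"
    using mat_mult_left_right_inverse[of A' r B'] assms by (simp add: A'_def B'_def)
  hence "(B' * A') $$ (r', r') = 1" using lt by simp
  moreover have "(B' * A') $$ (r', r') = 0" using lt by (simp add: A'_def B'_def scalar_prod_def)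
  ultimately show False by simp
qed

definition rkge :: "'k::field mat \<Rightarrow> nat \<Rightarrow> bool" where
  "rkge A r \<longleftrightarrow> (\<exists>L R. L \<in> carrier_mat r (dim_row A) \<and> R \<in> carrier_mat (dim_col A) r \<and> L * A * R = 1\<^sub>m r)"

definition mrank :: "'k::field mat \<Rightarrow> nat" where
  "mrank A = Max {r. rkge A r}"

lemma rkge_factor:
  assumes "rkge (Y * Z) r" "dim_col Y = dim_row Z"
  shows "r \<le> dim_col Y"
proof -
  obtain L R where LR: "L \<in> carrier_mat r (dim_row Y)" "R \<in> carrier_mat (dim_col Z) r"
    "L * (Y * Z) * R = 1\<^sub>m r"
    using assms unfolding rkge_def by auto
  have "(L * Y) * (Z * R) = 1\<^sub>m r" using LR assms(2) by (simp add: mat_assoc)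
  thus ?thesis using LR assms(2) by (intro mult_one_imp_le[of "L * Y" r _ "Z * R"]) auto
qed

lemma rkge_le_dim_row: "rkge A r \<Longrightarrow> r \<le> dim_row A"
  using rkge_factor[of "1\<^sub>m (dim_row A)" A r] by simp

lemma rkge_0 [simp]: "rkge A 0"
  unfolding rkge_def by (rule exI[of _ "0\<^sub>m 0 (dim_row A)"], rule exI[of _ "0\<^sub>m (dim_col A) 0"]) auto

lemma rkge_mono:
  assumes "rkge A r" "r' \<le> r"
  shows "rkge A r'"
proof -
  obtain L R where LR: "L \<in> carrier_mat r (dim_row A)" "R \<in> carrier_mat (dim_col A) r" "L * A * R = 1\<^sub>m r"
    using assms unfolding rkge_def by auto
  define P :: "'a mat" where "P = mat r' r (\<lambda>(i, j). if i = j then 1 else 0)"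
  define Q :: "'a mat" where "Q = mat r r' (\<lambda>(i, j). if i = j then 1 else 0)"
  have PQ: "P * Q = 1\<^sub>m r'"
  proof (rule eq_matI)
    fix i j assume "i < dim_row (1\<^sub>m r' :: 'a mat)" "j < dim_col (1\<^sub>m r' :: 'a mat)"
    hence ij: "i < r'" "j < r'" by auto
    have "(P * Q) $$ (i, j) = (\<Sum>l<r. P $$ (i, l) * Q $$ (l, j))"
      using ij by (subst index_mult_sum) (simp_all add: P_def Q_def)
    also have "\<dots> = (\<Sum>l<r. if l = i then (if i = j then 1 else 0) else 0)"
      using ij assms(2) by (intro sum.cong) (auto simp: P_def Q_def)
    finally have "(P * Q) $$ (i, j) = (\<Sum>l<r. if l = i then (if i = j then 1 else 0) else 0)" .
    thus "(P * Q) $$ (i, j) = 1\<^sub>m r' $$ (i, j)" using ij assms(2) by simp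
  qed (auto simp: P_def Q_def)
  have dims: "dim_row P = r'" "dim_col P = r" "dim_row Q = r" "dim_col Q = r'" by (auto simp: P_def Q_def)
  have "(P * L) * A * (R * Q) = P * ((L * A * R) * Q)" using LR(1,2) dims by (simp add: mat_assoc)
  also have "\<dots> = 1\<^sub>m r'" unfolding LR(3) using PQ dims by simp
  finally have "(P * L) * A * (R * Q) = 1\<^sub>m r'" .
  thus ?thesis unfolding rkge_def
    by (intro exI[of _ "P * L"] exI[of _ "R * Q"]) (use LR dims in auto)
qed

lemma rkge_iff: "rkge A r \<longleftrightarrow> r \<le> mrank A"
proof -
  have fin: "finite {r. rkge A r}" by (rule finite_subset[of _ "{..dim_row A}"]) (auto dest: rkge_le_dim_row)
  have "mrank A \<in> {r. rkge A r}" unfolding mrank_def by (rule Max_in[OF fin]) (use rkge_0 in blast)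
  thus ?thesis using fin rkge_mono[of A "mrank A" r] by (auto simp: mrank_def)
qed

lemma mrank_witness:
  obtains L R where "L \<in> carrier_mat (mrank A) (dim_row A)" "R \<in> carrier_mat (dim_col A) (mrank A)"
    "L * A * R = 1\<^sub>m (mrank A)"
  using rkge_iff[of A "mrank A"] unfolding rkge_def by auto

lemma rkgeI:
  "L \<in> carrier_mat r (dim_row A) \<Longrightarrow> R \<in> carrier_mat (dim_col A) r \<Longrightarrow> L * A * R = 1\<^sub>m r \<Longrightarrow> r \<le> mrank A"
  using rkge_iff[of A r] unfolding rkge_def by blast

lemma rkgeI_det:
  assumes "L \<in> carrier_mat r (dim_row A)" "R \<in> carrier_mat (dim_col A) r" "det (L * A * R) \<noteq> 0"
  shows "r \<le> mrank A"
proof (rule rkgeI)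
  have "L * A * R \<in> carrier_mat r r" using assms by auto
  note M = mat_inv[OF this assms(3)]
  show "mat_inv (L * A * R) * L \<in> carrier_mat r (dim_row A)" using M(1) assms by auto
  have "dim_row (mat_inv (L * A * R)) = r" "dim_col (mat_inv (L * A * R)) = r" using M(1) assms by auto
  thus "mat_inv (L * A * R) * L * A * R = 1\<^sub>m r" using M(3) assms by (simp add: mat_assoc)
qed (fact assms(2))

lemma mrank_factor_le: "dim_col Y = dim_row Z \<Longrightarrow> mrank (Y * Z) \<le> dim_col Y"
  using rkge_factor rkge_iff by blast

lemma mrank_mult_le:
  assumes "dim_col P = dim_row A" "dim_col A = dim_row Q"
  shows "mrank (P * A * Q) \<le> mrank A"
proof -
  obtain L R where LR: "L \<in> carrier_mat (mrank (P * A * Q)) (dim_row (P * A * Q))"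
    "R \<in> carrier_mat (dim_col (P * A * Q)) (mrank (P * A * Q))"
    "L * (P * A * Q) * R = 1\<^sub>m (mrank (P * A * Q))" by (rule mrank_witness)
  show ?thesis by (rule rkgeI[of "L * P" _ _ "Q * R"]) (use LR assms in \<open>auto simp: mat_assoc\<close>)
qed

lemma mrank_eqI:
  assumes "Y \<in> carrier_mat m r" "Z \<in> carrier_mat r n" "L \<in> carrier_mat r m" "R \<in> carrier_mat n r"
    "L * Y = 1\<^sub>m r" "Z * R = 1\<^sub>m r"
  shows "mrank (Y * Z) = r"
proof (rule antisym)
  show "mrank (Y * Z) \<le> r" using mrank_factor_le[of Y Z] assms by auto
  have "L * (Y * Z) * R = (L * Y) * (Z * R)" using assms(1-4) by (simp add: mat_assoc)
  thus "r \<le> mrank (Y * Z)" using assms by (intro rkgeI[of L _ _ R]) auto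
qed

lemma mrank_similar:
  assumes "similar_mat A B"
  shows "mrank A = mrank B"
proof -
  have "mrank A \<le> mrank B" if sim: "similar_mat A B" for A B :: "'a mat"
  proof -
    obtain P Q where "similar_mat_wit A B P Q" using sim unfolding similar_mat_def by blast
    note w = similar_mat_witD[OF refl this]
    have "mrank (P * B * Q) \<le> mrank B" using w(5-7) by (intro mrank_mult_le) auto
    thus ?thesis using w(3) by simp
  qed
  thus ?thesis using assms similar_mat_sym by (metis antisym)
qed

text \<open>If \<open>A\<close> differed from \<open>A R L A\<close>, a nonzero entry of the difference would allow to enlarge
  \<open>L\<close> and \<open>R\<close> by one row and one column.\<close>

lemma mrank_absorb:
  assumes "L \<in> carrier_mat r (dim_row A)" "R \<in> carrier_mat (dim_col A) r" "L * A * R = 1\<^sub>m r" "mrank A \<le> r"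
  shows "A * R * L * A = A"
proof (rule ccontr)
  assume neq: "A * R * L * A \<noteq> A"
  define m n where mn: "m = dim_row A" "n = dim_col A"
  have dims [simp]: "dim_row L = r" "dim_col L = m" "dim_row R = n" "dim_col R = r" "dim_row A = m" "dim_col A = n"
    using assms mn by auto
  have LAR: "L * (A * R) = 1\<^sub>m r" using assms(3) by (simp add: mat_assoc)
  define B where "B = A - A * (R * (L * A))"
  have dB [simp]: "dim_row B = m" "dim_col B = n" by (auto simp: B_def)
  have "\<exists>i<m. \<exists>j<n. B $$ (i, j) \<noteq> 0"
  proof (rule ccontr)
    assume "\<not> ?thesis"
    hence "A * R * L * A = A" by (intro eq_matI) (auto simp: B_def mat_assoc simp del: index_mult_mat(1))
    thus False using neq by simp
  qed
  then obtain i j where ij: "i < m" "j < n" "B $$ (i, j) \<noteq> 0" by blast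
  have "L * (A * (R * (L * A))) = (L * (A * R)) * (L * A)" by (simp add: mat_assoc)
  also have "\<dots> = L * A" unfolding LAR by simp
  finally have LB: "L * B = 0\<^sub>m r n" unfolding B_def
    by (subst mat_diff_left) (auto intro!: eq_matI simp del: index_mult_mat(1))
  have BR: "B * R = 0\<^sub>m m r" unfolding B_def
    by (subst mat_diff_right) (auto simp: mat_assoc LAR intro!: eq_matI simp del: index_mult_mat(1))
  define E where "E = mat 1 m (\<lambda>(_, l). if l = i then inverse (B $$ (i, j)) else 0)"
  define F where "F = mat n 1 (\<lambda>(l, _). if l = j then 1 else 0 :: 'a)"
  have dEF [simp]: "dim_row E = 1" "dim_col E = m" "dim_row F = n" "dim_col F = 1" by (auto simp: E_def F_def)
  have EBF: "E * (B * F) = 1\<^sub>m 1"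
  proof (rule eq_matI)
    fix a b assume ab: "a < dim_row (1\<^sub>m 1 :: 'a mat)" "b < dim_col (1\<^sub>m 1 :: 'a mat)"
    have BF: "(B * F) $$ (l, 0) = B $$ (l, j)" if "l < m" for l
    proof -
      have "(B * F) $$ (l, 0) = (\<Sum>x<n. B $$ (l, x) * F $$ (x, 0))"
        using that by (subst index_mult_sum) simp_all
      also have "\<dots> = B $$ (l, j)" using ij by (simp add: F_def sum_mult_delta)
      finally show ?thesis .
    qed
    have "(E * (B * F)) $$ (0, 0) = (\<Sum>x<m. E $$ (0, x) * (B * F) $$ (x, 0))"
      by (simp add: scalar_prod_def atLeast0LessThan)
    also have "\<dots> = (\<Sum>x<m. if x = i then inverse (B $$ (i, j)) * B $$ (i, j) else 0)"
      by (rule sum.cong) (auto simp: E_def BF simp del: index_mult_mat(1))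
    also have "\<dots> = 1" using ij by simp
    finally show "(E * (B * F)) $$ (a, b) = 1\<^sub>m 1 $$ (a, b)" using ab by simp
  qed (auto simp: E_def F_def)
  define u where "u = E - E * (A * (R * L))"
  define v where "v = F - R * (L * (A * F))"
  have duv [simp]: "dim_row u = 1" "dim_col u = m" "dim_row v = n" "dim_col v = 1" by (auto simp: u_def v_def)
  have uA: "u * A = E * B" unfolding u_def B_def
    by (simp add: mat_diff_right mat_diff_left mat_assoc)
  have "A * v = B * F" unfolding v_def B_def
    by (simp add: mat_diff_right mat_diff_left mat_assoc)
  hence LAv: "L * (A * v) = 0\<^sub>m r 1" using LB by (simp add: mat_assoc[symmetric])
  have uAR: "u * A * R = 0\<^sub>m 1 r" unfolding uA using BR by (simp add: mat_assoc)
  have "u * A * v = E * (B * F) - E * ((B * R) * (L * (A * F)))" unfolding uA v_def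
    by (simp add: mat_diff_left mat_assoc)
  hence uAv: "u * A * v = 1\<^sub>m 1" unfolding EBF BR by (intro eq_matI) auto
  have "vst L u * A * hst R v = four_block_mat (L * A * R) (L * A * v) (u * A * R) (u * A * v)"
    by (subst vst_mult) (simp_all add: vst_hst_mult)
  also have "\<dots> = 1\<^sub>m (r + 1)" unfolding assms(3) uAR uAv using LAv by (simp add: mat_assoc)
  finally have "r + 1 \<le> mrank A"
    by (intro rkgeI[of "vst L u" _ _ "hst R v"]) auto
  thus False using assms(4) by simp
qed

text \<open>With \<open>L (T e) R = 1\<close> for the maximal size, \<open>v - R (L T R)\<^sup>-\<^sup>1 L T v\<close> lies in the kernel of \<open>T x\<close>
  whenever the rank does not jump.\<close>

lemma kernel_path:
  assumes T: "regular_mat_at e T" "T e \<in> carrier_mat nr nc"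
    and v0: "v0 \<in> carrier_mat nc 1" "T e * v0 = 0\<^sub>m nr 1"
    and rk: "\<forall>\<^sub>F x in cofinite. mrank (T x) \<le> mrank (T e)"
  obtains v where "regular_mat_at e v" "\<And>x. v x \<in> carrier_mat nc 1" "v e = v0"
    "\<forall>\<^sub>F x in cofinite. T x * v x = 0\<^sub>m nr 1"
proof -
  note TD = regular_mat_atD(1)[OF T]
  have dT [simp]: "dim_row (T x) = nr" "dim_col (T x) = nc" for x using TD[of x] by auto
  have dv0 [simp]: "dim_row v0 = nc" "dim_col v0 = 1" using v0 by auto
  define r where "r = mrank (T e)"
  obtain L R where LR: "L \<in> carrier_mat r nr" "R \<in> carrier_mat nc r" "L * T e * R = 1\<^sub>m r"
    using mrank_witness[of "T e"] T(2) unfolding r_def by (metis carrier_matD)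
  have dLR [simp]: "dim_row L = r" "dim_col L = nr" "dim_row R = nc" "dim_col R = r" using LR by auto
  define S where "S x = L * T x * R" for x
  have S: "S x \<in> carrier_mat r r" for x unfolding S_def using LR TD[of x] by auto
  have dS [simp]: "dim_row (S x) = r" "dim_col (S x) = r" for x using S[of x] by auto
  have regS: "regular_mat_at e S" unfolding S_def
    by (intro regular_mat_at_mult regular_mat_at_const T(1)) auto
  have detS: "det (S e) \<noteq> 0" unfolding S_def LR(3) by simp
  note regSi = regular_mat_at_inv[OF regS S detS]
  have dSi [simp]: "dim_row (mat_inv (S x)) = r" "dim_col (mat_inv (S x)) = r" for x
    unfolding mat_inv_def using adj_mat(1)[OF S[of x]] by auto
  define v where "v x = v0 + (- R) * (mat_inv (S x) * (L * (T x * v0)))" for x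
  have "- R \<in> carrier_mat nc r" using LR by auto
  hence "regular_mat_at e v" unfolding v_def
    by (intro regular_mat_at_add regular_mat_at_mult regular_mat_at_const regSi T(1)) auto
  moreover have "v x \<in> carrier_mat nc 1" for x unfolding v_def by (auto intro!: carrier_matI)
  moreover have "v e = v0" unfolding v_def v0(2) by (simp, intro eq_matI) auto
  moreover have "\<forall>\<^sub>F x in cofinite. T x * v x = 0\<^sub>m nr 1"
    using rk regular_at_nonzero_cofinite[OF regular_at_det[OF regS S] detS]
  proof eventually_elim
    case (elim x)
    note i = mat_inv[OF S elim(2)]
    have "mat_inv (S x) * L * T x * R = mat_inv (S x) * (L * T x * R)" by (simp add: mat_assoc)
    also have "\<dots> = 1\<^sub>m r" using i(3) by (simp only: S_def[symmetric])
    finally have "mat_inv (S x) * L * T x * R = 1\<^sub>m r" .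
    moreover have "mat_inv (S x) * L \<in> carrier_mat r (dim_row (T x))" "R \<in> carrier_mat (dim_col (T x)) r"
      by (intro carrier_matI; simp)+
    ultimately have "T x * R * (mat_inv (S x) * L) * T x = T x"
      using elim(1) unfolding r_def[symmetric] by (intro mrank_absorb)
    hence *: "T x * (R * (mat_inv (S x) * (L * T x))) = T x" by (simp add: mat_assoc)
    have "(T x * (R * (mat_inv (S x) * (L * T x)))) * v0 = T x * v0" unfolding * ..
    hence **: "T x * (R * (mat_inv (S x) * (L * (T x * v0)))) = T x * v0" by (simp add: mat_assoc)
    have "T x * v x = T x * v0 + T x * (- (R * (mat_inv (S x) * (L * (T x * v0)))))"
      unfolding v_def by (simp add: mat_distrib_left uminus_mult_left_mat)
    also have "\<dots> = T x * v0 + - (T x * (R * (mat_inv (S x) * (L * (T x * v0)))))"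
      by (simp add: uminus_mult_right_mat)
    also have "\<dots> = 0\<^sub>m nr 1" unfolding ** by (intro eq_matI) (auto simp del: index_mult_mat(1))
    finally show ?case .
  qed
  ultimately show ?thesis by (rule that)
qed

section \<open>Nilpotent matrices and partitions\<close>

lemma pow_mat_intertwine:
  fixes A B C :: "'k::field mat"
  assumes "A \<in> carrier_mat m m" "B \<in> carrier_mat n n" "C \<in> carrier_mat m n" "A * C = C * B"
  shows "A ^\<^sub>m j * C = C * B ^\<^sub>m j"
proof (induction j)
  case (Suc j)
  have d: "dim_row A = m" "dim_col A = m" "dim_row B = n" "dim_col B = n" "dim_row C = m" "dim_col C = n"
    using assms by auto
  have "A ^\<^sub>m Suc j * C = A ^\<^sub>m j * (A * C)" using d by (simp add: mat_assoc)
  also have "\<dots> = (A ^\<^sub>m j * C) * B" unfolding assms(4) using d by (simp add: mat_assoc)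
  also have "\<dots> = C * B ^\<^sub>m Suc j" unfolding Suc using d by (simp add: mat_assoc)
  finally show ?case .
qed (use assms in auto)

lemma pow_mat_add:
  fixes A :: "'k::semiring_1 mat"
  assumes "A \<in> carrier_mat n n"
  shows "A ^\<^sub>m (i + j) = A ^\<^sub>m i * A ^\<^sub>m j"
proof (induction j)
  case (Suc j)
  have "dim_row A = n" "dim_col A = n" using assms by auto
  thus ?case using Suc by (simp add: mat_assoc)
qed (use assms in auto)

lemma pow_mat_zero_mono:
  fixes A :: "'k::semiring_1 mat"
  assumes "A \<in> carrier_mat n n" "A ^\<^sub>m e = 0\<^sub>m n n" "e \<le> e'"
  shows "A ^\<^sub>m e' = 0\<^sub>m n n"
  using pow_mat_add[OF assms(1), of e "e' - e"] assms by simp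

definition diagram :: "('i \<Rightarrow> nat) \<Rightarrow> ('i \<times> nat) set" where
  "diagram p = {(i, q). q < p i}"

text \<open>The basis vector with label \<open>(i, Suc q)\<close> is sent to the one with label \<open>(i, q)\<close>.\<close>

definition shift_mat :: "nat \<Rightarrow> (nat \<Rightarrow> 'i \<times> nat) \<Rightarrow> 'k::{zero,one} mat" where
  "shift_mat n \<beta> = mat n n (\<lambda>(r, c). if \<beta> c = (fst (\<beta> r), Suc (snd (\<beta> r))) then 1 else 0)"

lemma shift_mat_carrier [simp]: "shift_mat n \<beta> \<in> carrier_mat n n"
  and shift_mat_dim [simp]: "dim_row (shift_mat n \<beta>) = n" "dim_col (shift_mat n \<beta>) = n"
  by (auto simp: shift_mat_def)

lemma finite_diagram_frame: "bij_betw \<beta> {..<n::nat} (diagram p) \<Longrightarrow> finite (diagram p)"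
  using bij_betw_finite by blast

lemma finite_support_of_diagram:
  assumes "finite (diagram p)" shows "finite {i. p i \<noteq> (0::nat)}"
proof -
  have "{i. p i \<noteq> 0} \<subseteq> fst ` diagram p" by (force simp: diagram_def image_iff)
  thus ?thesis using assms finite_subset by blast
qed

lemma finite_diagram:
  assumes "finite {i. p i \<noteq> (0::nat)}" shows "finite (diagram p)"
proof -
  have "diagram p = (SIGMA i:{i. p i \<noteq> 0}. {..<p i})" by (auto simp: diagram_def)
  thus ?thesis using assms by simp
qed

lemma shift_mat_pow:
  assumes "bij_betw \<beta> {..<n} (diagram p)"
  shows "(shift_mat n \<beta> :: 'k::field mat) ^\<^sub>m j =
    mat n n (\<lambda>(r, c). if \<beta> c = (fst (\<beta> r), snd (\<beta> r) + j) then 1 else 0)"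
proof (induction j)
  case 0
  have "inj_on \<beta> {..<n}" using assms bij_betw_def by blast
  thus ?case by (intro eq_matI) (auto simp: inj_on_def)
next
  case (Suc j)
  note fin = finite_diagram_frame[OF assms]
  show ?case
  proof (rule eq_matI)
    fix r c assume "r < dim_row (mat n n (\<lambda>(r, c). if \<beta> c = (fst (\<beta> r), snd (\<beta> r) + Suc j) then 1 else 0 :: 'k))"
      "c < dim_col (mat n n (\<lambda>(r, c). if \<beta> c = (fst (\<beta> r), snd (\<beta> r) + Suc j) then 1 else 0 :: 'k))"
    hence rc: "r < n" "c < n" by auto
    have cD: "\<beta> c \<in> diagram p" using assms rc by (auto simp: bij_betw_def)
    have "(shift_mat n \<beta> ^\<^sub>m Suc j :: 'k mat) $$ (r, c) = (\<Sum>l<n.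
        (if \<beta> l = (fst (\<beta> r), snd (\<beta> r) + j) then 1 else 0) *
        (if \<beta> c = (fst (\<beta> l), Suc (snd (\<beta> l))) then 1 else 0))"
      unfolding pow_mat.simps Suc using rc
      by (subst index_mult_sum) (auto simp: shift_mat_def intro!: sum.cong)
    also have "\<dots> = (\<Sum>x\<in>diagram p.
        (if x = (fst (\<beta> r), snd (\<beta> r) + j) then 1 else 0) *
        (if \<beta> c = (fst x, Suc (snd x)) then 1 else 0))"
      by (rule sum.reindex_bij_betw[OF assms])
    also have "\<dots> = (if \<beta> c = (fst (\<beta> r), snd (\<beta> r) + Suc j) then 1 else 0)"
      using cD fin by (auto simp: sum_mult_delta diagram_def)
    finally show "(shift_mat n \<beta> ^\<^sub>m Suc j :: 'k mat) $$ (r, c) =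
      mat n n (\<lambda>(r, c). if \<beta> c = (fst (\<beta> r), snd (\<beta> r) + Suc j) then 1 else 0) $$ (r, c)"
      using rc by simp
  qed auto
qed

definition excess :: "('i \<Rightarrow> nat) \<Rightarrow> nat \<Rightarrow> nat" where
  "excess p j = (\<Sum>i | p i \<noteq> 0. p i - j)"

lemma excess_eq_sum:
  assumes "finite I" "{i. p i \<noteq> 0} \<subseteq> I"
  shows "excess p j = (\<Sum>i\<in>I. p i - j)"
  unfolding excess_def using assms by (intro sum.mono_neutral_left) auto

lemma excess_eq_card:
  assumes "finite (diagram p)"
  shows "excess p j = card {(i, q). q + j < p i}"
proof -
  have "{(i, q). q + j < p i} = (SIGMA i:{i. p i \<noteq> 0}. {..<p i - j})" by auto
  thus ?thesis unfolding excess_def using finite_support_of_diagram[OF assms] by (simp add: card_SigmaI)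
qed

lemma card_diagram:
  assumes "bij_betw \<beta> {..<n} (diagram p)" shows "excess p 0 = n"
  using bij_betw_same_card[OF assms] excess_eq_card[OF finite_diagram_frame[OF assms], of 0]
  by (simp add: diagram_def)

text \<open>Factorisation of a power of a shift matrix through the labels on which it does not vanish.\<close>

lemma mrank_shift_mat_pow:
  assumes "bij_betw \<beta> {..<n} (diagram p)"
  shows "mrank ((shift_mat n \<beta> :: 'k::field mat) ^\<^sub>m j) = excess p j"
proof -
  define K where "K = {(i, q). q + j < p i}"
  note fin = finite_diagram_frame[OF assms]
  have KD: "K \<subseteq> diagram p" by (auto simp: K_def diagram_def)
  hence finK: "finite K" using fin finite_subset by blast
  define r where "r = card K"
  have r: "r = excess p j" unfolding r_def K_def excess_eq_card[OF fin] ..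
  obtain \<gamma> where \<gamma>: "bij_betw \<gamma> {..<r} K" unfolding r_def
    using ex_bij_betw_nat_finite[OF finK] by (auto simp: atLeast0LessThan)
  have \<gamma>K: "\<gamma> a \<in> K" if "a < r" for a using \<gamma> that by (auto simp: bij_betw_def)
  have \<gamma>inj: "\<gamma> a = \<gamma> b \<longleftrightarrow> a = b" if "a < r" "b < r" for a b
    using \<gamma> that by (auto simp: bij_betw_def inj_on_def)
  let ?s = "\<lambda>x. (fst x, snd x + j)"
  define Y :: "'k mat" where "Y = mat n r (\<lambda>(l, b). if \<beta> l = \<gamma> b then 1 else 0)"
  define Z :: "'k mat" where "Z = mat r n (\<lambda>(b, l). if \<beta> l = ?s (\<gamma> b) then 1 else 0)"
  define L :: "'k mat" where "L = mat r n (\<lambda>(b, l). if \<beta> l = \<gamma> b then 1 else 0)"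
  define R :: "'k mat" where "R = mat n r (\<lambda>(l, b). if \<beta> l = ?s (\<gamma> b) then 1 else 0)"
  have LY: "L * Y = 1\<^sub>m r"
  proof (rule eq_matI)
    fix a b assume "a < dim_row (1\<^sub>m r :: 'k mat)" "b < dim_col (1\<^sub>m r :: 'k mat)"
    hence ab: "a < r" "b < r" by auto
    have "(L * Y) $$ (a, b) = (\<Sum>l<n. (if \<beta> l = \<gamma> a then 1 else 0) * (if \<beta> l = \<gamma> b then 1 else 0))"
      using ab by (subst index_mult_sum) (auto simp: L_def Y_def intro!: sum.cong)
    also have "\<dots> = (\<Sum>x\<in>diagram p. (if x = \<gamma> a then 1 else 0) * (if x = \<gamma> b then 1 else 0))"
      by (rule sum.reindex_bij_betw[OF assms])
    also have "\<dots> = 1\<^sub>m r $$ (a, b)"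
      using ab fin \<gamma>K[OF ab(1)] KD \<gamma>inj by (auto simp: sum_mult_delta)
    finally show "(L * Y) $$ (a, b) = 1\<^sub>m r $$ (a, b)" .
  qed (auto simp: L_def Y_def)
  have ZR: "Z * R = 1\<^sub>m r"
  proof (rule eq_matI)
    fix a b assume "a < dim_row (1\<^sub>m r :: 'k mat)" "b < dim_col (1\<^sub>m r :: 'k mat)"
    hence ab: "a < r" "b < r" by auto
    have "(Z * R) $$ (a, b) = (\<Sum>l<n. (if \<beta> l = ?s (\<gamma> a) then 1 else 0) * (if \<beta> l = ?s (\<gamma> b) then 1 else 0))"
      using ab by (subst index_mult_sum) (auto simp: Z_def R_def intro!: sum.cong)
    also have "\<dots> = (\<Sum>x\<in>diagram p. (if x = ?s (\<gamma> a) then 1 else 0) * (if x = ?s (\<gamma> b) then 1 else 0))"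
      by (rule sum.reindex_bij_betw[OF assms])
    also have "\<dots> = (if ?s (\<gamma> a) = ?s (\<gamma> b) then 1 else 0)"
      using fin \<gamma>K[OF ab(1)] by (auto simp: sum_mult_delta K_def diagram_def)
    also have "\<dots> = 1\<^sub>m r $$ (a, b)"
      using ab \<gamma>inj[OF ab] by (auto simp: prod_eq_iff)
    finally show "(Z * R) $$ (a, b) = 1\<^sub>m r $$ (a, b)" .
  qed (auto simp: Z_def R_def)
  have "(shift_mat n \<beta> :: 'k mat) ^\<^sub>m j = Y * Z" unfolding shift_mat_pow[OF assms]
  proof (rule eq_matI)
    fix a c assume "a < dim_row (Y * Z)" "c < dim_col (Y * Z)"
    hence ac: "a < n" "c < n" by (auto simp: Y_def Z_def)
    have cD: "\<beta> c \<in> diagram p" using assms ac by (auto simp: bij_betw_def)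
    have "(Y * Z) $$ (a, c) = (\<Sum>b<r. (if \<beta> a = \<gamma> b then 1 else 0) * (if \<beta> c = ?s (\<gamma> b) then 1 else 0))"
      using ac by (subst index_mult_sum) (auto simp: Y_def Z_def intro!: sum.cong)
    also have "\<dots> = (\<Sum>x\<in>K. (if \<beta> a = x then 1 else 0) * (if \<beta> c = ?s x then 1 else 0))"
      by (rule sum.reindex_bij_betw[OF \<gamma>])
    also have "\<dots> = (if \<beta> c = ?s (\<beta> a) then 1 else 0)"
      using finK cD by (auto simp: sum_mult_delta K_def diagram_def)
    finally show "mat n n (\<lambda>(r, c). if \<beta> c = (fst (\<beta> r), snd (\<beta> r) + j) then 1 else 0) $$ (a, c) = (Y * Z) $$ (a, c)"
      using ac by simp
  qed (auto simp: Y_def Z_def)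
  moreover have "mrank (Y * Z) = r"
    by (rule mrank_eqI[OF _ _ _ _ LY ZR]) (auto simp: Y_def Z_def L_def R_def)
  ultimately show ?thesis using r by simp
qed

lemma shift_mat_similar:
  assumes "bij_betw \<beta> {..<n} (diagram p)" "bij_betw \<beta>' {..<n} (diagram p)"
  shows "similar_mat (shift_mat n \<beta> :: 'k::field mat) (shift_mat n \<beta>')"
proof -
  define P where "P \<beta> \<beta>' = (mat n n (\<lambda>(r, c). if \<beta>' c = \<beta> r then 1 else 0) :: 'k mat)"
    for \<beta> \<beta>' :: "nat \<Rightarrow> 'a \<times> nat"
  note fin = finite_diagram_frame[OF assms(1)]
  have PP: "P \<beta> \<beta>' * P \<beta>' \<beta> = 1\<^sub>m n"
    if b: "bij_betw \<beta> {..<n} (diagram p)" "bij_betw \<beta>' {..<n} (diagram p)" for \<beta> \<beta>'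
  proof (rule eq_matI)
    fix a c assume "a < dim_row (1\<^sub>m n :: 'k mat)" "c < dim_col (1\<^sub>m n :: 'k mat)"
    hence ac: "a < n" "c < n" by auto
    have "(P \<beta> \<beta>' * P \<beta>' \<beta>) $$ (a, c) = (\<Sum>l<n. (if \<beta>' l = \<beta> a then 1 else 0) * (if \<beta> c = \<beta>' l then 1 else 0))"
      using ac by (subst index_mult_sum) (auto simp: P_def intro!: sum.cong)
    also have "\<dots> = (\<Sum>x\<in>diagram p. (if x = \<beta> a then 1 else 0) * (if \<beta> c = x then 1 else 0))"
      by (rule sum.reindex_bij_betw[OF b(2)])
    also have "\<dots> = 1\<^sub>m n $$ (a, c)"
      using fin ac b(1) by (auto simp: sum_mult_delta bij_betw_def inj_on_def)
    finally show "(P \<beta> \<beta>' * P \<beta>' \<beta>) $$ (a, c) = 1\<^sub>m n $$ (a, c)" .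
  qed (auto simp: P_def)
  have SP: "shift_mat n \<beta> * P \<beta> \<beta>' = P \<beta> \<beta>' * shift_mat n \<beta>'"
  proof (rule eq_matI)
    fix a c assume "a < dim_row (P \<beta> \<beta>' * shift_mat n \<beta>')" "c < dim_col (P \<beta> \<beta>' * shift_mat n \<beta>')"
    hence ac: "a < n" "c < n" by (auto simp: P_def)
    have mem: "\<beta> a \<in> diagram p" "\<beta>' c \<in> diagram p" using assms ac by (auto simp: bij_betw_def)
    have "(shift_mat n \<beta> * P \<beta> \<beta>') $$ (a, c) =
      (\<Sum>l<n. (if \<beta> l = (fst (\<beta> a), Suc (snd (\<beta> a))) then 1 else 0) * (if \<beta>' c = \<beta> l then 1 else 0))"
      using ac by (subst index_mult_sum) (auto simp: P_def shift_mat_def intro!: sum.cong)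
    also have "\<dots> = (\<Sum>x\<in>diagram p. (if x = (fst (\<beta> a), Suc (snd (\<beta> a))) then 1 else 0) * (if \<beta>' c = x then 1 else 0))"
      by (rule sum.reindex_bij_betw[OF assms(1)])
    also have "\<dots> = (if \<beta>' c = (fst (\<beta> a), Suc (snd (\<beta> a))) then 1 else 0)"
      using fin mem by (auto simp: sum_mult_delta)
    also have "\<dots> = (\<Sum>x\<in>diagram p. (if x = \<beta> a then 1 else 0) * (if \<beta>' c = (fst x, Suc (snd x)) then 1 else 0))"
      using fin mem by (auto simp: sum_mult_delta)
    also have "\<dots> = (\<Sum>l<n. (if \<beta>' l = \<beta> a then 1 else 0) * (if \<beta>' c = (fst (\<beta>' l), Suc (snd (\<beta>' l))) then 1 else 0))"
      by (rule sum.reindex_bij_betw[OF assms(2), symmetric])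
    also have "\<dots> = (P \<beta> \<beta>' * shift_mat n \<beta>') $$ (a, c)"
      using ac by (subst index_mult_sum) (auto simp: P_def shift_mat_def intro!: sum.cong)
    finally show "(shift_mat n \<beta> * P \<beta> \<beta>') $$ (a, c) = (P \<beta> \<beta>' * shift_mat n \<beta>') $$ (a, c)" .
  qed (auto simp: P_def)
  have dP: "dim_row (P \<beta> \<beta>') = n" "dim_col (P \<beta> \<beta>') = n" for \<beta> \<beta>' by (auto simp: P_def)
  have "P \<beta> \<beta>' * shift_mat n \<beta>' * P \<beta>' \<beta> = shift_mat n \<beta>"
    unfolding SP[symmetric] using PP[OF assms] dP by (simp add: mat_assoc)
  thus ?thesis
    by (intro similar_matI[of _ _ "P \<beta> \<beta>'" "P \<beta>' \<beta>" n] PP assms) (auto simp: P_def)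
qed

definition jordan_shape :: "'k::field mat \<Rightarrow> ('i \<Rightarrow> nat) \<Rightarrow> bool" where
  "jordan_shape N p \<longleftrightarrow> (\<exists>n \<beta>. bij_betw \<beta> {..<n} (diagram p) \<and> similar_mat N (shift_mat n \<beta>))"

lemma jordan_shape_similar: "similar_mat N N' \<Longrightarrow> jordan_shape N' p \<Longrightarrow> jordan_shape N p"
  unfolding jordan_shape_def using similar_mat_trans by blast

lemma jordan_shape_shift_mat:
  assumes "jordan_shape N p" "bij_betw \<beta> {..<n} (diagram p)"
  shows "similar_mat N (shift_mat n \<beta>)"
proof -
  obtain n' \<beta>' where *: "bij_betw \<beta>' {..<n'} (diagram p)" "similar_mat N (shift_mat n' \<beta>')"
    using assms(1) unfolding jordan_shape_def by blast
  have "n' = n" using card_diagram[OF *(1)] card_diagram[OF assms(2)] by simp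
  thus ?thesis using * shift_mat_similar[of \<beta>' n p \<beta>] assms(2) similar_mat_trans by blast
qed

lemma jordan_shape_unique_similar:
  assumes "jordan_shape N p" "jordan_shape N' p" shows "similar_mat N N'"
proof -
  obtain n' \<beta>' where *: "bij_betw \<beta>' {..<n'} (diagram p)" "similar_mat N' (shift_mat n' \<beta>')"
    using assms(2) unfolding jordan_shape_def by blast
  show ?thesis
    using similar_mat_trans[OF jordan_shape_shift_mat[OF assms(1) *(1)] similar_mat_sym[OF *(2)]] .
qed

lemma jordan_shape_mrank:
  assumes "jordan_shape N p" shows "mrank (N ^\<^sub>m j) = excess p j"
proof -
  obtain n \<beta> where *: "bij_betw \<beta> {..<n} (diagram p)" "similar_mat N (shift_mat n \<beta>)"
    using assms unfolding jordan_shape_def by blast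
  have "similar_mat (N ^\<^sub>m j) (shift_mat n \<beta> ^\<^sub>m j)"
    using *(2) similar_mat_wit_pow unfolding similar_mat_def by blast
  thus ?thesis using mrank_similar mrank_shift_mat_pow[OF *(1)] by metis
qed

lemma jordan_shape_reindex:
  assumes "jordan_shape N p" "inj_on \<iota> {i. p i \<noteq> 0}" "\<iota> ` {i. p i \<noteq> 0} = {i. p' i \<noteq> 0}"
    and "\<And>i. p i \<noteq> 0 \<Longrightarrow> p' (\<iota> i) = p i"
  shows "jordan_shape N p'"
proof -
  obtain n \<beta> where *: "bij_betw \<beta> {..<n} (diagram p)" "similar_mat N (shift_mat n \<beta>)"
    using assms(1) unfolding jordan_shape_def by blast
  let ?m = "\<lambda>x. (\<iota> (fst x), snd x)"
  have b: "bij_betw ?m (diagram p) (diagram p')"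
    unfolding bij_betw_def
  proof
    show inj: "inj_on ?m (diagram p)" using assms(2) by (auto simp: inj_on_def diagram_def)
    show "?m ` diagram p = diagram p'"
    proof (intro equalityI subsetI)
      fix x assume "x \<in> ?m ` diagram p"
      thus "x \<in> diagram p'" using assms(4) by (auto simp: diagram_def)
    next
      fix x assume x: "x \<in> diagram p'"
      hence "p' (fst x) \<noteq> 0" by (auto simp: diagram_def)
      then obtain i where i: "p i \<noteq> 0" "\<iota> i = fst x" using assms(3) by (metis (mono_tags, lifting) imageE mem_Collect_eq)
      hence "(i, snd x) \<in> diagram p" "x = ?m (i, snd x)" using x assms(4)[OF i(1)] by (auto simp: diagram_def)
      thus "x \<in> ?m ` diagram p" by blast
    qed
  qed
  have "shift_mat n (?m \<circ> \<beta>) = (shift_mat n \<beta> :: 'a mat)"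
  proof (rule eq_matI)
    fix r c assume "r < dim_row (shift_mat n \<beta> :: 'a mat)" "c < dim_col (shift_mat n \<beta> :: 'a mat)"
    hence rc: "r < n" "c < n" by auto
    have "\<beta> r \<in> diagram p" "\<beta> c \<in> diagram p" using rc *(1) by (auto simp: bij_betw_def)
    hence "\<iota> (fst (\<beta> c)) = \<iota> (fst (\<beta> r)) \<longleftrightarrow> fst (\<beta> c) = fst (\<beta> r)"
      using assms(2) by (auto simp: inj_on_def diagram_def)
    thus "shift_mat n (?m \<circ> \<beta>) $$ (r, c) = (shift_mat n \<beta> :: 'a mat) $$ (r, c)"
      using rc by (simp add: shift_mat_def prod_eq_iff)
  qed auto
  moreover have "bij_betw (?m \<circ> \<beta>) {..<n} (diagram p')" using bij_betw_trans[OF *(1) b] .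
  ultimately show ?thesis using *(2) unfolding jordan_shape_def by metis
qed

lemma jordan_matrix_shift_mat:
  "\<exists>\<beta>. bij_betw \<beta> {..<sum_list ms} (diagram (\<lambda>i. if i < length ms then ms ! i else 0)) \<and>
     (jordan_matrix (map (\<lambda>m. (m, 0)) ms) :: 'k::field mat) = shift_mat (sum_list ms) \<beta>"
proof (induction ms rule: rev_induct)
  case Nil
  have "jordan_matrix [] = (shift_mat 0 (\<lambda>_. undefined) :: 'k mat)"
    by (intro eq_matI) (auto simp: jordan_matrix_def)
  thus ?case by (auto simp: diagram_def bij_betw_def)
next
  case (snoc m ms)
  let ?S = "sum_list ms" and ?l = "length ms"
  let ?p = "\<lambda>i. if i < length ms then ms ! i else 0"
  let ?p' = "\<lambda>i. if i < length (ms @ [m]) then (ms @ [m]) ! i else 0"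
  obtain \<beta> where \<beta>: "bij_betw \<beta> {..<?S} (diagram ?p)"
    "(jordan_matrix (map (\<lambda>m. (m, 0)) ms) :: 'k mat) = shift_mat ?S \<beta>" using snoc by blast
  define \<beta>' where "\<beta>' l = (if l < ?S then \<beta> l else (?l, l - ?S))" for l
  have memb: "fst (\<beta> l) < ?l" if "l < ?S" for l
    using bij_betwE[OF \<beta>(1)] that by (force simp: diagram_def split: if_splits)
  have split: "{..<?S + m} = {..<?S} \<union> {?S..<?S + m}" by auto
  have D: "diagram ?p' = diagram ?p \<union> {?l} \<times> {..<m}"
    by (auto simp: diagram_def nth_append split: if_splits)
  have "bij_betw \<beta>' {..<?S} (diagram ?p)" using \<beta>(1) by (rule bij_betw_cong[THEN iffD1, rotated]) (auto simp: \<beta>'_def)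
  moreover have "bij_betw \<beta>' {?S..<?S + m} ({?l} \<times> {..<m})"
    by (rule bij_betw_byWitness[where f' = "\<lambda>x. ?S + snd x"]) (auto simp: \<beta>'_def)
  ultimately have bij: "bij_betw \<beta>' {..<?S + m} (diagram ?p')" unfolding split D
    by (rule bij_betw_combine) (auto simp: diagram_def)
  have "jordan_matrix (map (\<lambda>m. (m, 0)) (ms @ [m])) =
    four_block_mat (shift_mat ?S \<beta>) (0\<^sub>m ?S m) (0\<^sub>m m ?S) (jordan_block m (0 :: 'k))"
  proof -
    have "jordan_matrix (map (\<lambda>m. (m, 0 :: 'k)) [m]) = jordan_block m 0"
      by (intro eq_matI) (auto simp: jordan_matrix_def)
    moreover have "jordan_matrix (xs @ ys) = four_block_mat (jordan_matrix xs)
        (0\<^sub>m (dim_row (jordan_matrix xs)) (dim_col (jordan_matrix ys)))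
        (0\<^sub>m (dim_row (jordan_matrix ys)) (dim_col (jordan_matrix xs))) (jordan_matrix ys :: 'k mat)" for xs ys
      unfolding jordan_matrix_def map_append diag_block_mat_append Let_def ..
    ultimately show ?thesis using \<beta>(2) by (simp del: jordan_matrix_dim)
  qed
  also have "\<dots> = shift_mat (?S + m) \<beta>'"
  proof (rule eq_matI)
    fix r c assume "r < dim_row (shift_mat (?S + m) \<beta>' :: 'k mat)" "c < dim_col (shift_mat (?S + m) \<beta>' :: 'k mat)"
    hence rc: "r < ?S + m" "c < ?S + m" by auto
    have "fst (\<beta> r) \<noteq> ?l" if "r < ?S" using memb[OF that] by simp
    moreover have "fst (\<beta> c) \<noteq> ?l" if "c < ?S" using memb[OF that] by simp
    ultimately show "four_block_mat (shift_mat ?S \<beta>) (0\<^sub>m ?S m) (0\<^sub>m m ?S) (jordan_block m 0) $$ (r, c) =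
      (shift_mat (?S + m) \<beta>' :: 'k mat) $$ (r, c)"
      using rc by (cases "r < ?S"; cases "c < ?S")
        (auto simp: \<beta>'_def shift_mat_def jordan_block_def prod_eq_iff)
  qed auto
  finally show ?case using bij by auto
qed

lemma partition_antimono: "partition p \<Longrightarrow> i \<le> j \<Longrightarrow> p j \<le> p i"
  unfolding partition_def using lift_Suc_antimono_le[of p] by blast

lemma partition_support:
  assumes "partition p" shows "{i. p i \<noteq> 0} = {..<num_parts p}"
proof -
  have fin: "finite {i. p i \<noteq> 0}" using assms unfolding partition_def by blast
  have "\<exists>m. {i. p i \<noteq> 0} = {..<m}"
  proof (rule exI[of _ "LEAST i. p i = 0"], intro equalityI subsetI)
    have ex: "\<exists>i. p i = 0" using fin by (metis (mono_tags, lifting) Collect_cong ex_new_if_finite infinite_UNIV_nat mem_Collect_eq)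
    show "i \<in> {..<LEAST i. p i = 0}" if "i \<in> {i. p i \<noteq> 0}" for i
    proof (rule ccontr)
      assume "i \<notin> {..<LEAST i. p i = 0}"
      hence "p i \<le> p (LEAST i. p i = 0)" by (intro partition_antimono[OF assms]) auto
      thus False using that LeastI_ex[OF ex] by simp
    qed
    show "i \<in> {i. p i \<noteq> 0}" if "i \<in> {..<LEAST i. p i = 0}" for i
      using that not_less_Least[of i "\<lambda>i. p i = 0"] by simp
  qed
  then obtain m where m: "{i. p i \<noteq> 0} = {..<m}" by blast
  hence "num_parts p = m" unfolding num_parts_def by simp
  thus ?thesis using m by simp
qed

lemma partition_nonzero_iff: "partition p \<Longrightarrow> p i \<noteq> 0 \<longleftrightarrow> i < num_parts p"
  using partition_support[of p] by blast

lemma jordan_shape_jordan_matrix: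
  assumes "partition p"
  shows "jordan_shape (jordan_matrix (map (\<lambda>i. (p i, 0)) [0..<num_parts p]) :: 'k::field mat) p"
proof -
  let ?ms = "map p [0..<num_parts p]"
  obtain \<beta> where \<beta>: "bij_betw \<beta> {..<sum_list ?ms} (diagram (\<lambda>i. if i < length ?ms then ?ms ! i else 0))"
    "(jordan_matrix (map (\<lambda>m. (m, 0)) ?ms) :: 'k mat) = shift_mat (sum_list ?ms) \<beta>"
    using jordan_matrix_shift_mat[of ?ms] by blast
  have "p i = 0" if "\<not> i < num_parts p" for i using partition_nonzero_iff[OF assms] that by blast
  hence p: "(\<lambda>i. if i < length ?ms then ?ms ! i else 0) = p" by auto
  have "map (\<lambda>m. (m, 0 :: 'k)) ?ms = map (\<lambda>i. (p i, 0)) [0..<num_parts p]" by simp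
  hence "similar_mat (jordan_matrix (map (\<lambda>i. (p i, 0)) [0..<num_parts p]) :: 'k mat) (shift_mat (sum_list ?ms) \<beta>)"
    using \<beta>(2) similar_mat_refl[OF shift_mat_carrier] by (simp add: comp_def)
  thus ?thesis using \<beta>(1) unfolding jordan_shape_def p by blast
qed

lemma jordan_type_iff: "jordan_type N p \<longleftrightarrow> partition p \<and> jordan_shape N p"
proof (cases "partition p")
  case True
  let ?J = "jordan_matrix (map (\<lambda>i. (p i, 0)) [0..<num_parts p]) :: 'a mat"
  have "0 \<notin> fst ` set (map (\<lambda>i. (p i, 0 :: 'a)) [0..<num_parts p])"
  proof
    assume "0 \<in> fst ` set (map (\<lambda>i. (p i, 0 :: 'a)) [0..<num_parts p])"
    then obtain i where "i < num_parts p" "p i = 0" by auto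
    thus False using partition_nonzero_iff[OF True, of i] by simp
  qed
  hence "jordan_type N p \<longleftrightarrow> similar_mat N ?J" using True by (simp only: jordan_type_def jordan_nf_def simp_thms)
  also have "\<dots> \<longleftrightarrow> jordan_shape N p"
    using jordan_shape_similar[OF _ jordan_shape_jordan_matrix[OF True]]
      jordan_shape_unique_similar[OF _ jordan_shape_jordan_matrix[OF True]] by metis
  finally show ?thesis using True by simp
qed (auto simp: jordan_type_def)


lemma first_column_completion:
  fixes v :: "'k::field vec"
  assumes "v \<in> carrier_vec n" "v \<noteq> 0\<^sub>v n"
  obtains P Q where "P \<in> carrier_mat n n" "Q \<in> carrier_mat n n" "P * Q = 1\<^sub>m n" "Q * P = 1\<^sub>m n"
    "\<And>i. i < n \<Longrightarrow> P $$ (i, 0) = v $ i"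
proof -
  obtain i where i: "i < n" "v $ i \<noteq> 0" using assms by (metis carrier_vecD eq_vecI index_zero_vec)
  define \<sigma> where "\<sigma> = Transposition.transpose 0 i"
  have \<sigma>: "\<sigma> permutes {..<n}" unfolding \<sigma>_def using i by (intro permutes_swap_id) auto
  have \<sigma>0: "\<sigma> 0 = i" by (simp add: \<sigma>_def)
  have inj: "\<sigma> a = \<sigma> b \<longleftrightarrow> a = b" for a b using permutes_inj[OF \<sigma>] by (auto dest: injD)
  have \<sigma>\<sigma>: "\<sigma> (\<sigma> a) = a" for a by (simp add: \<sigma>_def)
  define P where "P = mat n n (\<lambda>(r, c). if c = 0 then v $ r else if r = \<sigma> c then 1 else 0)"
  define Q where "Q = mat n n (\<lambda>(c, r). if c = 0 then (if r = i then inverse (v $ i) else 0)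
     else (if r = \<sigma> c then 1 else 0) - (if r = i then v $ (\<sigma> c) * inverse (v $ i) else 0))"
  have dims: "dim_row P = n" "dim_col P = n" "dim_row Q = n" "dim_col Q = n" by (auto simp: P_def Q_def)
  have PQ: "P * Q = 1\<^sub>m n"
  proof (rule eq_matI)
    fix r r' assume "r < dim_row (1\<^sub>m n :: 'k mat)" "r' < dim_col (1\<^sub>m n :: 'k mat)"
    hence rr: "r < n" "r' < n" by auto
    have n0: "0 < n" using i by simp
    define F where "F c = P $$ (r, c) * Q $$ (c, r')" for c
    have bij: "bij_betw \<sigma> {..<n} {..<n}" using \<sigma> permutes_imp_bij by blast
    have "(P * Q) $$ (r, r') = (\<Sum>c<n. F c)" unfolding F_def
      using rr dims by (subst index_mult_sum) auto
    also have "\<dots> = F 0 + (\<Sum>c\<in>{..<n} - {0}. F c)" using n0 by (subst sum.remove[of _ 0]) auto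
    also have "(\<Sum>c\<in>{..<n} - {0}. F c) = (\<Sum>c\<in>{..<n} - {0}. if c = \<sigma> r then
        (if r' = r then 1 else 0) - (if r' = i then v $ r * inverse (v $ i) else 0) else 0)"
    proof (rule sum.cong[OF refl])
      fix c assume c: "c \<in> {..<n} - {0}"
      have "r = \<sigma> c \<longleftrightarrow> c = \<sigma> r" using \<sigma>\<sigma> by metis
      thus "F c = (if c = \<sigma> r then (if r' = r then 1 else 0) - (if r' = i then v $ r * inverse (v $ i) else 0) else 0)"
        using c rr by (auto simp: F_def P_def Q_def \<sigma>\<sigma>)
    qed
    also have "\<dots> = (if \<sigma> r \<noteq> 0 then (if r' = r then 1 else 0) - (if r' = i then v $ r * inverse (v $ i) else 0) else 0)"
      using permutes_in_image[OF \<sigma>, of r] rr by (subst sum.delta) auto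
    also have "F 0 = (if r' = i then v $ r * inverse (v $ i) else 0)"
      using rr n0 by (auto simp: F_def P_def Q_def)
    also have "\<sigma> r \<noteq> 0 \<longleftrightarrow> r \<noteq> i" using \<sigma>\<sigma> \<sigma>0 by metis
    finally show "(P * Q) $$ (r, r') = 1\<^sub>m n $$ (r, r')" using rr i by auto
  qed (auto simp: dims)
  have "P \<in> carrier_mat n n" "Q \<in> carrier_mat n n" by (auto simp: P_def Q_def)
  moreover from this have "Q * P = 1\<^sub>m n" using mat_mult_left_right_inverse PQ by blast
  moreover have "P $$ (j, 0) = v $ j" if "j < n" for j using that by (simp add: P_def)
  ultimately show ?thesis using PQ that by blast
qed

lemma nilpotent_triangular:
  fixes N :: "'k::field mat"
  assumes "N \<in> carrier_mat n n" "N ^\<^sub>m e = 0\<^sub>m n n"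
  shows "\<exists>U. similar_mat N U \<and> (\<forall>i<n. \<forall>j\<le>i. U $$ (i, j) = 0)"
  using assms
proof (induction n arbitrary: N)
  case 0
  thus ?case using similar_mat_refl by blast
next
  case (Suc n N)
  have detpow: "det (N ^\<^sub>m j) = det N ^ j" for j
    using Suc.prems(1) by (induction j) (auto simp: det_mult[of _ "Suc n"])
  have "det N ^ e = 0" using detpow[of e] Suc.prems(2) det_zero[of "Suc n"] by simp
  hence "det N = 0" by simp
  then obtain v where v: "v \<in> carrier_vec (Suc n)" "v \<noteq> 0\<^sub>v (Suc n)" "N *\<^sub>v v = 0\<^sub>v (Suc n)"
    using det_0_iff_vec_prod_zero_field[OF Suc.prems(1)] by blast
  obtain P Q where PQ: "P \<in> carrier_mat (Suc n) (Suc n)" "Q \<in> carrier_mat (Suc n) (Suc n)"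
    "P * Q = 1\<^sub>m (Suc n)" "Q * P = 1\<^sub>m (Suc n)" "\<And>i. i < Suc n \<Longrightarrow> P $$ (i, 0) = v $ i"
    using first_column_completion[OF v(1,2)] by blast
  have dims: "dim_row N = Suc n" "dim_col N = Suc n" "dim_row P = Suc n" "dim_col P = Suc n"
    "dim_row Q = Suc n" "dim_col Q = Suc n" using Suc.prems PQ by auto
  define B where "B = Q * (N * P)"
  have dB: "dim_row B = Suc n" "dim_col B = Suc n" by (auto simp: B_def dims)
  have "P * B = N * P" unfolding B_def using mat_cancel[OF PQ(3)] dims by simp
  hence NB: "N = P * B * Q" using PQ(3) dims dB by (simp add: mat_assoc)
  have simNB: "similar_mat N B"
    by (rule similar_matI[of _ _ P Q "Suc n"]) (use PQ NB Suc.prems dB in auto)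
  have "col P 0 = v" using PQ(5) v dims by (intro eq_vecI) auto
  hence "col (N * P) 0 = 0\<^sub>v (Suc n)" using v(3) dims by (metis col_mult2 Suc.prems(1) PQ(1) zero_less_Suc)
  hence "col B 0 = 0\<^sub>v (Suc n)" unfolding B_def
    using col_mult2[OF PQ(2), of "N * P" "Suc n" 0] Suc.prems(1) PQ(1,2) by (auto simp: mult_mat_vec_def)
  hence B0: "B $$ (i, 0) = 0" if "i < Suc n" for i
    using that dB by (metis index_col index_zero_vec(1) zero_less_Suc)
  define C where "C = mat n n (\<lambda>(i, j). B $$ (Suc i, Suc j))"
  define b where "b = mat 1 n (\<lambda>(i, j). B $$ (0, Suc j))"
  have Bfb: "B = four_block_mat (0\<^sub>m 1 1) b (0\<^sub>m n 1) C"
  proof (rule eq_matI)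
    fix i j assume "i < dim_row (four_block_mat (0\<^sub>m 1 1) b (0\<^sub>m n 1) C)"
      "j < dim_col (four_block_mat (0\<^sub>m 1 1) b (0\<^sub>m n 1) C)"
    hence ij: "i < Suc n" "j < Suc n" by (auto simp: C_def)
    show "B $$ (i, j) = four_block_mat (0\<^sub>m 1 1) b (0\<^sub>m n 1) C $$ (i, j)"
      using ij B0 by (cases i; cases j) (auto simp: C_def b_def)
  qed (auto simp: C_def dB)
  have bC: "b \<in> carrier_mat 1 n" "C \<in> carrier_mat n n" by (auto simp: b_def C_def)
  define G where "G = hst (0\<^sub>m n 1) (1\<^sub>m n :: 'k mat)"
  define H where "H = vst (0\<^sub>m 1 n) (1\<^sub>m n :: 'k mat)"
  have dG: "dim_row G = n" "dim_col G = Suc n" "dim_row H = Suc n" "dim_col H = n" by (auto simp: G_def H_def)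
  have "C * G = G * B"
  proof -
    have "B = vst (hst (0\<^sub>m 1 1) b) (C * G)" unfolding Bfb G_def using bC
      by (subst mult_hst) (auto simp: vst_def hst_def intro!: eq_matI)
    hence "G * B = (0\<^sub>m n 1) * (hst (0\<^sub>m 1 1) b) + 1\<^sub>m n * (C * G)"
      using bC dG by (subst G_def, simp) (subst hst_vst_mult, auto)
    thus ?thesis using bC dG by (auto intro!: eq_matI simp del: index_mult_mat(1))
  qed
  hence "C ^\<^sub>m e * G = G * B ^\<^sub>m e"
    by (intro pow_mat_intertwine[of _ n _ "Suc n"]) (use bC dB dG in auto)
  moreover have "B ^\<^sub>m e = 0\<^sub>m (Suc n) (Suc n)"
  proof -
    have w: "similar_mat_wit B N Q P"
      by (rule similar_mat_witI) (use PQ Suc.prems dB dims in \<open>auto simp: B_def mat_assoc\<close>)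
    show ?thesis using similar_mat_wit_pow_id[OF w, of e] Suc.prems(2) PQ dims by simp
  qed
  ultimately have "C ^\<^sub>m e * G * H = 0\<^sub>m n n" using dG by simp
  moreover have "G * H = 1\<^sub>m n" unfolding G_def H_def by (subst hst_vst_mult) auto
  ultimately have "C ^\<^sub>m e = 0\<^sub>m n n" using dG bC by (simp add: mat_assoc)
  then obtain U where U: "similar_mat C U" "\<forall>i<n. \<forall>j\<le>i. U $$ (i, j) = 0"
    using Suc.IH[OF bC(2)] by blast
  have Uc: "U \<in> carrier_mat n n" using U(1) bC(2) by (metis similar_matD carrier_matD insert_subset carrier_matI)
  have "similar_mat (0\<^sub>m 1 1 :: 'k mat) (0\<^sub>m 1 1)" by (rule similar_mat_refl[of _ 1]) auto
  then obtain b' where b': "b' \<in> carrier_mat 1 n"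
    "similar_mat B (four_block_mat (0\<^sub>m 1 1) b' (0\<^sub>m n 1) U)"
    using similar_mat_four_block_0_ex[OF _ U(1) bC(1) _ bC(2)] Bfb by (metis zero_carrier_mat)
  show ?case
  proof (intro exI conjI allI impI)
    show "similar_mat N (four_block_mat (0\<^sub>m 1 1) b' (0\<^sub>m n 1) U)"
      using similar_mat_trans[OF simNB b'(2)] .
    fix i j assume "i < Suc n" "j \<le> i"
    thus "four_block_mat (0\<^sub>m 1 1) b' (0\<^sub>m n 1) U $$ (i, j) = 0"
      using U(2) Uc by (cases i; cases j) auto
  qed
qed

lemma partition_of_mset_partition:
  assumes "0 \<notin># M" shows "partition (partition_of_mset M)" "num_parts (partition_of_mset M) = size M"
proof -
  let ?xs = "rev (sorted_list_of_multiset M)"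
  have len: "length ?xs = size M" by (metis length_rev mset_sorted_list_of_multiset size_mset)
  have s: "sorted (sorted_list_of_multiset M)" by simp
  have anti: "partition_of_mset M (Suc i) \<le> partition_of_mset M i" for i
  proof (cases "Suc i < size M")
    case True
    have "?xs ! Suc i \<le> ?xs ! i" using sorted_rev_nth_mono[of ?xs i "Suc i"] s True len by simp
    thus ?thesis using True by (simp add: partition_of_mset_def)
  qed (simp add: partition_of_mset_def)
  have supp: "{i. partition_of_mset M i \<noteq> 0} = {..<size M}"
  proof -
    have "?xs ! i \<noteq> 0" if "i < size M" for i
    proof -
      have "?xs ! i \<in> set ?xs" using that len by (metis nth_mem)
      hence "?xs ! i \<in># M" by simp
      thus ?thesis using assms by metis
    qed
    thus ?thesis by (auto simp: partition_of_mset_def split: if_splits)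
  qed
  show "partition (partition_of_mset M)" unfolding partition_def using anti supp by simp
  show "num_parts (partition_of_mset M) = size M" unfolding num_parts_def supp by simp
qed

lemma partition_of_mset_reindex:
  assumes "finite I" "M = image_mset f (mset_set I)"
  obtains \<iota> where "bij_betw \<iota> I {..<size M}" "\<And>i. i \<in> I \<Longrightarrow> partition_of_mset M (\<iota> i) = f i"
proof -
  let ?ys = "rev (sorted_list_of_multiset M)"
  obtain xs where xs: "set xs = I" "distinct xs" using assms(1) finite_distinct_list by blast
  have "mset (map f xs) = mset ?ys"
    using xs assms(2) by (metis mset_map mset_rev mset_set_set mset_sorted_list_of_multiset)
  then obtain \<pi> where \<pi>: "\<pi> permutes {..<length ?ys}" "permute_list \<pi> ?ys = map f xs"
    by (rule mset_eq_permutation)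
  have len: "length ?ys = size M" "length xs = size M"
    using \<open>mset (map f xs) = mset ?ys\<close> assms(2) xs
    by (metis length_rev mset_sorted_list_of_multiset size_mset, metis length_map mset_rev mset_sorted_list_of_multiset size_mset)
  define g where "g = the_inv_into {..<length xs} ((!) xs)"
  have bxs: "bij_betw ((!) xs) {..<length xs} I" using bij_betw_nth[OF xs(2)] xs(1) by blast
  have g: "bij_betw g I {..<size M}" unfolding g_def using bij_betw_the_inv_into[OF bxs] len by simp
  have "bij_betw (\<pi> \<circ> g) I {..<size M}"
    using bij_betw_trans[OF g] permutes_imp_bij[OF \<pi>(1)] len by simp
  moreover have "partition_of_mset M ((\<pi> \<circ> g) i) = f i" if "i \<in> I" for i
  proof -
    have gi: "g i < size M" "xs ! g i = i"
      using g that bij_betwE f_the_inv_into_f_bij_betw[OF bxs] unfolding g_def by fastforce+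
    have "\<pi> (g i) < size M" using permutes_in_image[OF \<pi>(1), of "g i"] gi len by simp
    moreover have "permute_list \<pi> ?ys ! g i = ?ys ! \<pi> (g i)"
      using gi len \<pi>(1) by (intro permute_list_nth) auto
    ultimately show ?thesis using \<pi>(2) gi len by (simp add: partition_of_mset_def)
  qed
  ultimately show ?thesis using that by blast
qed

lemma nilpotent_jordan_type:
  fixes N :: "'k::field mat"
  assumes "N \<in> carrier_mat n n" "N ^\<^sub>m e = 0\<^sub>m n n"
  shows "\<exists>p. jordan_type N p"
proof -
  obtain U where U: "similar_mat N U" "\<forall>i<n. \<forall>j\<le>i. U $$ (i, j) = 0"
    using nilpotent_triangular[OF assms] by blast
  have Uc: "U \<in> carrier_mat n n" using U(1) assms(1) by (metis similar_matD carrier_matD insert_subset carrier_matI)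
  have ut: "upper_triangular U" using U(2) Uc by auto
  define n_as where "n_as = triangular_to_jnf_vector U"
  have jnf: "jordan_nf U n_as" unfolding n_as_def by (rule triangular_to_jnf_vector[OF Uc ut])
  have zero: "a = 0" if "(m, a) \<in> set n_as" for m a
  proof -
    have m0: "m \<noteq> 0" using jnf that unfolding jordan_nf_def by force
    have "(\<Prod>(m, a)\<leftarrow>n_as. [:- a, 1:] ^ m) = (\<Prod>a\<leftarrow>diag_mat U. [:- a, 1:])"
      using jordan_nf_char_poly[OF jnf] char_poly_upper_triangular[OF Uc ut] by simp
    moreover have "[:- a, 1:] ^ m dvd (\<Prod>(m, a)\<leftarrow>n_as. [:- a, 1:] ^ m)"
      using that by (intro prod_list_dvd) force
    ultimately have "poly (\<Prod>a\<leftarrow>diag_mat U. [:- a, 1:]) a = 0"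
      using m0 by (auto elim!: dvdE)
    hence "\<exists>b\<in>set (diag_mat U). a - b = 0" by (auto simp: poly_prod_list prod_list_zero_iff)
    thus "a = 0" using U(2) Uc by (auto simp: diag_mat_def)
  qed
  define ms where "ms = map fst n_as"
  have nas: "n_as = map (\<lambda>m. (m, 0)) ms"
    unfolding ms_def map_map by (rule map_idI[symmetric]) (use zero in force)
  have ms0: "0 \<notin> set ms" using jnf unfolding jordan_nf_def ms_def by simp
  let ?p = "\<lambda>i. if i < length ms then ms ! i else 0"
  have "jordan_shape U ?p"
    using jordan_matrix_shift_mat[of ms, where ?'k = 'k] jnf unfolding jordan_shape_def jordan_nf_def nas by metis
  hence N: "jordan_shape N ?p" using jordan_shape_similar[OF U(1)] by blast
  define M where "M = mset ms"
  have "map ?p [0..<length ms] = ms" by (rule nth_equalityI) auto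
  hence "mset ms = image_mset ?p (mset [0..<length ms])" by (metis mset_map)
  hence M: "M = image_mset ?p (mset_set {..<length ms})"
    unfolding M_def by (simp add: atLeast0LessThan)
  obtain \<iota> where \<iota>: "bij_betw \<iota> {..<length ms} {..<size M}"
    "\<And>i. i \<in> {..<length ms} \<Longrightarrow> partition_of_mset M (\<iota> i) = ?p i"
    using partition_of_mset_reindex[OF _ M] by blast
  have M0: "0 \<notin># M" using ms0 by (simp add: M_def)
  have supp: "{i. ?p i \<noteq> 0} = {..<length ms}" using ms0 by (auto split: if_splits) (metis gr0I nth_mem)
  have "jordan_shape N (partition_of_mset M)"
  proof (rule jordan_shape_reindex[OF N, of \<iota>], unfold supp)
    show "\<iota> ` {..<length ms} = {i. partition_of_mset M i \<noteq> 0}"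
      using \<iota>(1) partition_support[OF partition_of_mset_partition(1)[OF M0]]
        partition_of_mset_partition(2)[OF M0] by (simp add: bij_betw_def)
    show "partition_of_mset M (\<iota> i) = ?p i" if "?p i \<noteq> 0" for i
      using \<iota>(2)[of i] that by (simp split: if_splits)
  qed (use \<iota>(1) in \<open>simp add: bij_betw_def\<close>)
  thus ?thesis using jordan_type_iff partition_of_mset_partition(1)[OF M0] by blast
qed

section \<open>Combinatorics of interlaced partitions\<close>

lemma finite_down_closed_nat:
  assumes "finite S" "\<And>i j. j \<in> S \<Longrightarrow> i \<le> j \<Longrightarrow> i \<in> S"
  shows "S = {..<card S}"
proof (cases "S = {}")
  case False
  have "S = {..<Suc (Max S)}"
  proof (intro equalityI subsetI)
    show "x \<in> {..<Suc (Max S)}" if "x \<in> S" for x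
      using Max_ge[OF assms(1) that] by simp
    show "x \<in> S" if "x \<in> {..<Suc (Max S)}" for x
      using assms(2)[OF Max_in[OF assms(1) False], of x] that by simp
  qed
  thus ?thesis by (metis card_lessThan)
qed auto

lemma partition_finite_support: "partition p \<Longrightarrow> finite {i. p i \<noteq> 0}"
  unfolding partition_def by blast

lemma partition_gt_set:
  assumes "partition p" shows "{i. j < p i} = {..<card {i. j < p i}}"
proof (rule finite_down_closed_nat)
  show "finite {i. j < p i}" by (rule finite_subset[OF _ partition_finite_support[OF assms]]) auto
  show "a \<in> {i. j < p i}" if "b \<in> {i. j < p i}" "a \<le> b" for a b
    using partition_antimono[OF assms that(2)] that(1) by simp
qed

lemma excess_Suc:
  assumes "partition p" shows "excess p j = excess p (Suc j) + card {i. j < p i}"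
proof -
  let ?I = "{i. p i \<noteq> 0}"
  have fin: "finite ?I" using partition_finite_support[OF assms] .
  have "card {i. j < p i} = (\<Sum>i\<in>?I. if j < p i then 1 else 0)"
  proof -
    have "{i. j < p i} = {i \<in> ?I. j < p i}" by auto
    thus ?thesis using sum.inter_filter[OF fin, of "\<lambda>_. 1 :: nat" "\<lambda>i. j < p i"] by simp
  qed
  moreover have "excess p j = (\<Sum>i\<in>?I. (p i - Suc j) + (if j < p i then 1 else 0))"
    unfolding excess_def by (rule sum.cong) auto
  ultimately show ?thesis unfolding excess_def by (simp only: sum.distrib)
qed

lemma excess_inject:
  assumes "partition p" "partition p'" "\<And>j. excess p j = excess p' j"
  shows "p = p'"
proof
  fix i
  have "card {i. j < p i} = card {i. j < p' i}" for j
    using excess_Suc[OF assms(1), of j] excess_Suc[OF assms(2), of j] assms(3)[of j] assms(3)[of "Suc j"] by simp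
  hence "{i. j < p i} = {i. j < p' i}" for j
    using partition_gt_set[OF assms(1), of j] partition_gt_set[OF assms(2), of j] by simp
  hence *: "j < p i \<longleftrightarrow> j < p' i" for j by blast
  show "p i = p' i" using *[of "p i"] *[of "p' i"] by simp
qed

lemma sum_diff_le_excess:
  fixes p :: "nat \<Rightarrow> nat"
  assumes "finite {i. p i \<noteq> 0}" shows "(\<Sum>i<m. p i - j) \<le> excess p (j :: nat)"
proof -
  have "(\<Sum>i<m. p i - j) \<le> (\<Sum>i\<in>{..<m} \<union> {i. p i \<noteq> 0}. p i - j)"
    using assms by (intro sum_mono2) auto
  also have "\<dots> = excess p j" using assms by (intro excess_eq_sum[symmetric]) auto
  finally show ?thesis .
qed

lemma sum_le_excess:
  fixes p :: "nat \<Rightarrow> nat"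
  assumes "finite {i. p i \<noteq> 0}" shows "(\<Sum>i<m. p i) \<le> m * j + excess p (j :: nat)"
proof -
  have "(\<Sum>i<m. p i) \<le> (\<Sum>i<m. j + (p i - j))" by (intro sum_mono) auto
  also have "\<dots> = m * j + (\<Sum>i<m. p i - j)" by (simp add: sum.distrib)
  also have "\<dots> \<le> m * j + excess p j" using sum_diff_le_excess[OF assms] by simp
  finally show ?thesis .
qed

lemma excess_eq_initial_sum:
  assumes "partition p" "\<And>i. i < m \<Longrightarrow> j \<le> p i" "\<And>i. m \<le> i \<Longrightarrow> p i \<le> j"
  shows "(\<Sum>i<m. p i) = m * j + excess p j"
proof -
  have fin: "finite {i. p i \<noteq> 0}" using partition_finite_support[OF assms(1)] .
  have "excess p j = (\<Sum>i\<in>{..<m} \<union> {i. p i \<noteq> 0}. p i - j)" using fin by (intro excess_eq_sum) auto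
  also have "\<dots> = (\<Sum>i<m. p i - j)" using fin assms(3) by (intro sum.mono_neutral_right) auto
  finally have "m * j + excess p j = (\<Sum>i<m. j + (p i - j))" by (simp add: sum.distrib)
  also have "\<dots> = (\<Sum>i<m. p i)" using assms(2) by (intro sum.cong) auto
  finally show ?thesis by simp
qed

lemma interlacedD:
  assumes "interlaced tt \<mu> lam"
  shows "lam s \<le> \<mu> (tt + 2 * s)" "\<mu> (tt + 2 * s + 1) \<le> lam s"
    "\<mu> (tt + 2 * s + 1) \<le> \<mu> (tt + 2 * s)" "\<mu> (tt + 2 * s + 2) \<le> \<mu> (tt + 2 * s + 1)"
  using assms unfolding interlaced_def by (metis add_2_eq_Suc' add.assoc Suc_eq_plus1 | simp)+

lemma pdiff_less [simp]: "i < tt \<Longrightarrow> pdiff tt \<mu> lam i = \<mu> i"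
  and pdiff_add [simp]: "pdiff tt \<mu> lam (tt + s) = \<mu> (tt + 2 * s) + \<mu> (tt + 2 * s + 1) - lam s"
  by (simp_all add: pdiff_def)

lemma pdiff_partition:
  assumes "interlaced tt \<mu> lam" "partition \<mu>"
  shows "partition (pdiff tt \<mu> lam)"
  unfolding partition_def
proof
  note I = interlacedD[OF assms(1)]
  show "\<forall>i. pdiff tt \<mu> lam (Suc i) \<le> pdiff tt \<mu> lam i"
  proof
    fix i
    consider "Suc i < tt" | "Suc i = tt" | s where "i = tt + s" by (metis le_Suc_ex not_less_eq linorder_neqE_nat less_or_eq_imp_le Suc_lessI)
    thus "pdiff tt \<mu> lam (Suc i) \<le> pdiff tt \<mu> lam i"
    proof cases
      case 1
      thus ?thesis using assms(1) by (simp add: interlaced_def)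
    next
      case 2
      have "\<mu> (Suc i) \<le> \<mu> i" using assms(1) by (simp add: interlaced_def)
      thus ?thesis using 2 pdiff_add[of tt \<mu> lam 0] I[of 0] by simp
    next
      case (3 s)
      have "pdiff tt \<mu> lam (Suc i) \<le> \<mu> (tt + 2 * s + 2)"
        using pdiff_add[of tt \<mu> lam "Suc s"] I[of "Suc s"] 3 by simp
      also have "\<dots> \<le> pdiff tt \<mu> lam i" using I[of s] 3 by simp
      finally show ?thesis .
    qed
  qed
  have "{i. pdiff tt \<mu> lam i \<noteq> 0} \<subseteq> {..<tt + num_parts \<mu>}"
  proof
    fix i assume "i \<in> {i. pdiff tt \<mu> lam i \<noteq> 0}"
    hence nz: "pdiff tt \<mu> lam i \<noteq> 0" by simp
    show "i \<in> {..<tt + num_parts \<mu>}"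
    proof (cases "i < tt")
      case False
      then obtain s where s: "i = tt + s" using le_Suc_ex not_less by blast
      have "\<mu> (tt + 2 * s) \<noteq> 0" using nz I[of s] s by simp
      hence "tt + 2 * s < num_parts \<mu>" using partition_nonzero_iff[OF assms(2)] by blast
      thus ?thesis using s by simp
    qed auto
  qed
  thus "finite {i. pdiff tt \<mu> lam i \<noteq> 0}" using finite_subset by blast
qed

text \<open>The rank inequality says that the partition with parts those of \<open>\<kappa>\<close> and \<open>lam\<close> is dominated by \<open>\<mu>\<close>;
  comparing partial sums shows that \<open>\<kappa>\<close> is dominated by \<open>pdiff tt \<mu> lam\<close>.\<close>

lemma excess_le_pdiff:
  assumes "interlaced tt \<mu> lam" "partition \<mu>" "partition lam" "partition \<kappa>"
    and le: "\<And>j. excess lam j + excess \<kappa> j \<le> excess \<mu> j"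
  shows "excess \<kappa> j \<le> excess (pdiff tt \<mu> lam) j"
proof -
  note fin = partition_finite_support[OF assms(3)] partition_finite_support[OF assms(4)]
    partition_finite_support[OF pdiff_partition[OF assms(1,2)]]
  note I = interlacedD[OF assms(1)]
  have sums: "(\<Sum>i<a. \<kappa> i) + (\<Sum>i<b. lam i) \<le> (\<Sum>i<a + b. \<mu> i)" for a b
  proof -
    define c where "c = \<mu> (a + b)"
    have "(\<Sum>i<a. \<kappa> i) + (\<Sum>i<b. lam i) \<le> (a * c + excess \<kappa> c) + (b * c + excess lam c)"
      by (intro add_mono sum_le_excess fin)
    also have "\<dots> \<le> (a + b) * c + excess \<mu> c" using le[of c] by (simp add: algebra_simps)
    also have "\<dots> = (\<Sum>i<a + b. \<mu> i)" unfolding c_def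
      by (rule excess_eq_initial_sum[symmetric, OF assms(2)]) (auto intro: partition_antimono[OF assms(2)])
    finally show ?thesis .
  qed
  have d1: "(\<Sum>i<m. pdiff tt \<mu> lam i) = (\<Sum>i<m. \<mu> i)" if "m \<le> tt" for m
    using that by (intro sum.cong) auto
  have d2: "(\<Sum>i<tt + s. pdiff tt \<mu> lam i) + (\<Sum>i<s. lam i) = (\<Sum>i<tt + 2 * s. \<mu> i)" for s
  proof (induction s)
    case (Suc s)
    thus ?case using I[of s] by simp
  qed (simp add: d1)
  have dom: "(\<Sum>i<m. \<kappa> i) \<le> (\<Sum>i<m. pdiff tt \<mu> lam i)" for m
  proof (cases "m \<le> tt")
    case True
    thus ?thesis using sums[of m 0] d1[of m] by simp
  next
    case False
    then obtain s where s: "m = tt + s" using le_Suc_ex nat_le_linear by blast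
    thus ?thesis using sums[of m s] d2[of s] by (simp add: mult_2 add.assoc)
  qed
  define m where "m = card {i. j < \<kappa> i}"
  have m: "j < \<kappa> i \<longleftrightarrow> i < m" for i using partition_gt_set[OF assms(4), of j] unfolding m_def by blast
  have "j \<le> \<kappa> i" if "i < m" for i using m[of i] that by simp
  moreover have "\<kappa> i \<le> j" if "m \<le> i" for i using m[of i] that by simp
  ultimately have "(\<Sum>i<m. \<kappa> i) = m * j + excess \<kappa> j"
    by (intro excess_eq_initial_sum[OF assms(4)])
  moreover have "(\<Sum>i<m. pdiff tt \<mu> lam i) \<le> m * j + excess (pdiff tt \<mu> lam) j"
    by (rule sum_le_excess[OF fin(3)])
  ultimately show ?thesis using dom[of m] by simp
qed

section \<open>Cokernels of maps between nilpotent modules\<close>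

lemma cokernel_rank_add:
  fixes X :: "'k::field mat"
  assumes "X \<in> carrier_mat m m" "N \<in> carrier_mat c c" "N' \<in> carrier_mat w w"
    "\<Phi> \<in> carrier_mat m c" "T \<in> carrier_mat c m" "G \<in> carrier_mat w m" "\<sigma> \<in> carrier_mat m w"
    and eqs: "X * \<Phi> = \<Phi> * N" "N' * G = G * X" "T * \<Phi> = 1\<^sub>m c" "G * \<sigma> = 1\<^sub>m w" "G * \<Phi> = 0\<^sub>m w c"
  shows "mrank (N ^\<^sub>m j) + mrank (N' ^\<^sub>m j) \<le> mrank (X ^\<^sub>m j)"
proof -
  have dims [simp]: "dim_row X = m" "dim_col X = m" "dim_row N = c" "dim_col N = c" "dim_row N' = w" "dim_col N' = w"
    "dim_row \<Phi> = m" "dim_col \<Phi> = c" "dim_row T = c" "dim_col T = m" "dim_row G = w" "dim_col G = m"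
    "dim_row \<sigma> = m" "dim_col \<sigma> = w" using assms by auto
  have dp [simp]: "dim_row (X ^\<^sub>m j) = m" "dim_col (X ^\<^sub>m j) = m" "dim_row (N ^\<^sub>m j) = c" "dim_col (N ^\<^sub>m j) = c"
    "dim_row (N' ^\<^sub>m j) = w" "dim_col (N' ^\<^sub>m j) = w" by auto
  have X\<Phi>: "X ^\<^sub>m j * \<Phi> = \<Phi> * N ^\<^sub>m j" by (rule pow_mat_intertwine[OF assms(1,2,4) eqs(1)])
  have NG: "N' ^\<^sub>m j * G = G * X ^\<^sub>m j" by (rule pow_mat_intertwine[OF assms(3,1,6) eqs(2)])
  define a b where "a = mrank (N ^\<^sub>m j)" and "b = mrank (N' ^\<^sub>m j)"
  obtain L1 R1 where 1: "L1 \<in> carrier_mat a c" "R1 \<in> carrier_mat c a" "L1 * N ^\<^sub>m j * R1 = 1\<^sub>m a"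
    using mrank_witness[of "N ^\<^sub>m j"] unfolding a_def dp by blast
  obtain L2 R2 where 2: "L2 \<in> carrier_mat b w" "R2 \<in> carrier_mat w b" "L2 * N' ^\<^sub>m j * R2 = 1\<^sub>m b"
    using mrank_witness[of "N' ^\<^sub>m j"] unfolding b_def dp by blast
  have d2 [simp]: "dim_row L1 = a" "dim_col L1 = c" "dim_row R1 = c" "dim_col R1 = a"
     "dim_row L2 = b" "dim_col L2 = w" "dim_row R2 = w" "dim_col R2 = b" using 1 2 by auto
  have e1: "L1 * T * X ^\<^sub>m j * (\<Phi> * R1) = 1\<^sub>m a"
  proof -
    have "L1 * T * X ^\<^sub>m j * (\<Phi> * R1) = L1 * (T * ((X ^\<^sub>m j * \<Phi>) * R1))" by (simp add: mat_assoc)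
    also have "\<dots> = L1 * ((T * \<Phi>) * (N ^\<^sub>m j * R1))" unfolding X\<Phi> by (simp add: mat_assoc)
    also have "\<dots> = 1\<^sub>m a" unfolding eqs(3) using 1(3) by (simp add: mat_assoc)
    finally show ?thesis .
  qed
  have e2: "L2 * G * X ^\<^sub>m j * (\<sigma> * R2) = 1\<^sub>m b"
  proof -
    have "L2 * G * X ^\<^sub>m j * (\<sigma> * R2) = L2 * ((G * X ^\<^sub>m j) * (\<sigma> * R2))" by (simp add: mat_assoc)
    also have "\<dots> = L2 * (N' ^\<^sub>m j * ((G * \<sigma>) * R2))" unfolding NG[symmetric] by (simp add: mat_assoc)
    also have "\<dots> = 1\<^sub>m b" unfolding eqs(4) using 2(3) by (simp add: mat_assoc)
    finally show ?thesis .
  qed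
  have e3: "L2 * G * X ^\<^sub>m j * (\<Phi> * R1) = 0\<^sub>m b a"
  proof -
    have "L2 * G * X ^\<^sub>m j * (\<Phi> * R1) = L2 * (G * ((X ^\<^sub>m j * \<Phi>) * R1))" by (simp add: mat_assoc)
    also have "\<dots> = L2 * ((G * \<Phi>) * (N ^\<^sub>m j * R1))" unfolding X\<Phi> by (simp add: mat_assoc)
    also have "\<dots> = 0\<^sub>m b a" unfolding eqs(5) by simp
    finally show ?thesis .
  qed
  have "vst (L1 * T) (L2 * G) * X ^\<^sub>m j * hst (\<Phi> * R1) (\<sigma> * R2) =
      four_block_mat (1\<^sub>m a) (L1 * T * X ^\<^sub>m j * (\<sigma> * R2)) (0\<^sub>m b a) (1\<^sub>m b)"
    unfolding e1[symmetric] e2[symmetric] e3[symmetric] by (subst vst_mult) (simp_all add: vst_hst_mult)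
  moreover have "det (four_block_mat (1\<^sub>m a) (L1 * T * X ^\<^sub>m j * (\<sigma> * R2)) (0\<^sub>m b a) (1\<^sub>m b)) = (1 :: 'k)"
    by (subst det_four_block_mat_lower_left_zero[of _ a _ b]) (auto intro!: carrier_matI)
  ultimately show ?thesis unfolding a_def[symmetric] b_def[symmetric]
    by (intro rkgeI_det[of "vst (L1 * T) (L2 * G)" _ _ "hst (\<Phi> * R1) (\<sigma> * R2)"]) (auto intro!: carrier_matI)
qed

text \<open>\<open>ample_cokernel X \<Phi> r\<close> is the open condition that the block matrix with blocks \<open>X\<^sup>j\<close> and \<open>\<Phi>\<close> has rank at least
  \<open>dim_col \<Phi> + r j\<close>, i.e. that \<open>\<Phi>\<close> is injective and \<open>X\<^sup>j\<close> has rank at least \<open>r j\<close> on the cokernel.\<close>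

definition ample_at :: "'k::field mat \<Rightarrow> 'k mat \<Rightarrow> nat \<Rightarrow> nat \<Rightarrow> bool" where
  "ample_at X \<Phi> j D \<longleftrightarrow> (\<exists>L R S. L \<in> carrier_mat D (dim_row \<Phi>) \<and> R \<in> carrier_mat (dim_row \<Phi>) D \<and>
     S \<in> carrier_mat (dim_col \<Phi>) D \<and> det (L * (X ^\<^sub>m j * R + \<Phi> * S)) \<noteq> 0)"

definition ample_cokernel :: "'k::field mat \<Rightarrow> 'k mat \<Rightarrow> (nat \<Rightarrow> nat) \<Rightarrow> bool" where
  "ample_cokernel X \<Phi> r \<longleftrightarrow> (\<forall>j. ample_at X \<Phi> j (dim_col \<Phi> + r j))"

lemma ample_at_factor:
  fixes X :: "'k::field mat"
  assumes "ample_at X \<Phi> j D" "X \<in> carrier_mat m m" "\<Phi> \<in> carrier_mat m c"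
    and "X ^\<^sub>m j = Y * Z + \<Phi> * W" "Y \<in> carrier_mat m r" "Z \<in> carrier_mat r m" "W \<in> carrier_mat c m"
  shows "D \<le> r + c"
proof -
  obtain L R S where LRS: "L \<in> carrier_mat D m" "R \<in> carrier_mat m D" "S \<in> carrier_mat c D"
    "det (L * (X ^\<^sub>m j * R + \<Phi> * S)) \<noteq> 0" using assms(1,3) unfolding ample_at_def by auto
  have d [simp]: "dim_row L = D" "dim_col L = m" "dim_row R = m" "dim_col R = D" "dim_row S = c" "dim_col S = D"
    "dim_row X = m" "dim_col X = m" "dim_row \<Phi> = m" "dim_col \<Phi> = c" "dim_row Y = m" "dim_col Y = r"
    "dim_row Z = r" "dim_col Z = m" "dim_row W = c" "dim_col W = m" using LRS assms by auto
  define M where "M = L * (X ^\<^sub>m j * R + \<Phi> * S)"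
  have Mc: "M \<in> carrier_mat D D" unfolding M_def by (auto intro!: carrier_matI)
  note Mi = mat_inv[OF Mc LRS(4)[folded M_def]]
  have Md [simp]: "dim_row (mat_inv M) = D" "dim_col (mat_inv M) = D" using Mi(1) by auto
  have "M = L * (Y * (Z * R) + \<Phi> * (W * R + S))" unfolding M_def assms(4)
    by (simp add: mat_ring) (rule assoc_add_mat[of _ D D], auto intro!: carrier_matI)
  also have "\<dots> = L * (hst Y \<Phi> * vst (Z * R) (W * R + S))" by (simp add: hst_vst_mult)
  finally have M: "M = (L * hst Y \<Phi>) * vst (Z * R) (W * R + S)" by (simp add: mat_assoc)
  have "(mat_inv M * (L * hst Y \<Phi>)) * vst (Z * R) (W * R + S) = mat_inv M * ((L * hst Y \<Phi>) * vst (Z * R) (W * R + S))"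
    by (simp add: mat_assoc)
  also have "\<dots> = mat_inv M * M" by (simp only: M[symmetric])
  finally have "(mat_inv M * (L * hst Y \<Phi>)) * vst (Z * R) (W * R + S) = 1\<^sub>m D" using Mi(3) by simp
  thus ?thesis by (intro mult_one_imp_le) (auto intro!: carrier_matI)
qed

lemma ample_cokernel_rank:
  fixes X :: "'k::field mat"
  assumes "ample_cokernel X \<Phi> r" "X \<in> carrier_mat m m" "\<Phi> \<in> carrier_mat m c" "T \<in> carrier_mat c m"
    "G \<in> carrier_mat w m" "\<sigma> \<in> carrier_mat m w" "N' \<in> carrier_mat w w"
    "\<sigma> * G + \<Phi> * T = 1\<^sub>m m" "N' * G = G * X"
  shows "r j \<le> mrank (N' ^\<^sub>m j)"
proof -
  have d [simp]: "dim_row X = m" "dim_col X = m" "dim_row \<Phi> = m" "dim_col \<Phi> = c" "dim_row T = c" "dim_col T = m"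
    "dim_row G = w" "dim_col G = m" "dim_row \<sigma> = m" "dim_col \<sigma> = w" "dim_row N' = w" "dim_col N' = w" using assms by auto
  have dp [simp]: "dim_row (X ^\<^sub>m j) = m" "dim_col (X ^\<^sub>m j) = m"
    "dim_row (N' ^\<^sub>m j) = w" "dim_col (N' ^\<^sub>m j) = w" by auto
  have NG: "N' ^\<^sub>m j * G = G * X ^\<^sub>m j" by (rule pow_mat_intertwine[OF assms(7,2,5,9)])
  define b where "b = mrank (N' ^\<^sub>m j)"
  obtain L R where LR: "L \<in> carrier_mat b w" "R \<in> carrier_mat w b" "L * N' ^\<^sub>m j * R = 1\<^sub>m b"
    using mrank_witness[of "N' ^\<^sub>m j"] unfolding b_def dp by blast
  have d2 [simp]: "dim_row L = b" "dim_col L = w" "dim_row R = w" "dim_col R = b" using LR by auto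
  have N: "N' ^\<^sub>m j * R * L * N' ^\<^sub>m j = N' ^\<^sub>m j"
    by (rule mrank_absorb[of _ b]) (use LR b_def in auto)
  have "X ^\<^sub>m j = (\<sigma> * G + \<Phi> * T) * X ^\<^sub>m j" unfolding assms(8) by simp
  also have "\<dots> = \<sigma> * (G * X ^\<^sub>m j) + \<Phi> * (T * X ^\<^sub>m j)" by (simp add: mat_ring)
  also have "\<dots> = \<sigma> * ((N' ^\<^sub>m j * R * L * N' ^\<^sub>m j) * G) + \<Phi> * (T * X ^\<^sub>m j)" unfolding N NG ..
  also have "\<dots> = (\<sigma> * (N' ^\<^sub>m j * R)) * (L * (N' ^\<^sub>m j * G)) + \<Phi> * (T * X ^\<^sub>m j)" by (simp add: mat_assoc)
  finally have "c + r j \<le> b + c"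
    using assms(1,2,3) unfolding ample_cokernel_def
    by (intro ample_at_factor[of X \<Phi> j _ m c _ _ _ b]) (auto intro!: carrier_matI)
  thus ?thesis by (simp add: b_def)
qed

lemma ample_cokernel_injective:
  fixes X :: "'k::field mat"
  assumes "ample_cokernel X \<Phi> r" "X \<in> carrier_mat m m" "\<Phi> \<in> carrier_mat m c" "X ^\<^sub>m e = 0\<^sub>m m m"
  obtains T where "T \<in> carrier_mat c m" "T * \<Phi> = 1\<^sub>m c"
proof -
  have d: "dim_row X = m" "dim_col X = m" "dim_row \<Phi> = m" "dim_col \<Phi> = c" using assms by auto
  have am: "ample_at X \<Phi> e (c + r e)" using assms(1) d unfolding ample_cokernel_def by simp
  have "c + r e \<le> 0 + c"
    by (rule ample_at_factor[OF am assms(2,3), of "0\<^sub>m m 0" "0\<^sub>m 0 m" "0\<^sub>m c m"])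
       (use assms d in \<open>auto intro!: eq_matI\<close>)
  hence "c + r e = c" by simp
  then obtain L R S where LRS: "L \<in> carrier_mat c m" "R \<in> carrier_mat m c" "S \<in> carrier_mat c c"
    "det (L * (X ^\<^sub>m e * R + \<Phi> * S)) \<noteq> 0" using am d unfolding ample_at_def by auto
  have "X ^\<^sub>m e * R + \<Phi> * S = \<Phi> * S" unfolding assms(4) using LRS d by (intro eq_matI) auto
  hence "det ((L * \<Phi>) * S) \<noteq> 0" using LRS d by (simp add: mat_assoc)
  hence "det (L * \<Phi>) \<noteq> 0" using LRS assms(3) by (subst (asm) det_mult[of _ c]) auto
  note i = mat_inv[OF _ this, of c]
  have Lc: "L * \<Phi> \<in> carrier_mat c c" using LRS assms(3) by auto
  have "(mat_inv (L * \<Phi>) * L) * \<Phi> = 1\<^sub>m c" using i(1,3)[OF Lc] LRS d by (simp add: mat_assoc)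
  thus ?thesis using that[of "mat_inv (L * \<Phi>) * L"] i(1)[OF Lc] LRS(1) by auto
qed

lemma ample_cokernel_splitting:
  fixes X :: "'k::field mat"
  assumes "X \<in> carrier_mat m m" "\<Phi> \<in> carrier_mat m c" "T \<in> carrier_mat c m"
    "\<gamma> \<in> carrier_mat w m" "\<tau> \<in> carrier_mat m w" "Y \<in> carrier_mat w w"
    and eqs: "T * \<Phi> = 1\<^sub>m c" "\<gamma> * \<Phi> = 0\<^sub>m w c" "\<gamma> * \<tau> = 1\<^sub>m w" "Y * \<gamma> = \<gamma> * X"
  shows "ample_cokernel X \<Phi> (\<lambda>j. mrank (Y ^\<^sub>m j))"
  unfolding ample_cokernel_def ample_at_def
proof
  fix j
  have d [simp]: "dim_row X = m" "dim_col X = m" "dim_row \<Phi> = m" "dim_col \<Phi> = c" "dim_row T = c" "dim_col T = m"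
    "dim_row \<gamma> = w" "dim_col \<gamma> = m" "dim_row \<tau> = m" "dim_col \<tau> = w" "dim_row Y = w" "dim_col Y = w" using assms by auto
  have dp [simp]: "dim_row (X ^\<^sub>m j) = m" "dim_col (X ^\<^sub>m j) = m"
    "dim_row (Y ^\<^sub>m j) = w" "dim_col (Y ^\<^sub>m j) = w" by auto
  have Yg: "Y ^\<^sub>m j * \<gamma> = \<gamma> * X ^\<^sub>m j" by (rule pow_mat_intertwine[OF assms(6,1,4) eqs(4)])
  define b where "b = mrank (Y ^\<^sub>m j)"
  obtain L R where LR: "L \<in> carrier_mat b w" "R \<in> carrier_mat w b" "L * Y ^\<^sub>m j * R = 1\<^sub>m b"
    using mrank_witness[of "Y ^\<^sub>m j"] unfolding b_def dp by blast
  have d2 [simp]: "dim_row L = b" "dim_col L = w" "dim_row R = w" "dim_col R = b" using LR by auto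
  let ?L = "vst T (L * \<gamma>)" and ?R = "hst (0\<^sub>m m c) (\<tau> * R)" and ?S = "hst (1\<^sub>m c) (0\<^sub>m c b)"
  have "X ^\<^sub>m j * ?R + \<Phi> * ?S = hst \<Phi> (X ^\<^sub>m j * (\<tau> * R))"
    by (subst mult_hst, simp, simp)+ (auto simp: hst_def simp del: index_mult_mat(1) intro!: eq_matI)
  hence "?L * (X ^\<^sub>m j * ?R + \<Phi> * ?S) = four_block_mat (T * \<Phi>) (T * (X ^\<^sub>m j * (\<tau> * R)))
      (L * \<gamma> * \<Phi>) (L * \<gamma> * (X ^\<^sub>m j * (\<tau> * R)))"
    by (simp add: vst_hst_mult)
  moreover have "L * \<gamma> * (X ^\<^sub>m j * (\<tau> * R)) = 1\<^sub>m b"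
  proof -
    have "L * \<gamma> * (X ^\<^sub>m j * (\<tau> * R)) = L * ((\<gamma> * X ^\<^sub>m j) * (\<tau> * R))" by (simp add: mat_assoc)
    also have "\<dots> = L * (Y ^\<^sub>m j * ((\<gamma> * \<tau>) * R))" unfolding Yg[symmetric] by (simp add: mat_assoc)
    also have "\<dots> = 1\<^sub>m b" unfolding eqs(3) using LR(3) by (simp add: mat_assoc)
    finally show ?thesis .
  qed
  moreover have "L * \<gamma> * \<Phi> = 0\<^sub>m b c" using eqs(2) by (simp add: mat_assoc)
  ultimately have "det (?L * (X ^\<^sub>m j * ?R + \<Phi> * ?S)) = 1" unfolding eqs(1)
    by simp (subst det_four_block_mat_lower_left_zero[of _ c _ b], auto intro!: carrier_matI)
  thus "\<exists>L R S. L \<in> carrier_mat (dim_col \<Phi> + mrank (Y ^\<^sub>m j)) (dim_row \<Phi>) \<and>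
      R \<in> carrier_mat (dim_row \<Phi>) (dim_col \<Phi> + mrank (Y ^\<^sub>m j)) \<and>
      S \<in> carrier_mat (dim_col \<Phi>) (dim_col \<Phi> + mrank (Y ^\<^sub>m j)) \<and> det (L * (X ^\<^sub>m j * R + \<Phi> * S)) \<noteq> 0"
    unfolding b_def[symmetric] by (intro exI[of _ ?L] exI[of _ ?R] exI[of _ ?S]) (auto intro!: carrier_matI)
qed

lemma ample_cokernel_conj:
  fixes X :: "'k::field mat"
  assumes "ample_cokernel X \<Phi> r" "X \<in> carrier_mat m m" "\<Phi> \<in> carrier_mat m c"
    "P \<in> carrier_mat m m" "P' \<in> carrier_mat m m" "P' * P = 1\<^sub>m m"
    "Q \<in> carrier_mat c c" "Q' \<in> carrier_mat c c" "Q' * Q = 1\<^sub>m c"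
    "X' \<in> carrier_mat m m" "X' * P = P * X"
  shows "ample_cokernel X' (P * \<Phi> * Q') r"
  unfolding ample_cokernel_def ample_at_def
proof
  fix j
  have d [simp]: "dim_row X = m" "dim_col X = m" "dim_row \<Phi> = m" "dim_col \<Phi> = c" "dim_row P = m" "dim_col P = m"
    "dim_row P' = m" "dim_col P' = m" "dim_row Q = c" "dim_col Q = c" "dim_row Q' = c" "dim_col Q' = c"
    "dim_row X' = m" "dim_col X' = m" using assms by auto
  have dp [simp]: "dim_row (X ^\<^sub>m j) = m" "dim_col (X ^\<^sub>m j) = m"
    "dim_row (X' ^\<^sub>m j) = m" "dim_col (X' ^\<^sub>m j) = m" by auto
  let ?D = "c + r j"
  obtain L R S where LRS: "L \<in> carrier_mat ?D m" "R \<in> carrier_mat m ?D" "S \<in> carrier_mat c ?D"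
    "det (L * (X ^\<^sub>m j * R + \<Phi> * S)) \<noteq> 0"
    using assms(1)[unfolded ample_cokernel_def ample_at_def, rule_format, of j] by auto
  have d2 [simp]: "dim_row L = ?D" "dim_col L = m" "dim_row R = m" "dim_col R = ?D" "dim_row S = c" "dim_col S = ?D"
    using LRS by auto
  have XP: "X' ^\<^sub>m j * P = P * X ^\<^sub>m j" by (rule pow_mat_intertwine[OF assms(10,2,4,11)])
  have "X' ^\<^sub>m j * (P * R) = P * (X ^\<^sub>m j * R)"
    using arg_cong[OF XP, of "\<lambda>M. M * R"] by (simp add: mat_assoc)
  moreover have "P * \<Phi> * Q' * (Q * S) = P * (\<Phi> * ((Q' * Q) * S))" by (simp add: mat_assoc)
  hence "P * \<Phi> * Q' * (Q * S) = P * (\<Phi> * S)" unfolding assms(9) by simp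
  ultimately have "L * P' * (X' ^\<^sub>m j * (P * R) + P * \<Phi> * Q' * (Q * S)) = L * ((P' * P) * (X ^\<^sub>m j * R + \<Phi> * S))"
    by (simp add: mat_ring)
  also have "\<dots> = L * (X ^\<^sub>m j * R + \<Phi> * S)" unfolding assms(6) by simp
  finally have "L * P' * (X' ^\<^sub>m j * (P * R) + P * \<Phi> * Q' * (Q * S)) = L * (X ^\<^sub>m j * R + \<Phi> * S)" .
  hence "det (L * P' * (X' ^\<^sub>m j * (P * R) + P * \<Phi> * Q' * (Q * S))) \<noteq> 0" using LRS(4) by simp
  moreover have "L * P' \<in> carrier_mat ?D m" "P * R \<in> carrier_mat m ?D" "Q * S \<in> carrier_mat c ?D"
    by (intro carrier_matI; simp)+
  moreover have "dim_row (P * \<Phi> * Q') = m" "dim_col (P * \<Phi> * Q') = c" by simp_all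
  ultimately show "\<exists>L R S. L \<in> carrier_mat (dim_col (P * \<Phi> * Q') + r j) (dim_row (P * \<Phi> * Q')) \<and>
      R \<in> carrier_mat (dim_row (P * \<Phi> * Q')) (dim_col (P * \<Phi> * Q') + r j) \<and>
      S \<in> carrier_mat (dim_col (P * \<Phi> * Q')) (dim_col (P * \<Phi> * Q') + r j) \<and>
      det (L * (X' ^\<^sub>m j * R + P * \<Phi> * Q' * S)) \<noteq> 0"
    by (simp only:) blast
qed

section \<open>An ample map between interlaced nilpotent modules\<close>

definition label_mat :: "nat \<Rightarrow> nat \<Rightarrow> (nat \<Rightarrow> 'x) \<Rightarrow> (nat \<Rightarrow> 'y) \<Rightarrow> ('x \<Rightarrow> 'y \<Rightarrow> 'k) \<Rightarrow> 'k mat" where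
  "label_mat n n' \<beta> \<beta>' F = mat n n' (\<lambda>(r, c). F (\<beta> r) (\<beta>' c))"

lemma label_mat_carrier [simp]: "label_mat n n' \<beta> \<beta>' F \<in> carrier_mat n n'"
  by (simp add: label_mat_def)

lemma label_mat_mult:
  fixes F :: "'x \<Rightarrow> 'y \<Rightarrow> 'k::semiring_0"
  assumes "bij_betw \<beta>' {..<n'} D"
  shows "label_mat n n' \<beta> \<beta>' F * label_mat n' n'' \<beta>' \<beta>'' F' =
    label_mat n n'' \<beta> \<beta>'' (\<lambda>x z. \<Sum>y\<in>D. F x y * F' y z)"
proof (rule eq_matI)
  fix r c assume "r < dim_row (label_mat n n'' \<beta> \<beta>'' (\<lambda>x z. \<Sum>y\<in>D. F x y * F' y z))"
    "c < dim_col (label_mat n n'' \<beta> \<beta>'' (\<lambda>x z. \<Sum>y\<in>D. F x y * F' y z))"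
  hence rc: "r < n" "c < n''" by (auto simp: label_mat_def)
  have "(label_mat n n' \<beta> \<beta>' F * label_mat n' n'' \<beta>' \<beta>'' F') $$ (r, c) =
      (\<Sum>l<n'. F (\<beta> r) (\<beta>' l) * F' (\<beta>' l) (\<beta>'' c))"
    using rc by (subst index_mult_sum) (auto simp: label_mat_def)
  also have "\<dots> = (\<Sum>y\<in>D. F (\<beta> r) y * F' y (\<beta>'' c))" by (rule sum.reindex_bij_betw[OF assms])
  finally show "(label_mat n n' \<beta> \<beta>' F * label_mat n' n'' \<beta>' \<beta>'' F') $$ (r, c) =
      label_mat n n'' \<beta> \<beta>'' (\<lambda>x z. \<Sum>y\<in>D. F x y * F' y z) $$ (r, c)"
    using rc by (simp add: label_mat_def)
qed (auto simp: label_mat_def)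

lemma label_mat_cong:
  assumes "bij_betw \<beta> {..<n} D" "bij_betw \<beta>' {..<n'} D'"
    and "\<And>x y. x \<in> D \<Longrightarrow> y \<in> D' \<Longrightarrow> F x y = F' x y"
  shows "label_mat n n' \<beta> \<beta>' F = label_mat n n' \<beta> \<beta>' F'"
  using assms by (intro eq_matI) (auto simp: label_mat_def bij_betw_def)

lemma label_mat_one:
  assumes "bij_betw \<beta> {..<n} D"
  shows "label_mat n n \<beta> \<beta> (\<lambda>x y. if x = y then 1 else 0) = 1\<^sub>m n"
  using assms by (intro eq_matI) (auto simp: label_mat_def bij_betw_def inj_on_def)

lemma label_mat_zero: "label_mat n n' \<beta> \<beta>' (\<lambda>x y. 0) = 0\<^sub>m n n'"
  by (intro eq_matI) (auto simp: label_mat_def)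

definition next_label :: "'i \<times> nat \<Rightarrow> 'i \<times> nat" where
  "next_label x = (fst x, Suc (snd x))"

lemma shift_mat_label: "shift_mat n \<beta> = label_mat n n \<beta> \<beta> (\<lambda>x y. if y = next_label x then 1 else 0)"
  by (simp add: shift_mat_def label_mat_def next_label_def)

lemma next_label_eq_iff: "next_label x = (i, q) \<longleftrightarrow> 0 < q \<and> x = (i, q - 1)"
  by (cases x) (auto simp: next_label_def)

context
  fixes \<mu> lam :: "nat \<Rightarrow> nat" and tt :: nat
  assumes inter: "interlaced tt \<mu> lam"
begin

private abbreviation "\<delta> \<equiv> pdiff tt \<mu> lam"
private abbreviation "a s \<equiv> \<mu> (tt + 2 * s)"
private abbreviation "b s \<equiv> \<mu> (tt + 2 * s + 1)"

lemma ab: "lam s \<le> a s" "b s \<le> lam s"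
  using interlacedD[OF inter] by auto

text \<open>Label \<open>(i, q)\<close> stands for \<open>x\<^bsup>l - 1 - q\<^esup>\<close> in \<open>k[x]/(x\<^bsup>l\<^esup>)\<close>, \<open>l\<close> being the \<open>i\<close>-th part.
  The map sends the generator of \<open>k[x]/(x\<^bsup>lam s\<^esup>)\<close> to \<open>(x\<^bsup>a s - lam s\<^esup>, 1)\<close>
  in \<open>k[x]/(x\<^bsup>a s\<^esup>) \<oplus> k[x]/(x\<^bsup>b s\<^esup>)\<close>; its cokernel is cyclic of length \<open>a s + b s - lam s\<close>.\<close>

definition sub_fun :: "nat \<times> nat \<Rightarrow> nat \<times> nat \<Rightarrow> 'k::field" where
  "sub_fun x y = (if x = (tt + 2 * fst y, snd y) then 1 else 0) +
     (if lam (fst y) \<le> b (fst y) + snd y \<and> x = (tt + 2 * fst y + 1, snd y + b (fst y) - lam (fst y)) then 1 else 0)"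

definition retract_fun :: "nat \<times> nat \<Rightarrow> nat \<times> nat \<Rightarrow> 'k::field" where
  "retract_fun y x = (if x = (tt + 2 * fst y, snd y) then 1 else 0)"

definition quot_fun :: "nat \<times> nat \<Rightarrow> nat \<times> nat \<Rightarrow> 'k::field" where
  "quot_fun z x = (if fst x < tt then (if z = x then 1 else 0)
     else (let s = (fst x - tt) div 2 in
       if even (fst x - tt) then (if lam s \<le> snd x + b s \<and> z = (tt + s, snd x + b s - lam s) then 1 else 0)
       else - (if z = (tt + s, snd x) then 1 else 0)))"

definition sect_label :: "nat \<times> nat \<Rightarrow> nat \<times> nat" where
  "sect_label z = (if fst z < tt then z
     else (let s = fst z - tt in
       if snd z < b s then (tt + 2 * s + 1, snd z) else (tt + 2 * s, snd z + lam s - b s)))"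

definition sect_fun :: "nat \<times> nat \<Rightarrow> nat \<times> nat \<Rightarrow> 'k::field" where
  "sect_fun x z = (if x = sect_label z then (if tt \<le> fst z \<and> snd z < b (fst z - tt) then - 1 else 1) else 0)"

lemma quot_fun_low: "i < tt \<Longrightarrow> quot_fun z (i, q) = (if z = (i, q) then 1 else 0)"
  and quot_fun_even: "quot_fun z (tt + 2 * s, q) =
      (if lam s \<le> q + b s \<and> z = (tt + s, q + b s - lam s) then 1 else 0)"
  and quot_fun_odd: "quot_fun z (tt + 2 * s + 1, q) = - (if z = (tt + s, q) then 1 else 0)"
  and quot_fun_odd': "quot_fun z (Suc (tt + 2 * s), q) = - (if z = (tt + s, q) then 1 else 0)"
  by (simp_all add: quot_fun_def Let_def)

lemma label_cases:
  obtains (low) i q where "x = (i, q)" "i < tt" | (even) s q where "x = (tt + 2 * s, q)"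
    | (odd) s q where "x = (tt + 2 * s + 1, q)"
proof (cases "fst x < tt")
  case True
  thus ?thesis using low[of "fst x" "snd x"] by simp
next
  case False
  then obtain u where u: "fst x = tt + u" using le_Suc_ex[of tt "fst x"] by auto
  show ?thesis
  proof (cases "even u")
    case True
    hence "x = (tt + 2 * (u div 2), snd x)" using u by (simp add: prod_eq_iff)
    thus ?thesis by (rule even)
  next
    case False
    hence "u = 2 * (u div 2) + 1" by presburger
    hence "x = (tt + 2 * (u div 2) + 1, snd x)" using u by (simp add: prod_eq_iff)
    thus ?thesis by (rule odd)
  qed
qed

lemma sum_sub_fun:
  fixes F :: "nat \<times> nat \<Rightarrow> 'k::field"
  assumes "finite (diagram \<mu>)" "(s, q) \<in> diagram lam"
  shows "(\<Sum>x\<in>diagram \<mu>. F x * sub_fun x (s, q)) =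
    F (tt + 2 * s, q) + (if lam s \<le> b s + q then F (tt + 2 * s + 1, q + b s - lam s) else 0)"
proof -
  have q: "q < lam s" using assms(2) by (simp add: diagram_def)
  have mem: "(tt + 2 * s, q) \<in> diagram \<mu>" "lam s \<le> b s + q \<Longrightarrow> (tt + 2 * s + 1, q + b s - lam s) \<in> diagram \<mu>"
    using q ab[of s] by (auto simp: diagram_def)
  have "F x * sub_fun x (s, q) = F x * (if x = (tt + 2 * s, q) then 1 else 0) +
      (if lam s \<le> b s + q then F x * (if x = (tt + 2 * s + 1, q + b s - lam s) then 1 else 0) else 0)" for x
    by (simp add: sub_fun_def)
  hence "(\<Sum>x\<in>diagram \<mu>. F x * sub_fun x (s, q)) =
      (\<Sum>x\<in>diagram \<mu>. F x * (if x = (tt + 2 * s, q) then 1 else 0)) +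
      (if lam s \<le> b s + q then (\<Sum>x\<in>diagram \<mu>. F x * (if x = (tt + 2 * s + 1, q + b s - lam s) then 1 else 0)) else 0)"
    by (simp add: sum.distrib)
  also have "\<dots> = F (tt + 2 * s, q) + (if lam s \<le> b s + q then F (tt + 2 * s + 1, q + b s - lam s) else 0)"
    using mem by (simp only: sum_mult_delta[OF assms(1)]) simp
  finally show ?thesis .
qed

lemma sum_next_label:
  fixes F :: "nat \<times> nat \<Rightarrow> 'k::field"
  assumes "finite (diagram p)" "(i, q) \<in> diagram p"
  shows "(\<Sum>x\<in>diagram p. F x * (if (i, q) = next_label x then 1 else 0)) = (if 0 < q then F (i, q - 1) else 0)"
proof (cases "0 < q")
  case True
  have "(i, q - 1) \<in> diagram p" using assms(2) by (auto simp: diagram_def)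
  moreover have "(i, q) = next_label x \<longleftrightarrow> x = (i, q - 1)" for x
    using True next_label_eq_iff[of x i q] by auto
  ultimately show ?thesis using True by (simp add: sum_mult_delta[OF assms(1)])
next
  case False
  hence "(i, q) \<noteq> next_label x" for x using next_label_eq_iff[of x i q] by auto
  thus ?thesis using False by simp
qed

lemma ample_shift_mat:
  assumes m: "bij_betw \<beta>m {..<m} (diagram \<mu>)" and l: "bij_betw \<beta>l {..<l} (diagram lam)"
    and w: "bij_betw \<beta>w {..<w :: nat} (diagram \<delta>)"
  shows "\<exists>\<Phi> \<in> carrier_mat m l. (shift_mat m \<beta>m :: 'k::field mat) * \<Phi> = \<Phi> * shift_mat l \<beta>l \<and>
    ample_cokernel (shift_mat m \<beta>m) \<Phi> (excess \<delta>)"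
proof -
  define \<Phi> :: "'k mat" where "\<Phi> = label_mat m l \<beta>m \<beta>l sub_fun"
  define T :: "'k mat" where "T = label_mat l m \<beta>l \<beta>m retract_fun"
  define G :: "'k mat" where "G = label_mat w m \<beta>w \<beta>m quot_fun"
  define \<sigma> :: "'k mat" where "\<sigma> = label_mat m w \<beta>m \<beta>w sect_fun"
  have fm: "finite (diagram \<mu>)" and fl: "finite (diagram lam)" and fw: "finite (diagram \<delta>)"
    using m l w finite_diagram_frame by blast+
  have 1: "(shift_mat m \<beta>m :: 'k mat) * \<Phi> = \<Phi> * shift_mat l \<beta>l"
    unfolding \<Phi>_def shift_mat_label label_mat_mult[OF m] label_mat_mult[OF l]
  proof (rule label_mat_cong[OF m l])
    fix x y assume x: "x \<in> diagram \<mu>" and y: "y \<in> diagram lam"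
    obtain s q where sq: "y = (s, q)" by (cases y)
    have q: "q < lam s" using y sq by (simp add: diagram_def)
    have "(\<Sum>x'\<in>diagram \<mu>. (if x' = next_label x then 1 else 0) * sub_fun x' y) =
       (if (tt + 2 * s, q) = next_label x then 1 else 0) +
       (if lam s \<le> b s + q then (if (tt + 2 * s + 1, q + b s - lam s) = next_label x then 1 else 0) else (0 :: 'k))"
      unfolding sq using y sq by (subst sum_sub_fun[OF fm]) auto
    also have "\<dots> = (if 0 < q then sub_fun x (s, q - 1) else 0)"
      unfolding eq_commute[of _ "next_label x"] next_label_eq_iff sub_fun_def using q ab[of s] by auto
    also have "\<dots> = (\<Sum>y'\<in>diagram lam. sub_fun x y' * (if y = next_label y' then 1 else 0))"
      unfolding sq using y sq by (subst sum_next_label[OF fl]) auto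
    finally show "(\<Sum>x'\<in>diagram \<mu>. (if x' = next_label x then 1 else 0) * sub_fun x' y) =
       (\<Sum>y'\<in>diagram lam. sub_fun x y' * (if y = next_label y' then 1 else 0 :: 'k))" .
  qed
  have 2: "T * \<Phi> = 1\<^sub>m l"
    unfolding T_def \<Phi>_def label_mat_mult[OF m] label_mat_one[OF l, symmetric]
  proof (rule label_mat_cong[OF l l])
    fix y' y assume "y' \<in> diagram lam" and y: "y \<in> diagram lam"
    obtain s q where sq: "y = (s, q)" by (cases y)
    have odd: "tt + 2 * s + 1 \<noteq> tt + 2 * s'" for s' by presburger
    have "(\<Sum>x\<in>diagram \<mu>. retract_fun y' x * sub_fun x y) = retract_fun y' (tt + 2 * s, q) +
       (if lam s \<le> b s + q then retract_fun y' (tt + 2 * s + 1, q + b s - lam s) else (0 :: 'k))"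
      unfolding sq using y sq by (subst sum_sub_fun[OF fm]) auto
    also have "\<dots> = (if y' = y then 1 else 0)"
      using odd by (cases y') (simp add: retract_fun_def sq)
    finally show "(\<Sum>x\<in>diagram \<mu>. retract_fun y' x * sub_fun x y) = (if y' = y then 1 else 0 :: 'k)" .
  qed
  have 3: "G * \<Phi> = 0\<^sub>m w l"
    unfolding G_def \<Phi>_def label_mat_mult[OF m] label_mat_zero[of w l \<beta>w \<beta>l, symmetric]
  proof (rule label_mat_cong[OF w l])
    fix z y assume "z \<in> diagram \<delta>" and y: "y \<in> diagram lam"
    obtain s q where sq: "y = (s, q)" by (cases y)
    have "(\<Sum>x\<in>diagram \<mu>. quot_fun z x * sub_fun x y) = quot_fun z (tt + 2 * s, q) +
       (if lam s \<le> b s + q then quot_fun z (tt + 2 * s + 1, q + b s - lam s) else (0 :: 'k))"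
      unfolding sq using y sq by (subst sum_sub_fun[OF fm]) auto
    also have "\<dots> = 0" unfolding quot_fun_even quot_fun_odd by (auto simp: add.commute)
    finally show "(\<Sum>x\<in>diagram \<mu>. quot_fun z x * sub_fun x y) = (0 :: 'k)" .
  qed
  have 4: "G * \<sigma> = 1\<^sub>m w"
    unfolding G_def \<sigma>_def label_mat_mult[OF m] label_mat_one[OF w, symmetric]
  proof (rule label_mat_cong[OF w w])
    fix z z' assume "z \<in> diagram \<delta>" and z': "z' \<in> diagram \<delta>"
    obtain i q where iq: "z' = (i, q)" by (cases z')
    have q: "q < \<delta> i" using z' iq by (simp add: diagram_def)
    let ?c = "if tt \<le> i \<and> q < b (i - tt) then - 1 else 1 :: 'k"
    have mem: "sect_label z' \<in> diagram \<mu>"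
    proof (cases "i < tt")
      case False
      then obtain s where s: "i = tt + s" using le_Suc_ex not_less by blast
      thus ?thesis using q ab[of s] by (auto simp: sect_label_def iq diagram_def Let_def)
    qed (use q in \<open>auto simp: sect_label_def iq diagram_def\<close>)
    have "quot_fun z x * sect_fun x z' = (quot_fun z x * ?c) * (if x = sect_label z' then 1 else 0)" for x
      by (simp add: sect_fun_def iq)
    hence "(\<Sum>x\<in>diagram \<mu>. quot_fun z x * sect_fun x z') = quot_fun z (sect_label z') * ?c"
      using mem by (simp only: sum_mult_delta[OF fm]) simp
    also have "\<dots> = (if z = z' then 1 else 0)"
    proof (cases "i < tt")
      case True
      thus ?thesis by (simp add: sect_label_def iq quot_fun_low)
    next
      case False
      then obtain s where s: "i = tt + s" using le_Suc_ex not_less by blast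
      show ?thesis
      proof (cases "q < b s")
        case True
        have "sect_label z' = (tt + 2 * s + 1, q)" using True by (simp add: sect_label_def iq s)
        thus ?thesis unfolding quot_fun_odd using True by (simp add: s iq quot_fun_odd')
      next
        case False
        have "sect_label z' = (tt + 2 * s, q + lam s - b s)" using False by (simp add: sect_label_def iq s)
        moreover have "lam s \<le> q + lam s - b s + b s" "q + lam s - b s + b s - lam s = q" using False by auto
        ultimately show ?thesis using False by (simp add: s iq quot_fun_even)
      qed
    qed
    finally show "(\<Sum>x\<in>diagram \<mu>. quot_fun z x * sect_fun x z') = (if z = z' then 1 else 0 :: 'k)" .
  qed
  have 5: "shift_mat w \<beta>w * G = G * shift_mat m \<beta>m"
    unfolding G_def shift_mat_label label_mat_mult[OF m] label_mat_mult[OF w]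
  proof (rule label_mat_cong[OF w m])
    fix z x assume "z \<in> diagram \<delta>" and x: "x \<in> diagram \<mu>"
    obtain i q where iq: "x = (i, q)" by (cases x)
    have q: "q < \<mu> i" using x iq by (simp add: diagram_def)
    have supp: "z' \<in> diagram \<delta>" if "quot_fun z' x \<noteq> (0 :: 'k)" for z'
    proof (cases x rule: label_cases)
      case (low i q)
      thus ?thesis using that x by (auto simp: quot_fun_low diagram_def split: if_splits)
    next
      case (even s q)
      thus ?thesis using that x ab[of s] by (auto simp: quot_fun_even diagram_def split: if_splits)
    next
      case (odd s q)
      have "q < b s" using odd x by (simp add: diagram_def)
      moreover have "z' = (tt + s, q)" using that unfolding odd quot_fun_odd by (simp split: if_splits)
      ultimately show ?thesis using ab[of s] by (auto simp: diagram_def)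
    qed
    have "(\<Sum>z'\<in>diagram \<delta>. (if z' = next_label z then 1 else 0) * quot_fun z' x) = (quot_fun (next_label z) x :: 'k)"
      using supp[of "next_label z"] by (auto simp: sum_mult_delta[OF fw])
    also have "\<dots> = (if 0 < q then quot_fun z (i, q - 1) else 0)"
    proof (cases x rule: label_cases)
      case (low i q)
      thus ?thesis using iq by (auto simp: quot_fun_low next_label_eq_iff)
    next
      case (even s r)
      have e: "i = tt + 2 * s" "q = r" using even iq by auto
      have *: "(lam s \<le> r + b s \<and> next_label z = (tt + s, r + b s - lam s)) \<longleftrightarrow>
        (0 < r \<and> lam s \<le> r - 1 + b s \<and> z = (tt + s, r - 1 + b s - lam s))"
        unfolding next_label_eq_iff using ab[of s] by auto
      show ?thesis unfolding iq e quot_fun_even *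
        by (cases "0 < r") (simp_all only: simp_thms if_True if_False)
    next
      case (odd s q)
      thus ?thesis using iq by (auto simp: quot_fun_odd' next_label_eq_iff)
    qed
    also have "\<dots> = (\<Sum>x'\<in>diagram \<mu>. quot_fun z x' * (if x = next_label x' then 1 else 0))"
      unfolding iq using x iq by (subst sum_next_label[OF fm]) auto
    finally show "(\<Sum>z'\<in>diagram \<delta>. (if z' = next_label z then 1 else 0) * quot_fun z' x) =
      (\<Sum>x'\<in>diagram \<mu>. quot_fun z x' * (if x = next_label x' then 1 else 0 :: 'k))" .
  qed
  have "ample_cokernel (shift_mat m \<beta>m) \<Phi> (\<lambda>j. mrank ((shift_mat w \<beta>w :: 'k mat) ^\<^sub>m j))"
    by (rule ample_cokernel_splitting[where m = m, OF _ _ _ _ _ _ 2 3 4 5]) (simp_all add: T_def \<Phi>_def G_def \<sigma>_def)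
  hence "ample_cokernel (shift_mat m \<beta>m) \<Phi> (excess \<delta>)" unfolding mrank_shift_mat_pow[OF w] .
  moreover have "\<Phi> \<in> carrier_mat m l" by (simp add: \<Phi>_def)
  ultimately show ?thesis using 1 by blast
qed

end

lemma exists_ample:
  fixes X N :: "'k::field mat"
  assumes inter: "interlaced tt \<mu> lam" and "partition \<mu>" "X \<in> carrier_mat m m" "N \<in> carrier_mat l l"
    and "jordan_shape X \<mu>" "jordan_shape N lam"
  shows "\<exists>\<Phi>\<in>carrier_mat m l. X * \<Phi> = \<Phi> * N \<and> ample_cokernel X \<Phi> (excess (pdiff tt \<mu> lam))"
proof -
  obtain m' \<beta>m where m': "bij_betw \<beta>m {..<m'} (diagram \<mu>)" "similar_mat X (shift_mat m' \<beta>m)"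
    using assms(5) unfolding jordan_shape_def by blast
  obtain l' \<beta>l where l': "bij_betw \<beta>l {..<l'} (diagram lam)" "similar_mat N (shift_mat l' \<beta>l)"
    using assms(6) unfolding jordan_shape_def by blast
  obtain P P' where P: "similar_mat_wit X (shift_mat m' \<beta>m) P P'" using m'(2) unfolding similar_mat_def by blast
  obtain Q Q' where Q: "similar_mat_wit N (shift_mat l' \<beta>l) Q Q'" using l'(2) unfolding similar_mat_def by blast
  note Pw = similar_mat_witD2[OF assms(3) P] and Qw = similar_mat_witD2[OF assms(4) Q]
  have "m' = m" "l' = l" using Pw(5) Qw(5) by auto
  note m = m'(1)[unfolded \<open>m' = m\<close>] and l = l'(1)[unfolded \<open>l' = l\<close>]
    and Pw = Pw[unfolded \<open>m' = m\<close>] and Qw = Qw[unfolded \<open>l' = l\<close>]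
  have "finite (diagram (pdiff tt \<mu> lam))"
    by (intro finite_diagram partition_finite_support pdiff_partition[OF inter assms(2)])
  then obtain \<beta>w where w: "bij_betw \<beta>w {..<card (diagram (pdiff tt \<mu> lam))} (diagram (pdiff tt \<mu> lam))"
    using ex_bij_betw_nat_finite by (metis atLeast0LessThan)
  obtain \<Phi> where \<Phi>: "\<Phi> \<in> carrier_mat m l" "(shift_mat m \<beta>m :: 'k mat) * \<Phi> = \<Phi> * shift_mat l \<beta>l"
    "ample_cokernel (shift_mat m \<beta>m) \<Phi> (excess (pdiff tt \<mu> lam))"
    using ample_shift_mat[OF inter m l w, where ?'k = 'k] by blast
  have d: "dim_row P = m" "dim_col P = m" "dim_row P' = m" "dim_col P' = m" "dim_row Q = l" "dim_col Q = l"
    "dim_row Q' = l" "dim_col Q' = l" "dim_row \<Phi> = m" "dim_col \<Phi> = l" using Pw Qw \<Phi> by auto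
  have XP: "X * P = P * shift_mat m \<beta>m"
  proof -
    have "X * P = P * (shift_mat m \<beta>m * (P' * P))" unfolding Pw(3) using d by (simp add: mat_assoc)
    thus ?thesis unfolding Pw(2) by simp
  qed
  have QN: "Q' * N = shift_mat l \<beta>l * Q'"
  proof -
    have "Q' * N = (Q' * Q) * (shift_mat l \<beta>l * Q')" unfolding Qw(3) using d by (simp add: mat_assoc)
    thus ?thesis unfolding Qw(2) using d by simp
  qed
  have dXN: "dim_row X = m" "dim_col X = m" "dim_row N = l" "dim_col N = l" using assms(3,4) by auto
  have "X * (P * \<Phi> * Q') = (X * P) * (\<Phi> * Q')" using d dXN by (simp add: mat_assoc)
  also have "\<dots> = P * ((shift_mat m \<beta>m * \<Phi>) * Q')" unfolding XP using d by (simp add: mat_assoc)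
  also have "\<dots> = P * (\<Phi> * (shift_mat l \<beta>l * Q'))" unfolding \<Phi>(2) using d by (simp add: mat_assoc)
  also have "\<dots> = P * \<Phi> * Q' * N" unfolding QN[symmetric] using d dXN by (simp add: mat_assoc)
  finally have "X * (P * \<Phi> * Q') = P * \<Phi> * Q' * N" .
  moreover have "ample_cokernel X (P * \<Phi> * Q') (excess (pdiff tt \<mu> lam))"
    by (rule ample_cokernel_conj[OF \<Phi>(3) _ \<Phi>(1) Pw(6,7,2) Qw(6,7,2) assms(3) XP]) simp
  moreover have "P * \<Phi> * Q' \<in> carrier_mat m l" using d by (intro carrier_matI) auto
  ultimately show ?thesis by blast
qed

section \<open>Block matrices at a source\<close>

locale source_vertex =
  fixes n :: nat and A :: "'a set" and s t :: "'a \<Rightarrow> nat" and k :: nat and d :: "nat \<Rightarrow> nat"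
    and \<kappa> :: "nat \<Rightarrow> 'a \<times> nat" and m :: nat
  assumes finA: "finite A" and s_less: "\<And>a. a \<in> A \<Longrightarrow> s a < n" and t_less: "\<And>a. a \<in> A \<Longrightarrow> t a < n"
    and t_neq: "\<And>a. a \<in> A \<Longrightarrow> t a \<noteq> k" and k_less: "k < n"
    and \<kappa>: "bij_betw \<kappa> {..<m} (SIGMA a:{a\<in>A. s a = k}. {..<d (t a)})"
begin

abbreviation "Out \<equiv> {a\<in>A. s a = k}"

lemma finite_Out [simp]: "finite Out" using finA by simp

lemma \<kappa>_mem: "p < m \<Longrightarrow> fst (\<kappa> p) \<in> A" "p < m \<Longrightarrow> s (fst (\<kappa> p)) = k" "p < m \<Longrightarrow> snd (\<kappa> p) < d (t (fst (\<kappa> p)))"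
proof -
  show "p < m \<Longrightarrow> fst (\<kappa> p) \<in> A" "p < m \<Longrightarrow> s (fst (\<kappa> p)) = k" "p < m \<Longrightarrow> snd (\<kappa> p) < d (t (fst (\<kappa> p)))"
    using bij_betwE[OF \<kappa>, rule_format, of p] by auto
qed

lemma \<kappa>_surj: "a \<in> Out \<Longrightarrow> r < d (t a) \<Longrightarrow> \<exists>p<m. \<kappa> p = (a, r)"
  using \<kappa> unfolding bij_betw_def by (metis (no_types, lifting) SigmaI imageE lessThan_iff)

lemma \<kappa>_inj: "p < m \<Longrightarrow> q < m \<Longrightarrow> \<kappa> p = \<kappa> q \<longleftrightarrow> p = q"
  using \<kappa> unfolding bij_betw_def inj_on_def by blast

lemma sum_\<kappa>: "(\<Sum>p<m. F (fst (\<kappa> p)) (snd (\<kappa> p))) = (\<Sum>a\<in>Out. \<Sum>r<d (t a). F a r)"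
proof -
  have "(\<Sum>p<m. F (fst (\<kappa> p)) (snd (\<kappa> p))) = (\<Sum>x\<in>(SIGMA a:Out. {..<d (t a)}). F (fst x) (snd x))"
    by (rule sum.reindex_bij_betw[OF \<kappa>])
  also have "\<dots> = (\<Sum>a\<in>Out. \<Sum>r<d (t a). F a r)"
    by (subst sum.Sigma) (auto intro!: sum.cong)
  finally show ?thesis .
qed

definition stack :: "('a \<Rightarrow> 'k::field mat) \<Rightarrow> nat \<Rightarrow> 'k mat" where
  "stack f c = mat m c (\<lambda>(p, j). f (fst (\<kappa> p)) $$ (snd (\<kappa> p), j))"

definition flat :: "('a \<Rightarrow> 'k::field mat) \<Rightarrow> nat \<Rightarrow> 'k mat" where
  "flat g w = mat w m (\<lambda>(i, p). g (fst (\<kappa> p)) $$ (i, snd (\<kappa> p)))"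

definition bdiag :: "(nat \<Rightarrow> 'k::field mat) \<Rightarrow> 'k mat" where
  "bdiag N = mat m m (\<lambda>(p, q). if fst (\<kappa> p) = fst (\<kappa> q) then N (t (fst (\<kappa> p))) $$ (snd (\<kappa> p), snd (\<kappa> q)) else 0)"

lemma block_dims [simp]: "dim_row (stack f c) = m" "dim_col (stack f c) = c" "dim_row (flat g w) = w"
  "dim_col (flat g w) = m" "dim_row (bdiag N) = m" "dim_col (bdiag N) = m"
  by (auto simp: stack_def flat_def bdiag_def)

lemma block_carrier [simp]: "stack f c \<in> carrier_mat m c" "flat g w \<in> carrier_mat w m" "bdiag N \<in> carrier_mat m m"
  by (auto simp: stack_def flat_def bdiag_def)

lemma bdiag_stack:
  assumes "\<And>a. a \<in> Out \<Longrightarrow> N (t a) \<in> carrier_mat (d (t a)) (d (t a))"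
    "\<And>a. a \<in> Out \<Longrightarrow> f a \<in> carrier_mat (d (t a)) c"
  shows "bdiag N * stack f c = stack (\<lambda>a. N (t a) * f a) c"
proof (rule eq_matI)
  fix p j assume "p < dim_row (stack (\<lambda>a. N (t a) * f a) c)" "j < dim_col (stack (\<lambda>a. N (t a) * f a) c)"
  hence pj: "p < m" "j < c" by auto
  obtain a r where ar: "\<kappa> p = (a, r)" by (cases "\<kappa> p")
  have a: "a \<in> Out" "r < d (t a)" using \<kappa>_mem[OF pj(1)] ar by auto
  note Na = carrier_matD[OF assms(1)[OF a(1)]] and fa = carrier_matD[OF assms(2)[OF a(1)]]
  have "(bdiag N * stack f c) $$ (p, j) = (\<Sum>l<m. (\<lambda>a' r'. (if a' = a then N (t a) $$ (r, r') * f a $$ (r', j) else 0))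
      (fst (\<kappa> l)) (snd (\<kappa> l)))"
    using pj ar by (subst index_mult_sum) (auto simp: bdiag_def stack_def intro!: sum.cong)
  also have "\<dots> = (\<Sum>a'\<in>Out. \<Sum>r'<d (t a'). (if a' = a then N (t a) $$ (r, r') * f a $$ (r', j) else 0))"
    by (rule sum_\<kappa>)
  also have "\<dots> = (\<Sum>a'\<in>Out. if a' = a then (\<Sum>r'<d (t a). N (t a) $$ (r, r') * f a $$ (r', j)) else 0)"
    by (rule sum.cong) auto
  also have "\<dots> = (\<Sum>r'<d (t a). N (t a) $$ (r, r') * f a $$ (r', j))" using a by (subst sum.delta) auto
  also have "\<dots> = (N (t a) * f a) $$ (r, j)" using a pj Na fa by (subst index_mult_sum) auto
  finally show "(bdiag N * stack f c) $$ (p, j) = stack (\<lambda>a. N (t a) * f a) c $$ (p, j)"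
    using pj ar by (simp add: stack_def)
qed auto

lemma flat_bdiag:
  assumes "\<And>a. a \<in> Out \<Longrightarrow> N (t a) \<in> carrier_mat (d (t a)) (d (t a))"
    "\<And>a. a \<in> Out \<Longrightarrow> g a \<in> carrier_mat w (d (t a))"
  shows "flat g w * bdiag N = flat (\<lambda>a. g a * N (t a)) w"
proof (rule eq_matI)
  fix i p assume "i < dim_row (flat (\<lambda>a. g a * N (t a)) w)" "p < dim_col (flat (\<lambda>a. g a * N (t a)) w)"
  hence ip: "i < w" "p < m" by auto
  obtain a r where ar: "\<kappa> p = (a, r)" by (cases "\<kappa> p")
  have a: "a \<in> Out" "r < d (t a)" using \<kappa>_mem[OF ip(2)] ar by auto
  note Na = carrier_matD[OF assms(1)[OF a(1)]] and ga = carrier_matD[OF assms(2)[OF a(1)]]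
  have "(flat g w * bdiag N) $$ (i, p) = (\<Sum>l<m. (\<lambda>a' r'. (if a' = a then g a $$ (i, r') * N (t a) $$ (r', r) else 0))
      (fst (\<kappa> l)) (snd (\<kappa> l)))"
    using ip ar by (subst index_mult_sum) (auto simp: bdiag_def flat_def intro!: sum.cong)
  also have "\<dots> = (\<Sum>a'\<in>Out. \<Sum>r'<d (t a'). (if a' = a then g a $$ (i, r') * N (t a) $$ (r', r) else 0))"
    by (rule sum_\<kappa>)
  also have "\<dots> = (\<Sum>a'\<in>Out. if a' = a then (\<Sum>r'<d (t a). g a $$ (i, r') * N (t a) $$ (r', r)) else 0)"
    by (rule sum.cong) auto
  also have "\<dots> = (\<Sum>r'<d (t a). g a $$ (i, r') * N (t a) $$ (r', r))" using a by (subst sum.delta) auto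
  also have "\<dots> = (g a * N (t a)) $$ (i, r)" using a ip Na ga by (subst index_mult_sum) auto
  finally show "(flat g w * bdiag N) $$ (i, p) = flat (\<lambda>a. g a * N (t a)) w $$ (i, p)"
    using ip ar by (simp add: flat_def)
qed auto

lemma stack_mult:
  assumes "\<And>a. a \<in> Out \<Longrightarrow> f a \<in> carrier_mat (d (t a)) c" "M \<in> carrier_mat c c'"
  shows "stack f c * M = stack (\<lambda>a. f a * M) c'"
proof (rule eq_matI)
  fix p j assume "p < dim_row (stack (\<lambda>a. f a * M) c')" "j < dim_col (stack (\<lambda>a. f a * M) c')"
  hence pj: "p < m" "j < c'" by auto
  note a = \<kappa>_mem[OF pj(1)]
  have "f (fst (\<kappa> p)) \<in> carrier_mat (d (t (fst (\<kappa> p)))) c" using assms(1) a by auto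
  thus "(stack f c * M) $$ (p, j) = stack (\<lambda>a. f a * M) c' $$ (p, j)"
    using pj a assms(2) by (auto simp: stack_def index_mult_sum simp del: index_mult_mat(1))
qed (use assms in auto)

lemma mult_flat:
  assumes "\<And>a. a \<in> Out \<Longrightarrow> g a \<in> carrier_mat w (d (t a))" "M \<in> carrier_mat w' w"
  shows "M * flat g w = flat (\<lambda>a. M * g a) w'"
proof (rule eq_matI)
  fix i p assume "i < dim_row (flat (\<lambda>a. M * g a) w')" "p < dim_col (flat (\<lambda>a. M * g a) w')"
  hence ip: "i < w'" "p < m" by auto
  note a = \<kappa>_mem[OF ip(2)]
  have "g (fst (\<kappa> p)) \<in> carrier_mat w (d (t (fst (\<kappa> p))))" using assms(1) a by auto
  thus "(M * flat g w) $$ (i, p) = flat (\<lambda>a. M * g a) w' $$ (i, p)"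
    using ip a assms(2) by (auto simp: flat_def index_mult_sum simp del: index_mult_mat(1))
qed (use assms in auto)

lemma stack_eq_iff:
  assumes "\<And>a. a \<in> Out \<Longrightarrow> f a \<in> carrier_mat (d (t a)) c" "\<And>a. a \<in> Out \<Longrightarrow> f' a \<in> carrier_mat (d (t a)) c"
  shows "stack f c = stack f' c \<longleftrightarrow> (\<forall>a\<in>Out. f a = f' a)"
proof
  assume eq: "stack f c = stack f' c"
  show "\<forall>a\<in>Out. f a = f' a"
  proof
    fix a assume a: "a \<in> Out"
    show "f a = f' a"
    proof (rule eq_matI)
      fix r j assume "r < dim_row (f' a)" "j < dim_col (f' a)"
      hence rj: "r < d (t a)" "j < c" using carrier_matD[OF assms(2)[OF a]] by auto
      obtain p where p: "p < m" "\<kappa> p = (a, r)" using \<kappa>_surj[OF a rj(1)] by blast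
      show "f a $$ (r, j) = f' a $$ (r, j)"
        using arg_cong[OF eq, of "\<lambda>M. M $$ (p, j)"] p rj by (simp add: stack_def)
    qed (use carrier_matD[OF assms(1)[OF a]] carrier_matD[OF assms(2)[OF a]] in auto)
  qed
next
  assume "\<forall>a\<in>Out. f a = f' a"
  thus "stack f c = stack f' c" using \<kappa>_mem by (intro eq_matI) (auto simp: stack_def)
qed

lemma flat_eq_iff:
  assumes "\<And>a. a \<in> Out \<Longrightarrow> g a \<in> carrier_mat w (d (t a))" "\<And>a. a \<in> Out \<Longrightarrow> g' a \<in> carrier_mat w (d (t a))"
  shows "flat g w = flat g' w \<longleftrightarrow> (\<forall>a\<in>Out. g a = g' a)"
proof
  assume eq: "flat g w = flat g' w"
  show "\<forall>a\<in>Out. g a = g' a"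
  proof
    fix a assume a: "a \<in> Out"
    show "g a = g' a"
    proof (rule eq_matI)
      fix i r assume "i < dim_row (g' a)" "r < dim_col (g' a)"
      hence ir: "i < w" "r < d (t a)" using carrier_matD[OF assms(2)[OF a]] by auto
      obtain p where p: "p < m" "\<kappa> p = (a, r)" using \<kappa>_surj[OF a ir(2)] by blast
      show "g a $$ (i, r) = g' a $$ (i, r)"
        using arg_cong[OF eq, of "\<lambda>M. M $$ (i, p)"] p ir by (simp add: flat_def)
    qed (use carrier_matD[OF assms(1)[OF a]] carrier_matD[OF assms(2)[OF a]] in auto)
  qed
next
  assume "\<forall>a\<in>Out. g a = g' a"
  thus "flat g w = flat g' w" using \<kappa>_mem by (intro eq_matI) (auto simp: flat_def)
qed

lemma stack_surj:
  assumes "M \<in> carrier_mat m c"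
  obtains f where "\<And>a. f a \<in> carrier_mat (d (t a)) c" "stack f c = M"
proof -
  define f where "f a = mat (d (t a)) c (\<lambda>(r, j). M $$ (the_inv_into {..<m} \<kappa> (a, r), j))" for a
  have inj: "inj_on \<kappa> {..<m}" using \<kappa> by (simp add: bij_betw_def)
  have "stack f c = M"
  proof (rule eq_matI)
    fix p j assume "p < dim_row M" "j < dim_col M"
    hence pj: "p < m" "j < c" using assms by auto
    have "the_inv_into {..<m} \<kappa> (fst (\<kappa> p), snd (\<kappa> p)) = p"
      using the_inv_into_f_f[OF inj, of p] pj by simp
    thus "stack f c $$ (p, j) = M $$ (p, j)"
      using pj \<kappa>_mem(3)[OF pj(1)] by (simp add: stack_def f_def)
  qed (use assms in auto)
  thus ?thesis using that[of f] by (simp add: f_def)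
qed

lemma bdiag_mult:
  assumes "\<And>a. a \<in> Out \<Longrightarrow> N (t a) \<in> carrier_mat (d (t a)) (d (t a))"
    "\<And>a. a \<in> Out \<Longrightarrow> N' (t a) \<in> carrier_mat (d (t a)) (d (t a))"
  shows "bdiag N * bdiag N' = bdiag (\<lambda>i. N i * N' i)"
proof (rule eq_matI)
  fix p q assume "p < dim_row (bdiag (\<lambda>i. N i * N' i))" "q < dim_col (bdiag (\<lambda>i. N i * N' i))"
  hence pq: "p < m" "q < m" by auto
  obtain a r where ar: "\<kappa> p = (a, r)" by (cases "\<kappa> p")
  obtain b u where bu: "\<kappa> q = (b, u)" by (cases "\<kappa> q")
  have a: "a \<in> Out" "r < d (t a)" using \<kappa>_mem[OF pq(1)] ar by auto
  have b: "b \<in> Out" "u < d (t b)" using \<kappa>_mem[OF pq(2)] bu by auto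
  note Na = carrier_matD[OF assms(1)[OF a(1)]] and Na' = carrier_matD[OF assms(2)[OF a(1)]]
  have "(bdiag N * bdiag N') $$ (p, q) = (\<Sum>l<m. (\<lambda>a' r'. (if a' = a then
      (if a = b then N (t a) $$ (r, r') * N' (t a) $$ (r', u) else 0) else 0))
      (fst (\<kappa> l)) (snd (\<kappa> l)))"
    using pq ar bu by (subst index_mult_sum) (auto simp: bdiag_def intro!: sum.cong)
  also have "\<dots> = (\<Sum>a'\<in>Out. \<Sum>r'<d (t a'). (if a' = a then
      (if a = b then N (t a) $$ (r, r') * N' (t a) $$ (r', u) else 0) else 0))"
    by (rule sum_\<kappa>)
  also have "\<dots> = (\<Sum>a'\<in>Out. if a' = a then (\<Sum>r'<d (t a).
      (if a = b then N (t a) $$ (r, r') * N' (t a) $$ (r', u) else 0)) else 0)"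
    by (rule sum.cong) auto
  also have "\<dots> = (\<Sum>r'<d (t a). (if a = b then N (t a) $$ (r, r') * N' (t a) $$ (r', u) else 0))"
    using a by (subst sum.delta) auto
  also have "\<dots> = (if a = b then (N (t a) * N' (t a)) $$ (r, u) else 0)"
    using a b Na Na' by (auto simp: index_mult_sum simp del: index_mult_mat(1))
  finally show "(bdiag N * bdiag N') $$ (p, q) = bdiag (\<lambda>i. N i * N' i) $$ (p, q)"
    using pq ar bu by (simp add: bdiag_def)
qed auto

lemma bdiag_cong: "(\<And>a. a \<in> Out \<Longrightarrow> N (t a) = N' (t a)) \<Longrightarrow> bdiag N = bdiag N'"
  using \<kappa>_mem by (intro eq_matI) (auto simp: bdiag_def)

lemma bdiag_one:
  assumes "\<And>a. a \<in> Out \<Longrightarrow> N (t a) = 1\<^sub>m (d (t a))" shows "bdiag N = 1\<^sub>m m"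
proof (rule eq_matI)
  fix p q assume "p < dim_row (1\<^sub>m m :: 'b mat)" "q < dim_col (1\<^sub>m m :: 'b mat)"
  hence pq: "p < m" "q < m" by auto
  have "fst (\<kappa> p) \<in> Out" using \<kappa>_mem[OF pq(1)] by simp
  hence "N (t (fst (\<kappa> p))) = 1\<^sub>m (d (t (fst (\<kappa> p))))" by (rule assms)
  thus "bdiag N $$ (p, q) = 1\<^sub>m m $$ (p, q)"
    using pq \<kappa>_mem[OF pq(1)] \<kappa>_mem[OF pq(2)] \<kappa>_inj[OF pq] by (auto simp: bdiag_def prod_eq_iff)
qed auto

lemma bdiag_pow:
  assumes "\<And>a. a \<in> Out \<Longrightarrow> N (t a) \<in> carrier_mat (d (t a)) (d (t a))"
  shows "bdiag N ^\<^sub>m j = bdiag (\<lambda>i. N i ^\<^sub>m j)"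
proof (induction j)
  case 0
  have "bdiag (\<lambda>i. N i ^\<^sub>m 0) = 1\<^sub>m m"
    by (rule bdiag_one) (use carrier_matD(1)[OF assms] in simp)
  thus ?case by simp
next
  case (Suc j)
  have "bdiag (\<lambda>i. N i ^\<^sub>m j) * bdiag N = bdiag (\<lambda>i. N i ^\<^sub>m j * N i)"
    by (rule bdiag_mult) (use assms in auto)
  thus ?case using Suc by simp
qed

lemma bdiag_similar:
  assumes "\<And>a. a \<in> Out \<Longrightarrow> N (t a) \<in> carrier_mat (d (t a)) (d (t a))"
    and "\<And>a. a \<in> Out \<Longrightarrow> similar_mat_wit (N (t a)) (N' (t a)) (P (t a)) (Q (t a))"
  shows "similar_mat (bdiag N) (bdiag N')"
proof (rule similar_matI[of _ _ "bdiag P" "bdiag Q" m])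
  note w = similar_mat_witD2[OF assms(1) assms(2)]
  show "bdiag P * bdiag Q = 1\<^sub>m m" using w by (subst bdiag_mult) (auto intro: bdiag_one)
  show "bdiag Q * bdiag P = 1\<^sub>m m" using w by (subst bdiag_mult) (auto intro: bdiag_one)
  have "bdiag P * bdiag N' = bdiag (\<lambda>i. P i * N' i)" by (rule bdiag_mult) (use w in auto)
  moreover have "bdiag (\<lambda>i. P i * N' i) * bdiag Q = bdiag (\<lambda>i. P i * N' i * Q i)"
    by (rule bdiag_mult) (use mult_carrier_mat[OF w(6) w(5)] w(7) in auto)
  moreover have "bdiag N = bdiag (\<lambda>i. P i * N' i * Q i)" by (rule bdiag_cong) (use w in auto)
  ultimately show "bdiag N = bdiag P * bdiag N' * bdiag Q" by simp
qed auto

lemma sum_mset_Sigma: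
  assumes "finite B" "\<And>a. a \<in> B \<Longrightarrow> finite (C a)"
  shows "(\<Sum>a\<in>B. image_mset (\<lambda>i. F (a, i)) (mset_set (C a))) = image_mset F (mset_set (Sigma B C))"
  using assms
proof (induction B rule: finite_induct)
  case (insert b B)
  have split: "Sigma (insert b B) C = Pair b ` C b \<union> Sigma B C" by auto
  have "mset_set (Sigma (insert b B) C) = mset_set (Pair b ` C b) + mset_set (Sigma B C)"
    unfolding split using insert by (intro mset_set_Union) auto
  moreover have "mset_set (Pair b ` C b) = image_mset (Pair b) (mset_set (C b))"
    by (rule image_mset_mset_set[symmetric]) (auto simp: inj_on_def)
  ultimately show ?case using insert by (simp add: multiset.map_comp comp_def)
qed auto

lemma bdiag_jordan_type:
  assumes "\<And>a. a \<in> Out \<Longrightarrow> N (t a) \<in> carrier_mat (d (t a)) (d (t a))"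
    and "\<And>a. a \<in> Out \<Longrightarrow> jordan_type (N (t a)) (\<nu> (t a))"
  shows "jordan_type (bdiag N :: 'k::field mat) (adj_partition A s t \<nu> k)"
proof -
  have "\<exists>\<beta> P Q. bij_betw \<beta> {..<d (t a)} (diagram (\<nu> (t a))) \<and>
      similar_mat_wit (N (t a)) (shift_mat (d (t a)) \<beta>) P Q" if a: "a \<in> Out" for a
  proof -
    obtain n' \<beta> where *: "bij_betw \<beta> {..<n'} (diagram (\<nu> (t a)))" "similar_mat (N (t a)) (shift_mat n' \<beta>)"
      using assms(2)[OF a] unfolding jordan_type_iff jordan_shape_def by blast
    then obtain P Q where w: "similar_mat_wit (N (t a)) (shift_mat n' \<beta>) P Q" unfolding similar_mat_def by blast
    have "n' = d (t a)" using similar_mat_witD2(5)[OF assms(1)[OF a] w] by auto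
    thus ?thesis using * w by blast
  qed
  hence "\<forall>i\<in>t ` Out. \<exists>x. bij_betw (fst x) {..<d i} (diagram (\<nu> i)) \<and>
      similar_mat_wit (N i) (shift_mat (d i) (fst x)) (fst (snd x)) (snd (snd x))"
    by fastforce
  then obtain x where x: "\<forall>i\<in>t ` Out. bij_betw (fst (x i)) {..<d i} (diagram (\<nu> i)) \<and>
      similar_mat_wit (N i) (shift_mat (d i) (fst (x i))) (fst (snd (x i))) (snd (snd (x i)))"
    by (rule bchoice[THEN exE])
  define \<beta> where "\<beta> i = fst (x i)" for i
  have bij: "bij_betw (\<beta> (t a)) {..<d (t a)} (diagram (\<nu> (t a)))" if "a \<in> Out" for a
    using x that unfolding \<beta>_def by blast
  have sim: "similar_mat (bdiag N) (bdiag (\<lambda>i. shift_mat (d i) (\<beta> i)))"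
    by (rule bdiag_similar[where P = "\<lambda>i. fst (snd (x i))" and Q = "\<lambda>i. snd (snd (x i))"])
       (use assms(1) x \<beta>_def in auto)
  define p where "p ai = (if fst ai \<in> Out then \<nu> (t (fst ai)) (snd ai) else 0)" for ai :: "'a \<times> nat"
  define \<theta> where "\<theta> y = (let (a, r) = y; (i, q) = \<beta> (t a) r in ((a, i), q))" for y :: "'a \<times> nat"
  have "bij_betw \<theta> (SIGMA a:Out. {..<d (t a)}) (diagram p)"
    unfolding bij_betw_def
  proof
    show "inj_on \<theta> (SIGMA a:Out. {..<d (t a)})"
    proof (rule inj_onI)
      fix y z assume yz: "y \<in> (SIGMA a:Out. {..<d (t a)})" "z \<in> (SIGMA a:Out. {..<d (t a)})" "\<theta> y = \<theta> z"
      obtain a r b u where y: "y = (a, r)" and z: "z = (b, u)" by (metis prod.exhaust)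
      have *: "a = b" "\<beta> (t a) r = \<beta> (t a) u" using yz(3) unfolding y z by (auto simp: \<theta>_def split: prod.splits)
      have "a \<in> Out" "r < d (t a)" "u < d (t a)" using yz(1,2) * y z by auto
      thus "y = z" using bij[of a] * y z by (auto simp: bij_betw_def inj_on_def)
    qed
    show "\<theta> ` (SIGMA a:Out. {..<d (t a)}) = diagram p"
    proof (intro equalityI subsetI)
      fix z assume "z \<in> \<theta> ` (SIGMA a:Out. {..<d (t a)})"
      then obtain a r where ar: "a \<in> Out" "r < d (t a)" "z = \<theta> (a, r)" by blast
      thus "z \<in> diagram p" using bij_betwE[OF bij[OF ar(1)]]
        by (auto simp: \<theta>_def p_def diagram_def split: prod.splits)
    next
      fix z assume z: "z \<in> diagram p"
      obtain a i q where aiq: "z = ((a, i), q)" by (metis prod.exhaust)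
      have a: "a \<in> Out" "(i, q) \<in> diagram (\<nu> (t a))" using z aiq by (auto simp: diagram_def p_def split: if_splits)
      then obtain r where "r < d (t a)" "\<beta> (t a) r = (i, q)"
        using bij[OF a(1)] unfolding bij_betw_def by (metis (no_types, lifting) imageE lessThan_iff)
      thus "z \<in> \<theta> ` (SIGMA a:Out. {..<d (t a)})" using a aiq by (force simp: \<theta>_def image_iff)
    qed
  qed
  hence "bij_betw (\<theta> \<circ> \<kappa>) {..<m} (diagram p)" using bij_betw_trans[OF \<kappa>] by blast
  moreover have "bdiag (\<lambda>i. shift_mat (d i) (\<beta> i)) = (shift_mat m (\<theta> \<circ> \<kappa>) :: 'k mat)"
  proof (rule eq_matI)
    fix u v assume "u < dim_row (shift_mat m (\<theta> \<circ> \<kappa>) :: 'k mat)" "v < dim_col (shift_mat m (\<theta> \<circ> \<kappa>) :: 'k mat)"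
    hence uv: "u < m" "v < m" by auto
    show "bdiag (\<lambda>i. shift_mat (d i) (\<beta> i)) $$ (u, v) = (shift_mat m (\<theta> \<circ> \<kappa>) :: 'k mat) $$ (u, v)"
      using uv \<kappa>_mem[OF uv(1)] \<kappa>_mem[OF uv(2)]
      by (auto simp: bdiag_def shift_mat_def \<theta>_def prod_eq_iff split: prod.splits)
  qed auto
  ultimately have shape: "jordan_shape (bdiag N) p" using sim unfolding jordan_shape_def by metis
  define I where "I = (SIGMA a:Out. {..<num_parts (\<nu> (t a))})"
  define M where "M = (\<Sum>a\<in>Out. parts_mset (\<nu> (t a)))"
  have part: "partition (\<nu> (t a))" if "a \<in> Out" for a using assms(2)[OF that] unfolding jordan_type_iff by blast
  have supp: "{ai. p ai \<noteq> 0} = I"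
    unfolding p_def I_def using partition_nonzero_iff[OF part] by (auto split: if_splits)
  have finI: "finite I" unfolding I_def by auto
  have "parts_mset (\<nu> (t a)) = image_mset (\<lambda>i. p (a, i)) (mset_set {..<num_parts (\<nu> (t a))})" if "a \<in> Out" for a
    using that by (simp add: parts_mset_def p_def atLeast0LessThan)
  hence M: "M = image_mset p (mset_set I)" unfolding M_def I_def
    by (subst sum_mset_Sigma[symmetric]) (auto intro!: sum.cong)
  have adj: "adj_partition A s t \<nu> k = partition_of_mset M" unfolding adj_partition_def M_def ..
  obtain \<iota> where \<iota>: "bij_betw \<iota> I {..<size M}" "\<And>i. i \<in> I \<Longrightarrow> partition_of_mset M (\<iota> i) = p i"
    using partition_of_mset_reindex[OF finI M] by blast
  have M0: "0 \<notin># M" unfolding M using finI supp by auto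
  have "jordan_shape (bdiag N) (partition_of_mset M)"
  proof (rule jordan_shape_reindex[OF shape, of \<iota>], unfold supp)
    show "\<iota> ` I = {i. partition_of_mset M i \<noteq> 0}"
      using \<iota>(1) partition_support[OF partition_of_mset_partition(1)[OF M0]]
        partition_of_mset_partition(2)[OF M0] by (simp add: bij_betw_def)
    show "partition_of_mset M (\<iota> i) = p i" if "p i \<noteq> 0" for i
      using \<iota>(2)[of i] that supp by blast
  qed (use \<iota>(1) in \<open>simp add: bij_betw_def\<close>)
  thus ?thesis unfolding adj jordan_type_iff using partition_of_mset_partition(1)[OF M0] by blast
qed

end

section \<open>Deforming intertwiners along a line of representations\<close>

definition linfun :: "'v set \<Rightarrow> (('v \<Rightarrow> 'k::field) \<Rightarrow> 'k) \<Rightarrow> bool" where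
  "linfun I \<phi> \<longleftrightarrow> (\<forall>y. \<phi> y = (\<Sum>v\<in>I. y v * \<phi> (\<lambda>u. if u = v then 1 else 0)))"

lemma linfun_coord: "finite I \<Longrightarrow> v \<in> I \<Longrightarrow> linfun I (\<lambda>y. y v)"
  by (simp add: linfun_def sum_mult_delta)

lemma linfun_zero: "linfun I (\<lambda>y. 0)"
  by (simp add: linfun_def)

lemma linfunD: "linfun I \<phi> \<Longrightarrow> \<phi> y = (\<Sum>v\<in>I. y v * \<phi> (\<lambda>u. if u = v then 1 else 0))"
  unfolding linfun_def by blast

lemma linfun_add:
  assumes "linfun I \<phi>" "linfun I \<psi>" shows "linfun I (\<lambda>y. \<phi> y + \<psi> y)"
  unfolding linfun_def
proof
  fix y
  show "\<phi> y + \<psi> y = (\<Sum>v\<in>I. y v * (\<phi> (\<lambda>u. if u = v then 1 else 0) + \<psi> (\<lambda>u. if u = v then 1 else 0)))"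
    by (rule trans[OF arg_cong2[OF linfunD[OF assms(1)] linfunD[OF assms(2)], of plus]])
       (simp add: distrib_left sum.distrib)
qed

lemma linfun_cmult:
  assumes "linfun I \<phi>" shows "linfun I (\<lambda>y. c * \<phi> y)"
  unfolding linfun_def
proof
  fix y
  show "c * \<phi> y = (\<Sum>v\<in>I. y v * (c * \<phi> (\<lambda>u. if u = v then 1 else 0)))"
    by (rule trans[OF arg_cong[OF linfunD[OF assms], of "times c"]]) (simp add: sum_distrib_left mult.left_commute)
qed

lemma linfun_multc: "linfun I \<phi> \<Longrightarrow> linfun I (\<lambda>y. \<phi> y * c)"
  using linfun_cmult[of I \<phi> c] by (simp add: mult.commute)

lemma linfun_diff: "linfun I \<phi> \<Longrightarrow> linfun I \<psi> \<Longrightarrow> linfun I (\<lambda>y. \<phi> y - \<psi> y)"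
  using linfun_add[OF _ linfun_cmult[of I \<psi> "- 1"], of \<phi>] by simp

lemma linfun_sum: "(\<And>x. x \<in> B \<Longrightarrow> linfun I (\<phi> x)) \<Longrightarrow> linfun I (\<lambda>y. \<Sum>x\<in>B. \<phi> x y)"
  by (induction B rule: infinite_finite_induct) (auto intro: linfun_zero linfun_add)

definition opmat :: "nat \<Rightarrow> (nat \<Rightarrow> 'w) \<Rightarrow> nat \<Rightarrow> (nat \<Rightarrow> 'v) \<Rightarrow> (('v \<Rightarrow> 'k::field) \<Rightarrow> 'w \<Rightarrow> 'k) \<Rightarrow> 'k mat" where
  "opmat nJ eJ nI eI F = mat nJ nI (\<lambda>(w, v). F (\<lambda>u. if u = eI v then 1 else 0) (eJ w))"

definition cvec :: "nat \<Rightarrow> (nat \<Rightarrow> 'v) \<Rightarrow> ('v \<Rightarrow> 'k) \<Rightarrow> 'k mat" where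
  "cvec nI eI y = mat nI 1 (\<lambda>(v, _). y (eI v))"

lemma opmat_dims [simp]: "dim_row (opmat nJ eJ nI eI F) = nJ" "dim_col (opmat nJ eJ nI eI F) = nI"
  by (simp_all add: opmat_def)

lemma opmat_cvec:
  assumes "bij_betw eI {..<nI} I" "\<And>w. w < nJ \<Longrightarrow> linfun I (\<lambda>y. F y (eJ w))"
  shows "opmat nJ eJ nI eI F * cvec nI eI y = cvec nJ eJ (F y)"
proof (rule eq_matI)
  fix w c assume "w < dim_row (cvec nJ eJ (F y))" "c < dim_col (cvec nJ eJ (F y))"
  hence wc: "w < nJ" "c = 0" by (auto simp: cvec_def)
  have "(opmat nJ eJ nI eI F * cvec nI eI y) $$ (w, c) =
      (\<Sum>l<nI. y (eI l) * F (\<lambda>u. if u = eI l then 1 else 0) (eJ w))"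
    using wc by (subst index_mult_sum) (auto simp: opmat_def cvec_def intro!: sum.cong)
  also have "\<dots> = (\<Sum>v\<in>I. y v * F (\<lambda>u. if u = v then 1 else 0) (eJ w))" by (rule sum.reindex_bij_betw[OF assms(1)])
  also have "\<dots> = F y (eJ w)" by (rule linfunD[OF assms(2)[OF wc(1)], symmetric])
  finally show "(opmat nJ eJ nI eI F * cvec nI eI y) $$ (w, c) = cvec nJ eJ (F y) $$ (w, c)"
    using wc by (simp add: cvec_def)
qed (auto simp: cvec_def)

lemma opmat_comp:
  assumes "bij_betw eI' {..<nI'} I'" "\<And>w. w < nJ \<Longrightarrow> linfun I' (\<lambda>y. F y (eJ w))"
  shows "opmat nJ eJ nI eI (\<lambda>y. F (F' y)) = opmat nJ eJ nI' eI' F * opmat nI' eI' nI eI F'"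
proof (rule eq_matI)
  fix w v assume "w < dim_row (opmat nJ eJ nI' eI' F * opmat nI' eI' nI eI F')"
    "v < dim_col (opmat nJ eJ nI' eI' F * opmat nI' eI' nI eI F')"
  hence wv: "w < nJ" "v < nI" by auto
  let ?y = "F' (\<lambda>u. if u = eI v then 1 else 0)"
  have "(opmat nJ eJ nI' eI' F * opmat nI' eI' nI eI F') $$ (w, v) =
      (\<Sum>l<nI'. ?y (eI' l) * F (\<lambda>u. if u = eI' l then 1 else 0) (eJ w))"
    using wv by (subst index_mult_sum) (auto simp: opmat_def intro!: sum.cong)
  also have "\<dots> = (\<Sum>v\<in>I'. ?y v * F (\<lambda>u. if u = v then 1 else 0) (eJ w))" by (rule sum.reindex_bij_betw[OF assms(1)])
  also have "\<dots> = F ?y (eJ w)" by (rule linfunD[OF assms(2)[OF wv(1)], symmetric])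
  finally show "opmat nJ eJ nI eI (\<lambda>y. F (F' y)) $$ (w, v) = (opmat nJ eJ nI' eI' F * opmat nI' eI' nI eI F') $$ (w, v)"
    using wv by (simp add: opmat_def)
qed auto

definition end_mats :: "(nat \<Rightarrow> nat) \<Rightarrow> (nat \<times> nat \<times> nat \<Rightarrow> 'k) \<Rightarrow> nat \<Rightarrow> 'k mat" where
  "end_mats d y i = mat (d i) (d i) (\<lambda>(r, c). y (i, r, c))"

lemma end_mats_carrier [simp]: "end_mats d y i \<in> carrier_mat (d i) (d i)"
  and end_mats_dims [simp]: "dim_row (end_mats d y i) = d i" "dim_col (end_mats d y i) = d i"
  by (simp_all add: end_mats_def)

lemma end_mats_coords:
  assumes "i < n" "N i \<in> carrier_mat (d i) (d i)"
  shows "end_mats d (end_coords n d N) i = N i"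
  using assms by (intro eq_matI) (auto simp: end_mats_def end_coords_def)

lemma intertwiner_path:
  fixes F :: "'k::field \<Rightarrow> 'a \<Rightarrow> 'k mat" and f :: "'a \<Rightarrow> 'k mat" and h :: "nat \<Rightarrow> 'k mat"
  assumes finA: "finite A" and st: "\<And>a. a \<in> A \<Longrightarrow> s a < n" "\<And>a. a \<in> A \<Longrightarrow> t a < n"
    and f: "\<And>a. a \<in> A \<Longrightarrow> f a \<in> carrier_mat (d (t a)) (d (s a))"
    and F: "\<And>x a. a \<in> A \<Longrightarrow> F x a \<in> carrier_mat (d (t a)) (d (s a))"
    and regF: "\<And>a. a \<in> A \<Longrightarrow> regular_mat_at 0 (\<lambda>x. F x a)"
    and h: "\<And>i. i < n \<Longrightarrow> h i \<in> carrier_mat (d i) (d i)" "\<And>i. i < n \<Longrightarrow> h' i \<in> carrier_mat (d i) (d i)"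
      "\<And>i. i < n \<Longrightarrow> h' i * h i = 1\<^sub>m (d i)" "\<And>i. i < n \<Longrightarrow> h i * h' i = 1\<^sub>m (d i)"
    and hf: "\<And>a. a \<in> A \<Longrightarrow> h (t a) * f a = F 0 a * h (s a)"
    and iso: "\<forall>\<^sub>F x in cofinite. \<exists>\<phi> \<phi>'. (\<forall>i<n. \<phi> i \<in> carrier_mat (d i) (d i) \<and> \<phi>' i \<in> carrier_mat (d i) (d i) \<and>
        \<phi>' i * \<phi> i = 1\<^sub>m (d i)) \<and> (\<forall>a\<in>A. \<phi> (t a) * F x a = f a * \<phi> (s a))"
  obtains H where "\<And>i. i < n \<Longrightarrow> regular_mat_at 0 (\<lambda>x. H x i)" "\<And>x i. H x i \<in> carrier_mat (d i) (d i)"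
    "\<And>i. i < n \<Longrightarrow> H 0 i = h i" "\<forall>\<^sub>F x in cofinite. \<forall>a\<in>A. H x (t a) * f a = F x a * H x (s a)"
proof -
  define I where "I = (SIGMA i:{..<n}. {..<d i} \<times> {..<d i})"
  define J where "J = (SIGMA a:A. {..<d (t a)} \<times> {..<d (s a)})"
  have finI: "finite I" and finJ: "finite J" using finA by (auto simp: I_def J_def)
  obtain eI where eI: "bij_betw eI {..<card I} I" using ex_bij_betw_nat_finite[OF finI] by (auto simp: atLeast0LessThan)
  obtain eJ where eJ: "bij_betw eJ {..<card J} J" using ex_bij_betw_nat_finite[OF finJ] by (auto simp: atLeast0LessThan)
  define nI nJ where "nI = card I" and "nJ = card J"
  note eI = eI[folded nI_def] and eJ = eJ[folded nJ_def]
  have eJ_mem: "eJ w \<in> J" if "w < nJ" for w using eJ that by (auto simp: bij_betw_def)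
  define Top where "Top x y = (\<lambda>(a, r, c). (end_mats d y (t a) * f a - F x a * end_mats d y (s a)) $$ (r, c))" for x y
  have Top: "Top x y (a, r, c) = (\<Sum>l<d (t a). y (t a, r, l) * f a $$ (l, c)) - (\<Sum>l<d (s a). F x a $$ (r, l) * y (s a, l, c))"
    if "(a, r, c) \<in> J" for x y a r c
  proof -
    have a: "a \<in> A" "r < d (t a)" "c < d (s a)" using that by (auto simp: J_def)
    show ?thesis using a carrier_matD[OF f[OF a(1)]] carrier_matD[OF F[OF a(1), of x]]
      by (simp add: Top_def index_mult_sum end_mats_def del: index_mult_mat(1))
  qed
  have linTop: "linfun I (\<lambda>y. Top x y w)" if "w \<in> J" for x w
  proof -
    obtain a r c where w: "w = (a, r, c)" by (metis prod.exhaust)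
    have "a \<in> A" "r < d (t a)" "c < d (s a)" using that w by (auto simp: J_def)
    thus ?thesis unfolding w using that[unfolded w] st
      by (simp only: Top) (intro linfun_diff linfun_sum linfun_multc linfun_cmult linfun_coord finI; auto simp: I_def)
  qed
  define T where "T x = opmat nJ eJ nI eI (Top x)" for x
  have Tc: "T x \<in> carrier_mat nJ nI" for x unfolding T_def opmat_def by simp
  have regT: "regular_mat_at 0 T"
  proof (rule regular_mat_atI[OF Tc])
    fix w v assume wv: "w < nJ" "v < nI"
    obtain a r c where arc: "eJ w = (a, r, c)" by (metis prod.exhaust)
    have J: "(a, r, c) \<in> J" using eJ_mem[OF wv(1)] arc by simp
    hence a: "a \<in> A" "r < d (t a)" "c < d (s a)" by (auto simp: J_def)
    have "T x $$ (w, v) = Top x (\<lambda>u. if u = eI v then 1 else 0) (a, r, c)" for x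
      using wv arc by (simp add: T_def opmat_def)
    thus "regular_at 0 (\<lambda>x. T x $$ (w, v))"
      unfolding Top[OF J]
      by (simp only:) (intro regular_at_diff regular_at_sum regular_at_mult regular_at_const
          regular_mat_atD(2)[OF regF[OF a(1)] F[OF a(1)]]; use a in auto)
  qed
  have rk: "\<forall>\<^sub>F x in cofinite. mrank (T x) \<le> mrank (T 0)"
    using iso
  proof eventually_elim
    case (elim x)
    then obtain \<phi> \<phi>' where \<phi>: "\<And>i. i < n \<Longrightarrow> \<phi> i \<in> carrier_mat (d i) (d i)" "\<And>i. i < n \<Longrightarrow> \<phi>' i \<in> carrier_mat (d i) (d i)"
      "\<And>i. i < n \<Longrightarrow> \<phi>' i * \<phi> i = 1\<^sub>m (d i)" "\<And>a. a \<in> A \<Longrightarrow> \<phi> (t a) * F x a = f a * \<phi> (s a)" by blast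
    define \<theta> where "\<theta> i = h i * \<phi> i" for i
    define \<theta>' where "\<theta>' i = \<phi>' i * h' i" for i
    define Pop where "Pop z = (\<lambda>(a, r, c). \<Sum>l<d (t a). \<theta>' (t a) $$ (r, l) * z (a, l, c))" for z :: "'a \<times> nat \<times> nat \<Rightarrow> 'k"
    define Qop where "Qop y = (\<lambda>(i, r, c). (\<theta> i * end_mats d y i) $$ (r, c))" for y
    have Qm: "end_mats d (Qop y) i = \<theta> i * end_mats d y i" if "i < n" for y i
      using h(1)[OF that] \<phi>(1)[OF that] by (intro eq_matI) (auto simp: end_mats_def Qop_def \<theta>_def)
    have eq: "Top x y w = Pop (Top 0 (Qop y)) w" if "w \<in> J" for y w
    proof -
      obtain a r c where w: "w = (a, r, c)" by (metis prod.exhaust)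
      have a: "a \<in> A" "r < d (t a)" "c < d (s a)" using that w by (auto simp: J_def)
      note hs = carrier_matD[OF h(1)[OF st(1)[OF a(1)]]] carrier_matD[OF h(1)[OF st(2)[OF a(1)]]]
        carrier_matD[OF h(2)[OF st(1)[OF a(1)]]] carrier_matD[OF h(2)[OF st(2)[OF a(1)]]]
        carrier_matD[OF \<phi>(1)[OF st(1)[OF a(1)]]] carrier_matD[OF \<phi>(1)[OF st(2)[OF a(1)]]]
        carrier_matD[OF \<phi>(2)[OF st(1)[OF a(1)]]] carrier_matD[OF \<phi>(2)[OF st(2)[OF a(1)]]]
        carrier_matD[OF f[OF a(1)]] carrier_matD[OF F[OF a(1), of x]] carrier_matD[OF F[OF a(1), of 0]]
      have \<theta>\<theta>: "\<theta>' (t a) * \<theta> (t a) = 1\<^sub>m (d (t a))"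
      proof -
        have "\<theta>' (t a) * \<theta> (t a) = \<phi>' (t a) * ((h' (t a) * h (t a)) * \<phi> (t a))"
          using hs by (simp add: \<theta>_def \<theta>'_def mat_assoc)
        thus ?thesis using h(3)[OF st(2)[OF a(1)]] \<phi>(3)[OF st(2)[OF a(1)]] hs by simp
      qed
      have \<theta>F: "F 0 a * \<theta> (s a) = \<theta> (t a) * F x a"
      proof -
        have "F 0 a * \<theta> (s a) = (F 0 a * h (s a)) * \<phi> (s a)" using hs by (simp add: \<theta>_def mat_assoc)
        also have "\<dots> = h (t a) * (f a * \<phi> (s a))" unfolding hf[OF a(1), symmetric] using hs by (simp add: mat_assoc)
        also have "\<dots> = \<theta> (t a) * F x a" unfolding \<phi>(4)[OF a(1), symmetric] using hs by (simp add: \<theta>_def mat_assoc)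
        finally show ?thesis .
      qed
      have d\<theta>: "dim_row (\<theta> (s a)) = d (s a)" "dim_col (\<theta> (s a)) = d (s a)" "dim_row (\<theta> (t a)) = d (t a)"
        "dim_col (\<theta> (t a)) = d (t a)" "dim_row (\<theta>' (t a)) = d (t a)" "dim_col (\<theta>' (t a)) = d (t a)"
        using hs by (simp_all add: \<theta>_def \<theta>'_def)
      let ?M = "end_mats d (Qop y) (t a) * f a - F 0 a * end_mats d (Qop y) (s a)"
      have M: "?M = \<theta> (t a) * end_mats d y (t a) * f a - F 0 a * (\<theta> (s a) * end_mats d y (s a))"
        using Qm st a by simp
      have "\<theta>' (t a) * ?M = (\<theta>' (t a) * \<theta> (t a)) * (end_mats d y (t a) * f a)
          - \<theta>' (t a) * ((F 0 a * \<theta> (s a)) * end_mats d y (s a))"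
        unfolding M using hs d\<theta> by (simp add: mat_ring)
      also have "\<dots> = end_mats d y (t a) * f a - (\<theta>' (t a) * \<theta> (t a)) * (F x a * end_mats d y (s a))"
        unfolding \<theta>F \<theta>\<theta>[symmetric] unfolding \<theta>\<theta> using hs d\<theta> \<theta>\<theta> mat_cancel[OF \<theta>\<theta>] by (simp add: mat_assoc)
      finally have fin: "\<theta>' (t a) * ?M = end_mats d y (t a) * f a - F x a * end_mats d y (s a)"
        unfolding \<theta>\<theta> using hs by simp
      have "Pop (Top 0 (Qop y)) w = (\<Sum>l<d (t a). \<theta>' (t a) $$ (r, l) * ?M $$ (l, c))"
        by (simp add: Pop_def Top_def w)
      also have "\<dots> = (\<theta>' (t a) * ?M) $$ (r, c)"
        using a d\<theta> hs by (subst index_mult_sum) auto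
      finally show ?thesis unfolding fin by (simp add: Top_def w)
    qed
    have linPop: "linfun J (\<lambda>z. Pop z w)" if "w \<in> J" for w
    proof -
      obtain a r c where w: "w = (a, r, c)" by (metis prod.exhaust)
      have a: "a \<in> A" "r < d (t a)" "c < d (s a)" using that w by (auto simp: J_def)
      have "linfun J (\<lambda>z. \<Sum>l<d (t a). \<theta>' (t a) $$ (r, l) * z (a, l, c))"
        by (intro linfun_sum linfun_cmult linfun_coord finJ) (use a in \<open>auto simp: J_def\<close>)
      thus ?thesis by (simp add: Pop_def w)
    qed
    have "T x = opmat nJ eJ nI eI (\<lambda>y. Pop (Top 0 (Qop y)))"
      unfolding T_def using eq[OF eJ_mem] by (intro eq_matI) (auto simp: opmat_def)
    also have "\<dots> = opmat nJ eJ nJ eJ Pop * opmat nJ eJ nI eI (\<lambda>y. Top 0 (Qop y))"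
      by (rule opmat_comp[where F = Pop and F' = "\<lambda>y. Top 0 (Qop y)", OF eJ linPop[OF eJ_mem]])
    also have "opmat nJ eJ nI eI (\<lambda>y. Top 0 (Qop y)) = T 0 * opmat nI eI nI eI Qop"
      unfolding T_def by (rule opmat_comp[where F = "Top 0" and F' = Qop, OF eI linTop[OF eJ_mem]])
    finally have "T x = opmat nJ eJ nJ eJ Pop * T 0 * opmat nI eI nI eI Qop"
      using carrier_matD[OF Tc[of 0]] by (simp add: mat_assoc)
    thus "mrank (T x) \<le> mrank (T 0)" using carrier_matD[OF Tc[of 0]] by (simp add: mrank_mult_le)
  qed
  define hc where "hc = (\<lambda>(i, r, c). h i $$ (r, c))"
  have hm: "end_mats d hc i = h i" if "i < n" for i
    using h(1)[OF that] by (intro eq_matI) (auto simp: end_mats_def hc_def)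
  have "Top 0 hc w = 0" if "w \<in> J" for w
  proof -
    obtain a r c where w: "w = (a, r, c)" by (metis prod.exhaust)
    have a: "a \<in> A" "r < d (t a)" "c < d (s a)" using that w by (auto simp: J_def)
    have "end_mats d hc (t a) * f a - F 0 a * end_mats d hc (s a) = 0\<^sub>m (d (t a)) (d (s a))"
      using hm st a hf[OF a(1)] F[OF a(1), of 0] h(1) by simp
    thus ?thesis using a by (simp add: Top_def w)
  qed
  hence "Top 0 hc (eJ w) = 0" if "w < nJ" for w using eJ_mem[OF that] by blast
  hence T0: "T 0 * cvec nI eI hc = 0\<^sub>m nJ 1" unfolding T_def
    by (subst opmat_cvec[where F = "Top 0", OF eI linTop[OF eJ_mem]]) (auto simp: cvec_def intro!: eq_matI)
  have cv: "cvec nI eI hc \<in> carrier_mat nI 1" by (simp add: cvec_def)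
  obtain v where v: "regular_mat_at 0 v" "\<And>x. v x \<in> carrier_mat nI 1" "v 0 = cvec nI eI hc"
    "\<forall>\<^sub>F x in cofinite. T x * v x = 0\<^sub>m nJ 1"
    using kernel_path[OF regT Tc cv T0 rk] by blast
  define pos where "pos = the_inv_into {..<nI} eI"
  have inj: "inj_on eI {..<nI}" using eI by (simp add: bij_betw_def)
  have pos1: "pos (eI l) = l" if "l < nI" for l unfolding pos_def using the_inv_into_f_f[OF inj] that by simp
  have pos2: "pos u < nI" "eI (pos u) = u" if "u \<in> I" for u
  proof -
    show "eI (pos u) = u" unfolding pos_def using f_the_inv_into_f_bij_betw[OF eI] that by blast
    show "pos u < nI" unfolding pos_def using bij_betwE[OF bij_betw_the_inv_into[OF eI]] that by auto
  qed
  define y where "y x u = v x $$ (pos u, 0)" for x u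
  have yv: "cvec nI eI (y x) = v x" for x
    using carrier_matD[OF v(2)[of x]] by (intro eq_matI) (auto simp: cvec_def y_def pos1)
  define H where "H x i = end_mats d (y x) i" for x i
  show ?thesis
  proof (rule that[of H])
    show "H x i \<in> carrier_mat (d i) (d i)" for x i by (simp add: H_def)
    show "regular_mat_at 0 (\<lambda>x. H x i)" if i: "i < n" for i
    proof (rule regular_mat_atI[of _ "d i" "d i"])
      show "H x i \<in> carrier_mat (d i) (d i)" for x by (simp add: H_def)
      fix r c assume rc: "r < d i" "c < d i"
      hence "(i, r, c) \<in> I" using i by (auto simp: I_def)
      hence "regular_at 0 (\<lambda>x. v x $$ (pos (i, r, c), 0))"
        using regular_mat_atD(2)[OF v(1,2)] pos2(1) by simp
      thus "regular_at 0 (\<lambda>x. H x i $$ (r, c))" using rc by (simp add: H_def end_mats_def y_def)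
    qed
    show "H 0 i = h i" if i: "i < n" for i
    proof -
      have "y 0 (i, r, c) = hc (i, r, c)" if "r < d i" "c < d i" for r c
      proof -
        have "(i, r, c) \<in> I" using that i by (auto simp: I_def)
        thus ?thesis using pos2 by (simp add: y_def v(3) cvec_def)
      qed
      hence "H 0 i = end_mats d hc i" by (intro eq_matI) (auto simp: H_def end_mats_def)
      thus ?thesis using hm[OF i] by simp
    qed
    show "\<forall>\<^sub>F x in cofinite. \<forall>a\<in>A. H x (t a) * f a = F x a * H x (s a)"
      using v(4)
    proof eventually_elim
      case (elim x)
      have "cvec nJ eJ (Top x (y x)) = T x * v x"
        unfolding T_def yv[symmetric] by (rule opmat_cvec[where F = "Top x", OF eI linTop[OF eJ_mem], symmetric])
      hence zero: "cvec nJ eJ (Top x (y x)) = 0\<^sub>m nJ 1" using elim by simp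
      have Tz: "Top x (y x) u = 0" if u: "u \<in> J" for u
      proof -
        obtain l where l: "l < nJ" "eJ l = u"
          using eJ u unfolding bij_betw_def by (metis imageE lessThan_iff)
        show ?thesis using arg_cong[OF zero, of "\<lambda>M. M $$ (l, 0)"] l by (simp add: cvec_def)
      qed
      show ?case
      proof
        fix a assume a: "a \<in> A"
        note fF = carrier_matD[OF f[OF a]] carrier_matD[OF F[OF a, of x]]
        show "H x (t a) * f a = F x a * H x (s a)"
        proof (rule eq_matI)
          fix r c assume "r < dim_row (F x a * H x (s a))" "c < dim_col (F x a * H x (s a))"
          hence rc: "r < d (t a)" "c < d (s a)" using fF by (auto simp: H_def)
          hence "Top x (y x) (a, r, c) = 0" using a by (intro Tz) (auto simp: J_def)
          moreover have "Top x (y x) (a, r, c) = (H x (t a) * f a) $$ (r, c) - (F x a * H x (s a)) $$ (r, c)"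
            unfolding Top_def H_def prod.case using rc fF by (subst index_minus_mat) auto
          ultimately show "(H x (t a) * f a) $$ (r, c) = (F x a * H x (s a)) $$ (r, c)"
            by simp
        qed (use fF in \<open>auto simp: H_def\<close>)
      qed
    qed
  qed
qed

section \<open>Generic endomorphisms with ample cokernel\<close>

lemma invertible_mat_inverse:
  assumes "invertible_mat M" "M \<in> carrier_mat n n"
  obtains M' where "M' \<in> carrier_mat n n" "M' * M = 1\<^sub>m n" "M * M' = 1\<^sub>m n"
proof -
  obtain B where B: "M * B = 1\<^sub>m (dim_row M)" "B * M = 1\<^sub>m (dim_row B)"
    using assms(1) unfolding invertible_mat_def inverts_mat_def by blast
  have "dim_col B = n" using arg_cong[OF B(1), of dim_col] assms(2) by simp
  moreover have "dim_row B = n" using arg_cong[OF B(2), of dim_col] assms(2) by simp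
  ultimately show ?thesis using that[of B] B assms(2) by auto
qed

lemma end_coords_poly_fun:
  assumes "\<And>i. i < n \<Longrightarrow> poly_mat (\<lambda>y. N y i)" "\<And>y i. i < n \<Longrightarrow> N y i \<in> carrier_mat (d i) (d i)"
  shows "(\<lambda>y. end_coords n d (N y) v) \<in> poly_fun"
proof -
  obtain i r c where v: "v = (i, r, c)" by (metis prod.exhaust)
  show ?thesis
  proof (cases "i < n \<and> r < d i \<and> c < d i")
    case True
    hence "(\<lambda>y. N y i $$ (r, c)) \<in> poly_fun" using poly_matD(2)[OF assms(1,2)] by blast
    thus ?thesis using True by (simp add: end_coords_def v)
  next
    case False
    hence "(\<lambda>y. end_coords n d (N y) v) = (\<lambda>y. 0)" by (auto simp: end_coords_def v)
    thus ?thesis by (simp add: pf_const)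
  qed
qed

lemma end_coords_regular:
  assumes "\<And>i. i < n \<Longrightarrow> regular_mat_at e (\<lambda>x. N x i)" "\<And>i. i < n \<Longrightarrow> N e i \<in> carrier_mat (d i) (d i)"
  shows "regular_at e (\<lambda>x. end_coords n d (N x) v)"
proof -
  obtain i r c where v: "v = (i, r, c)" by (metis prod.exhaust)
  show ?thesis
  proof (cases "i < n \<and> r < d i \<and> c < d i")
    case True
    hence "regular_at e (\<lambda>x. N x i $$ (r, c))" using regular_mat_atD(2)[OF assms(1,2)] by blast
    thus ?thesis using True by (simp add: end_coords_def v)
  next
    case False
    hence "(\<lambda>x. end_coords n d (N x) v) = (\<lambda>x. 0)" by (auto simp: end_coords_def v)
    thus ?thesis by simp
  qed
qed

lemma end_mats_poly_mat: "poly_mat (\<lambda>y. end_mats d y i)"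
  by (rule poly_matI[of _ "d i" "d i"]) (auto simp: end_mats_def intro: pf_var)

lemma end_coords_cong: "(\<And>i. i < n \<Longrightarrow> N i = N' i) \<Longrightarrow> end_coords n d N = end_coords n d N'"
  by (auto simp: end_coords_def fun_eq_iff)

lemma compat_reps_lincomb:
  assumes "f \<in> compat_reps A s t d N" "g \<in> compat_reps A s t d N"
    "\<And>a. a \<in> A \<Longrightarrow> N (t a) \<in> carrier_mat (d (t a)) (d (t a))" "\<And>a. a \<in> A \<Longrightarrow> N (s a) \<in> carrier_mat (d (s a)) (d (s a))"
  shows "(\<lambda>a. x \<cdot>\<^sub>m f a + y \<cdot>\<^sub>m g a) \<in> compat_reps A s t d N"
  unfolding compat_reps_def rep_def
proof (intro CollectI conjI ballI)
  fix a assume a: "a \<in> A"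
  have f: "f a \<in> carrier_mat (d (t a)) (d (s a))" "N (t a) * f a = f a * N (s a)"
    and g: "g a \<in> carrier_mat (d (t a)) (d (s a))" "N (t a) * g a = g a * N (s a)"
    using assms(1,2) a unfolding compat_reps_def rep_def by auto
  show "x \<cdot>\<^sub>m f a + y \<cdot>\<^sub>m g a \<in> carrier_mat (d (t a)) (d (s a))" using f g by simp
  note dims = carrier_matD[OF f(1)] carrier_matD[OF g(1)] carrier_matD[OF assms(3)[OF a]] carrier_matD[OF assms(4)[OF a]]
  have "N (t a) * (x \<cdot>\<^sub>m f a + y \<cdot>\<^sub>m g a) = x \<cdot>\<^sub>m (N (t a) * f a) + y \<cdot>\<^sub>m (N (t a) * g a)"
    using dims by (simp add: mat_distrib_left mult_smult_distrib[OF assms(3)[OF a] f(1)] mult_smult_distrib[OF assms(3)[OF a] g(1)])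
  also have "\<dots> = (x \<cdot>\<^sub>m f a + y \<cdot>\<^sub>m g a) * N (s a)" unfolding f(2) g(2)
    using dims by (simp add: mat_distrib_right mult_smult_assoc_mat[OF f(1) assms(4)[OF a]] mult_smult_assoc_mat[OF g(1) assms(4)[OF a]])
  finally show "N (t a) * (x \<cdot>\<^sub>m f a + y \<cdot>\<^sub>m g a) = (x \<cdot>\<^sub>m f a + y \<cdot>\<^sub>m g a) * N (s a)" .
qed

lemma rep_coords_lincomb:
  assumes "rep A s t d f" "rep A s t d g"
  shows "rep_coords A s t d (\<lambda>a. x \<cdot>\<^sub>m f a + y \<cdot>\<^sub>m g a) v = x * rep_coords A s t d f v + y * rep_coords A s t d g v"
proof -
  obtain a r c where v: "v = (a, r, c)" by (metis prod.exhaust)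
  show ?thesis
  proof (cases "a \<in> A")
    case True
    hence "f a \<in> carrier_mat (d (t a)) (d (s a))" "g a \<in> carrier_mat (d (t a)) (d (s a))"
      using assms unfolding rep_def by auto
    thus ?thesis by (auto simp: rep_coords_def v)
  qed (auto simp: rep_coords_def v)
qed

lemma ample_at_nilpotent:
  assumes "ample_at X \<Phi> J D" "X \<in> carrier_mat m m" "X ^\<^sub>m J = 0\<^sub>m m m" "J \<le> j"
  shows "ample_at X \<Phi> j D"
  using assms(1) pow_mat_zero_mono[OF assms(2-4)] assms(3) unfolding ample_at_def by simp

context source_vertex
begin

lemma bdiag_nilpotent:
  assumes "\<And>a. a \<in> Out \<Longrightarrow> nilpotent_mat (d (t a)) (N (t a))"
  shows "\<exists>e. bdiag N ^\<^sub>m e = 0\<^sub>m m m"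
proof -
  have Nc: "N (t a) \<in> carrier_mat (d (t a)) (d (t a))" if "a \<in> Out" for a
    using assms[OF that] unfolding nilpotent_mat_def by blast
  have "\<forall>a\<in>Out. \<exists>e. N (t a) ^\<^sub>m e = 0\<^sub>m (d (t a)) (d (t a))"
    using assms unfolding nilpotent_mat_def by blast
  then obtain e where e: "\<forall>a\<in>Out. N (t a) ^\<^sub>m e a = 0\<^sub>m (d (t a)) (d (t a))" by (rule bchoice[THEN exE])
  define E where "E = (\<Sum>a\<in>Out. e a)"
  have "N (t a) ^\<^sub>m E = 0\<^sub>m (d (t a)) (d (t a))" if "a \<in> Out" for a
  proof (rule pow_mat_zero_mono[OF Nc[OF that], of "e a"])
    show "e a \<le> E" unfolding E_def by (rule member_le_sum[OF that]) auto
  qed (use e that in blast)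
  hence "N (t (fst (\<kappa> p))) ^\<^sub>m E = 0\<^sub>m (d (t (fst (\<kappa> p)))) (d (t (fst (\<kappa> p))))" if "p < m" for p
    using \<kappa>_mem[OF that] by simp
  hence "bdiag (\<lambda>i. N i ^\<^sub>m E) = 0\<^sub>m m m"
    using \<kappa>_mem(3) by (intro eq_matI) (simp_all add: bdiag_def, metis index_zero_mat(1))
  thus ?thesis using bdiag_pow[of N E] Nc by metis
qed

lemma excess_eventually_zero: "partition p \<Longrightarrow> p 0 \<le> j \<Longrightarrow> excess p j = 0"
  unfolding excess_def by (rule sum.neutral) (use partition_antimono[of p 0] le_trans in fastforce)

lemma ample_poly:
  fixes X :: "'k::field mat"
  assumes "ample_cokernel X (stack f1 (d k)) r" "X \<in> carrier_mat m m" "X ^\<^sub>m J = 0\<^sub>m m m"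
    and r: "\<And>j. J \<le> j \<Longrightarrow> r j = 0"
  obtains p where "p \<in> poly_fun" "p (rep_coords A s t d f1) \<noteq> 0"
    "\<And>g. p (rep_coords A s t d g) \<noteq> 0 \<Longrightarrow> ample_cokernel X (stack g (d k)) r"
proof -
  define \<Phi> where "\<Phi> y = mat m (d k) (\<lambda>(p, c). y (fst (\<kappa> p), snd (\<kappa> p), c))" for y :: "'a \<times> nat \<times> nat \<Rightarrow> 'k"
  have \<Phi>: "\<Phi> (rep_coords A s t d g) = stack g (d k)" for g :: "'a \<Rightarrow> 'k mat"
    using \<kappa>_mem by (intro eq_matI) (auto simp: \<Phi>_def stack_def rep_coords_def)
  have \<Phi>c [simp]: "\<Phi> y \<in> carrier_mat m (d k)" "dim_row (\<Phi> y) = m" "dim_col (\<Phi> y) = d k" for y by (auto simp: \<Phi>_def)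
  have poly\<Phi>: "poly_mat \<Phi>" by (rule poly_matI[OF \<Phi>c(1)]) (auto simp: \<Phi>_def intro: pf_var)
  have dX: "dim_row (X ^\<^sub>m j) = m" "dim_col (X ^\<^sub>m j) = m" for j using assms(2) by auto
  have "\<forall>j. \<exists>L R S. L \<in> carrier_mat (d k + r j) m \<and> R \<in> carrier_mat m (d k + r j) \<and> S \<in> carrier_mat (d k) (d k + r j) \<and>
      det (L * (X ^\<^sub>m j * R + stack f1 (d k) * S)) \<noteq> 0"
    using assms(1) unfolding ample_cokernel_def ample_at_def by simp
  then obtain L R S where LRS: "\<And>j. L j \<in> carrier_mat (d k + r j) m" "\<And>j. R j \<in> carrier_mat m (d k + r j)"
    "\<And>j. S j \<in> carrier_mat (d k) (d k + r j)" "\<And>j. det (L j * (X ^\<^sub>m j * R j + stack f1 (d k) * S j)) \<noteq> 0"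
    by metis
  define p where "p y = (\<Prod>j\<le>J. det (L j * (X ^\<^sub>m j * R j + \<Phi> y * S j)))" for y
  show ?thesis
  proof (rule that[of p])
    show "p \<in> poly_fun" unfolding p_def
    proof (rule poly_fun_prod)
      fix j
      note c = carrier_matD[OF LRS(1)[of j]] carrier_matD[OF LRS(2)[of j]] carrier_matD[OF LRS(3)[of j]] dX[of j]
      have "poly_mat (\<lambda>y. L j * (X ^\<^sub>m j * R j + \<Phi> y * S j))"
        by (rule poly_mat_mult[where ?x0.0 = "\<lambda>_. 0"], rule poly_mat_const,
            rule poly_mat_add[where ?x0.0 = "\<lambda>_. 0"], rule poly_mat_const,
            rule poly_mat_mult[where ?x0.0 = "\<lambda>_. 0"], rule poly\<Phi>, rule poly_mat_const) (use c in auto)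
      thus "(\<lambda>y. det (L j * (X ^\<^sub>m j * R j + \<Phi> y * S j))) \<in> poly_fun"
        by (rule poly_fun_det[where ?x0.0 = "\<lambda>_. 0"]) (use c in \<open>auto intro!: carrier_matI\<close>)
    qed
    show "p (rep_coords A s t d f1) \<noteq> 0" using LRS(4) by (simp add: p_def \<Phi>)
    fix g assume "p (rep_coords A s t d g) \<noteq> 0"
    hence "det (L j * (X ^\<^sub>m j * R j + stack g (d k) * S j)) \<noteq> 0" if "j \<le> J" for j
      using that by (simp add: p_def \<Phi>)
    hence "ample_at X (stack g (d k)) j (d k + r j)" if "j \<le> J" for j
      using that LRS(1-3) unfolding ample_at_def by simp blast
    moreover have "ample_at X (stack g (d k)) j (d k + r j)" if "J \<le> j" for j
      using ample_at_nilpotent[OF calculation[of J] assms(2,3) that] r[of j] r[of J] that by simp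
    ultimately show "ample_cokernel X (stack g (d k)) r"
      unfolding ample_cokernel_def using nat_le_linear by simp blast
  qed
qed

abbreviation "refl_excess \<nu> tt \<equiv> excess (pdiff tt (adj_partition A s t \<nu> k) (\<nu> k))"

lemma exists_ample_rep:
  fixes N :: "nat \<Rightarrow> 'k::field mat"
  assumes N: "\<And>i. i < n \<Longrightarrow> N i \<in> carrier_mat (d i) (d i)" "\<And>i. i < n \<Longrightarrow> jordan_type (N i) (\<nu> i)"
    and inter: "interlaced tt (adj_partition A s t \<nu> k) (\<nu> k)"
  obtains f where "f \<in> compat_reps A s t d N" "ample_cokernel (bdiag N) (stack f (d k)) (refl_excess \<nu> tt)"
proof -
  have "jordan_type (bdiag N) (adj_partition A s t \<nu> k)" by (rule bdiag_jordan_type) (use N t_less in auto)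
  moreover have "jordan_type (N k) (\<nu> k)" "N k \<in> carrier_mat (d k) (d k)" using N k_less by auto
  ultimately obtain \<Psi> where \<Psi>: "\<Psi> \<in> carrier_mat m (d k)" "bdiag N * \<Psi> = \<Psi> * N k"
    "ample_cokernel (bdiag N) \<Psi> (refl_excess \<nu> tt)"
    using exists_ample[OF inter, of "bdiag N" m "N k" "d k"] unfolding jordan_type_iff by auto
  obtain f0 where f0: "\<And>a. f0 a \<in> carrier_mat (d (t a)) (d k)" "stack f0 (d k) = \<Psi>" using stack_surj[OF \<Psi>(1)] by blast
  define f where "f a = (if a \<in> Out then f0 a else 0\<^sub>m (d (t a)) (d (s a)))" for a
  have fc: "f a \<in> carrier_mat (d (t a)) (d (s a))" for a using f0(1)[of a] by (auto simp: f_def)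
  have f\<Psi>: "stack f (d k) = \<Psi>" unfolding f0(2)[symmetric]
    by (subst stack_eq_iff) (use f0(1) in \<open>auto simp: f_def\<close>)
  have "stack (\<lambda>a. N (t a) * f0 a) (d k) = stack (\<lambda>a. f0 a * N k) (d k)"
    using \<Psi>(2) f0 N t_less k_less bdiag_stack[of N f0 "d k"] stack_mult[of f0 "d k" "N k" "d k"] by simp
  hence eq: "N (t a) * f0 a = f0 a * N k" if "a \<in> Out" for a
    by (subst (asm) stack_eq_iff) (use that f0(1) N t_less k_less in \<open>auto intro!: mult_carrier_mat\<close>)
  have "N (t a) * f a = f a * N (s a)" if "a \<in> A" for a
  proof (cases "s a = k")
    case True
    thus ?thesis using eq[of a] that by (simp add: f_def)
  next
    case False
    have "N (t a) \<in> carrier_mat (d (t a)) (d (t a))" "N (s a) \<in> carrier_mat (d (s a)) (d (s a))"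
      using N s_less t_less that by auto
    thus ?thesis using False by (simp add: f_def)
  qed
  hence "f \<in> compat_reps A s t d N" using fc unfolding compat_reps_def rep_def by blast
  thus ?thesis using that f\<Psi> \<Psi>(3) by simp
qed

lemma ample_conj:
  fixes f g :: "'a \<Rightarrow> 'k::field mat"
  assumes "ample_cokernel (bdiag N) (stack g (d k)) r"
    and g: "\<And>a. a \<in> A \<Longrightarrow> g a \<in> carrier_mat (d (t a)) (d (s a))"
    and f: "\<And>a. a \<in> A \<Longrightarrow> f a \<in> carrier_mat (d (t a)) (d (s a))"
    and c: "\<And>i. i < n \<Longrightarrow> N i \<in> carrier_mat (d i) (d i)" "\<And>i. i < n \<Longrightarrow> N' i \<in> carrier_mat (d i) (d i)"
      "\<And>i. i < n \<Longrightarrow> P i \<in> carrier_mat (d i) (d i)" "\<And>i. i < n \<Longrightarrow> Q i \<in> carrier_mat (d i) (d i)"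
    and PQ: "\<And>i. i < n \<Longrightarrow> Q i * P i = 1\<^sub>m (d i)"
    and NP: "\<And>i. i < n \<Longrightarrow> N' i * P i = P i * N i"
    and fP: "\<And>a. a \<in> A \<Longrightarrow> P (t a) * g a = f a * P (s a)"
  shows "ample_cokernel (bdiag N') (stack f (d k)) r"
proof -
  have PQ': "P i * Q i = 1\<^sub>m (d i)" if "i < n" for i
    using mat_mult_left_right_inverse[OF c(4)[OF that] c(3)[OF that] PQ[OF that]] .
  have B: "bdiag Q * bdiag P = 1\<^sub>m m" by (subst bdiag_mult) (use c t_less PQ in \<open>auto intro: bdiag_one\<close>)
  have NB: "bdiag N' * bdiag P = bdiag P * bdiag N"
    by (subst (1 2) bdiag_mult) (use c t_less NP in \<open>auto intro: bdiag_cong\<close>)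
  have st: "a \<in> A" "s a < n" "t a < n" "s a = k" if "a \<in> Out" for a using that s_less t_less by auto
  have gc: "g a \<in> carrier_mat (d (t a)) (d k)" if "a \<in> Out" for a using g[OF st(1)[OF that]] st(4)[OF that] by simp
  have fc: "f a \<in> carrier_mat (d (t a)) (d k)" if "a \<in> Out" for a using f[OF st(1)[OF that]] st(4)[OF that] by simp
  have Pc: "P (t a) \<in> carrier_mat (d (t a)) (d (t a))" if "a \<in> Out" for a using c(3)[OF st(3)[OF that]] .
  have "bdiag P * stack g (d k) = stack (\<lambda>a. P (t a) * g a) (d k)"
    by (rule bdiag_stack[OF Pc gc])
  moreover have "stack (\<lambda>a. P (t a) * g a) (d k) * Q k = stack (\<lambda>a. P (t a) * g a * Q k) (d k)"
    by (rule stack_mult[OF mult_carrier_mat[OF Pc gc] c(4)[OF k_less]])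
  moreover have "stack (\<lambda>a. P (t a) * g a * Q k) (d k) = stack f (d k)"
  proof (subst stack_eq_iff)
    show "P (t a) * g a * Q k \<in> carrier_mat (d (t a)) (d k)" if "a \<in> Out" for a
      by (rule mult_carrier_mat[OF mult_carrier_mat[OF Pc[OF that] gc[OF that]] c(4)[OF k_less]])
    show "\<forall>a\<in>Out. P (t a) * g a * Q k = f a"
    proof
      fix a assume a: "a \<in> Out"
      note q = st[OF a]
      have "P (t a) * g a * Q k = f a * P k * Q k" using fP[OF q(1)] q(4) by simp
      also have "\<dots> = f a * (P k * Q k)"
        by (rule assoc_mult_mat[OF fc[OF a] c(3)[OF k_less] c(4)[OF k_less]])
      finally show "P (t a) * g a * Q k = f a" unfolding PQ'[OF k_less] using fc[OF a] by simp
    qed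
  qed (use fc in auto)
  ultimately have eq: "bdiag P * stack g (d k) * Q k = stack f (d k)" by simp
  show ?thesis unfolding eq[symmetric]
    by (rule ample_cokernel_conj[OF assms(1) _ _ _ _ B _ _ PQ[OF k_less] _ NB]) (use c k_less in auto)
qed

lemma generic_ample_endomorphism:
  fixes f :: "'a \<Rightarrow> 'k::alg_closed_field mat"
  assumes rep: "rep A s t d f"
    and N: "N \<in> nil_ends n A s t d f" "\<And>i. i < n \<Longrightarrow> jordan_type (N i) (\<nu> i)"
    and gen: "is_GenRep n A s t d f \<nu>"
    and inter: "interlaced tt (adj_partition A s t \<nu> k) (\<nu> k)"
    and p: "p \<in> poly_fun" "p (end_coords n d N) \<noteq> 0"
  obtains N1 where "N1 \<in> nil_ends n A s t d f" "p (end_coords n d N1) \<noteq> 0"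
    "ample_cokernel (bdiag N1) (stack f (d k)) (refl_excess \<nu> tt)"
proof -
  let ?r = "refl_excess \<nu> tt"
  have f: "f a \<in> carrier_mat (d (t a)) (d (s a))" if "a \<in> A" for a using rep that unfolding rep_def by blast
  have Nc: "N i \<in> carrier_mat (d i) (d i)" if "i < n" for i using N(1) that unfolding nil_ends_def nilpotent_mat_def by blast
  have Nf: "N (t a) * f a = f a * N (s a)" if "a \<in> A" for a using N(1) that unfolding nil_ends_def by blast
  obtain N0 U where N0: "\<And>i. i < n \<Longrightarrow> nilpotent_mat (d i) (N0 i)" "\<And>i. i < n \<Longrightarrow> jordan_type (N0 i) (\<nu> i)"
    and U: "dense_open_in_via (rep_coords A s t d) (compat_reps A s t d N0) U"
      "\<And>g. g \<in> U \<Longrightarrow> rep_iso n A s t d g d f"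
    using gen unfolding is_GenRep_def by blast
  have N0c: "N0 i \<in> carrier_mat (d i) (d i)" if "i < n" for i using N0(1)[OF that] unfolding nilpotent_mat_def by blast
  obtain f1 where f1: "f1 \<in> compat_reps A s t d N0" "ample_cokernel (bdiag N0) (stack f1 (d k)) ?r"
    using exists_ample_rep[OF N0c N0(2) inter] by blast
  obtain e where e: "bdiag N0 ^\<^sub>m e = 0\<^sub>m m m" using bdiag_nilpotent[of N0] N0(1) t_less by auto
  let ?\<delta> = "pdiff tt (adj_partition A s t \<nu> k) (\<nu> k)"
  have "partition (adj_partition A s t \<nu> k)"
    using bdiag_jordan_type[of N0 \<nu>] N0c N0(2) t_less unfolding jordan_type_iff by auto
  hence part: "partition ?\<delta>" using pdiff_partition inter by blast
  define J where "J = e + ?\<delta> 0"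
  have BJ: "bdiag N0 ^\<^sub>m J = 0\<^sub>m m m" by (rule pow_mat_zero_mono[OF block_carrier(3) e]) (simp add: J_def)
  have rJ: "?r j = 0" if "J \<le> j" for j using excess_eventually_zero[OF part, of j] that by (simp add: J_def)
  obtain pa where pa: "pa \<in> poly_fun" "pa (rep_coords A s t d f1) \<noteq> 0"
    "\<And>g. pa (rep_coords A s t d g) \<noteq> 0 \<Longrightarrow> ample_cokernel (bdiag N0) (stack g (d k)) ?r"
    using ample_poly[OF f1(2) block_carrier(3) BJ rJ] by blast
  let ?C = "compat_reps A s t d N0"
  have "open_in_via (rep_coords A s t d) ?C {g\<in>?C. pa (rep_coords A s t d g) \<noteq> 0}"
    unfolding open_in_via_iff using pa(1) by blast
  moreover have "f1 \<in> {g\<in>?C. pa (rep_coords A s t d g) \<noteq> 0}" using f1(1) pa(2) by blast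
  ultimately obtain f2 where f2: "f2 \<in> U" "f2 \<in> ?C" "pa (rep_coords A s t d f2) \<noteq> 0"
    using U(1) unfolding dense_open_in_via_def by blast
  have "open_in_via (rep_coords A s t d) ?C U" using U(1) unfolding dense_open_in_via_def by blast
  then obtain pU where pU: "pU \<in> poly_fun" "pU (rep_coords A s t d f2) \<noteq> 0"
    "\<And>g. g \<in> ?C \<Longrightarrow> pU (rep_coords A s t d g) \<noteq> 0 \<Longrightarrow> g \<in> U"
    using f2(1) unfolding open_in_via_iff by blast
  have "\<exists>P Q. similar_mat_wit (N0 i) (N i) P Q" if "i < n" for i
    using jordan_shape_unique_similar[of "N0 i" "\<nu> i" "N i"] N0(2)[OF that] N(2)[OF that]
    unfolding jordan_type_iff similar_mat_def by blast
  then obtain h h' where hh: "\<And>i. i < n \<Longrightarrow> similar_mat_wit (N0 i) (N i) (h i) (h' i)" by metis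
  note w = similar_mat_witD2[OF N0c hh]
  have hw: "h i \<in> carrier_mat (d i) (d i)" "h' i \<in> carrier_mat (d i) (d i)"
    "h' i * h i = 1\<^sub>m (d i)" "h i * h' i = 1\<^sub>m (d i)" if "i < n" for i
    using w(6,7,2,1)[OF that that] by blast+
  have hN: "h i * N i = N0 i * h i" if "i < n" for i
  proof -
    have "N0 i * h i = h i * (N i * (h' i * h i))" unfolding w(3)[OF that that]
      using carrier_matD[OF w(5)[OF that that]] carrier_matD[OF w(6)[OF that that]] carrier_matD[OF w(7)[OF that that]]
      by (simp add: mat_assoc)
    thus ?thesis unfolding w(2)[OF that that] using carrier_matD[OF w(5)[OF that that]] by simp
  qed
  have h'N: "N i * h' i = h' i * N0 i" if "i < n" for i
  proof -
    have "h' i * N0 i = (h' i * h i) * (N i * h' i)" unfolding w(3)[OF that that]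
      using carrier_matD[OF w(5)[OF that that]] carrier_matD[OF w(6)[OF that that]] carrier_matD[OF w(7)[OF that that]]
      by (simp add: mat_assoc)
    thus ?thesis unfolding w(2)[OF that that] using carrier_matD[OF w(5)[OF that that]] by simp
  qed
  define f' where "f' a = h (t a) * f a * h' (s a)" for a
  have f'C: "f' \<in> ?C"
    unfolding compat_reps_def rep_def
  proof (intro CollectI conjI ballI)
    fix a assume a: "a \<in> A"
    note sn = s_less[OF a] and tn = t_less[OF a]
    note dims = carrier_matD[OF w(5)[OF sn sn]] carrier_matD[OF w(6)[OF sn sn]] carrier_matD[OF w(7)[OF sn sn]]
      carrier_matD[OF w(5)[OF tn tn]] carrier_matD[OF w(6)[OF tn tn]] carrier_matD[OF w(7)[OF tn tn]]
      carrier_matD[OF f[OF a]] carrier_matD[OF N0c[OF sn]] carrier_matD[OF N0c[OF tn]]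
    show "f' a \<in> carrier_mat (d (t a)) (d (s a))" unfolding f'_def using dims by (intro carrier_matI) auto
    have "N0 (t a) * f' a = (N0 (t a) * h (t a)) * (f a * h' (s a))" unfolding f'_def using dims by (simp add: mat_assoc)
    also have "\<dots> = h (t a) * ((N (t a) * f a) * h' (s a))" unfolding hN[OF tn, symmetric] using dims by (simp add: mat_assoc)
    also have "\<dots> = h (t a) * (f a * (N (s a) * h' (s a)))" unfolding Nf[OF a] using dims by (simp add: mat_assoc)
    also have "\<dots> = f' a * N0 (s a)" unfolding h'N[OF sn] f'_def using dims by (simp add: mat_assoc)
    finally show "N0 (t a) * f' a = f' a * N0 (s a)" .
  qed
  have rep2: "rep A s t d f2" "rep A s t d f'" using f2(2) f'C unfolding compat_reps_def by auto
  define F where "F x = (\<lambda>a. (1 - x) \<cdot>\<^sub>m f' a + x \<cdot>\<^sub>m f2 a)" for x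
  have FC: "F x \<in> ?C" for x unfolding F_def
    by (rule compat_reps_lincomb[OF f'C f2(2)]) (use N0c s_less t_less in auto)
  have Fc: "F x a \<in> carrier_mat (d (t a)) (d (s a))" if "a \<in> A" for x a
    using FC[of x] that unfolding compat_reps_def rep_def by blast
  have f'c: "f' a \<in> carrier_mat (d (t a)) (d (s a))" "f2 a \<in> carrier_mat (d (t a)) (d (s a))" if "a \<in> A" for a
    using rep2 that unfolding rep_def by auto
  have F0: "F 0 a = f' a" if "a \<in> A" for a unfolding F_def using f'c[OF that] by (intro eq_matI) auto
  have F1: "rep_coords A s t d (F 1) = rep_coords A s t d f2"
    unfolding F_def by (rule ext) (simp only: rep_coords_lincomb[OF rep2(2,1)], simp)
  have regc: "regular_at e' (\<lambda>x. rep_coords A s t d (F x) v)" for e' v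
    unfolding F_def rep_coords_lincomb[OF rep2(2,1)] by (intro regular_at_add regular_at_mult regular_at_diff) auto
  have ev1: "\<forall>\<^sub>F x in cofinite. pU (rep_coords A s t d (F x)) \<noteq> 0"
    by (rule regular_at_nonzero_cofinite[of 1]) (use regular_at_poly_fun[OF pU(1) regc] F1 pU(2) in auto)
  have ev2: "\<forall>\<^sub>F x in cofinite. pa (rep_coords A s t d (F x)) \<noteq> 0"
    by (rule regular_at_nonzero_cofinite[of 1]) (use regular_at_poly_fun[OF pa(1) regc] F1 f2(3) in auto)
  have iso: "\<forall>\<^sub>F x in cofinite. \<exists>\<phi> \<phi>'. (\<forall>i<n. \<phi> i \<in> carrier_mat (d i) (d i) \<and> \<phi>' i \<in> carrier_mat (d i) (d i) \<and>
        \<phi>' i * \<phi> i = 1\<^sub>m (d i)) \<and> (\<forall>a\<in>A. \<phi> (t a) * F x a = f a * \<phi> (s a))"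
    using ev1
  proof eventually_elim
    case (elim x)
    have "rep_iso n A s t d (F x) d f" using U(2) pU(3)[OF FC elim] by blast
    then obtain \<phi> where \<phi>: "\<And>i. i < n \<Longrightarrow> \<phi> i \<in> carrier_mat (d i) (d i) \<and> invertible_mat (\<phi> i)"
      "\<forall>a\<in>A. \<phi> (t a) * F x a = f a * \<phi> (s a)" unfolding rep_iso_def by blast
    have "\<exists>M. M \<in> carrier_mat (d i) (d i) \<and> M * \<phi> i = 1\<^sub>m (d i)" if "i < n" for i
      using \<phi>(1)[OF that] by (auto elim!: invertible_mat_inverse[of "\<phi> i" "d i"])
    then obtain \<phi>' where "\<And>i. i < n \<Longrightarrow> \<phi>' i \<in> carrier_mat (d i) (d i) \<and> \<phi>' i * \<phi> i = 1\<^sub>m (d i)" by metis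
    thus ?case using \<phi> by blast
  qed
  have regF: "regular_mat_at 0 (\<lambda>x. F x a)" if "a \<in> A" for a
  proof (rule regular_mat_atI[OF Fc[OF that]])
    fix i j assume ij: "i < d (t a)" "j < d (s a)"
    have "F x a $$ (i, j) = (1 - x) * f' a $$ (i, j) + x * f2 a $$ (i, j)" for x
      unfolding F_def using ij carrier_matD[OF f'c(1)[OF that]] carrier_matD[OF f'c(2)[OF that]] by simp
    thus "regular_at 0 (\<lambda>x. F x a $$ (i, j))" by (simp only:) (intro regular_at_add regular_at_mult regular_at_diff; simp)
  qed
  have hf: "h (t a) * f a = F 0 a * h (s a)" if "a \<in> A" for a
  proof -
    note sn = s_less[OF that] and tn = t_less[OF that]
    have "f' a * h (s a) = h (t a) * (f a * (h' (s a) * h (s a)))" unfolding f'_def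
      using carrier_matD[OF w(6)[OF sn sn]] carrier_matD[OF w(7)[OF sn sn]]
        carrier_matD[OF w(6)[OF tn tn]] carrier_matD[OF f[OF that]] by (simp add: mat_assoc)
    thus ?thesis unfolding w(2)[OF sn sn] F0[OF that] using carrier_matD[OF f[OF that]] by simp
  qed
  have "\<exists>H. (\<forall>i<n. regular_mat_at 0 (\<lambda>x. H x i)) \<and> (\<forall>x i. H x i \<in> carrier_mat (d i) (d i)) \<and>
      (\<forall>i<n. H 0 i = h i) \<and> (\<forall>\<^sub>F x in cofinite. \<forall>a\<in>A. H x (t a) * f a = F x a * H x (s a))"
  proof (rule intertwiner_path[where F = F and f = f and h = h and h' = h' and A = A and s = s and t = t and n = n and d = d,
        OF finA s_less t_less f Fc regF hw hf iso])
    fix H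
    assume "\<And>i. i < n \<Longrightarrow> regular_mat_at 0 (\<lambda>x. H x i)" "\<And>x i. H x i \<in> carrier_mat (d i) (d i)"
      "\<And>i. i < n \<Longrightarrow> H 0 i = h i" "\<forall>\<^sub>F x in cofinite. \<forall>a\<in>A. H x (t a) * f a = F x a * H x (s a)"
    thus ?thesis by (intro exI[of _ H]) simp
  qed
  then obtain H where H: "\<And>i. i < n \<Longrightarrow> regular_mat_at 0 (\<lambda>x. H x i)" "\<And>x i. H x i \<in> carrier_mat (d i) (d i)"
      "\<And>i. i < n \<Longrightarrow> H 0 i = h i" "\<forall>\<^sub>F x in cofinite. \<forall>a\<in>A. H x (t a) * f a = F x a * H x (s a)"
    by blast
  have det0: "det (H 0 i) \<noteq> 0" if "i < n" for i
  proof
    assume "det (H 0 i) = 0"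
    hence "det (h i * h' i) = 0" using det_mult[OF w(6)[OF that that] w(7)[OF that that]] H(3)[OF that] by simp
    thus False using w(1)[OF that that] by simp
  qed
  have "\<forall>\<^sub>F x in cofinite. \<forall>i\<in>{..<n}. det (H x i) \<noteq> 0"
    by (rule eventually_ball_finite) (auto intro!: regular_at_nonzero_cofinite[of 0] regular_at_det[OF H(1,2)] simp: det0)
  hence ev3: "\<forall>\<^sub>F x in cofinite. \<forall>i<n. det (H x i) \<noteq> 0" by eventually_elim auto
  define N1 where "N1 x i = mat_inv (H x i) * N0 i * H x i" for x i
  have Hd: "dim_row (H x i) = d i" "dim_col (H x i) = d i" for x i using carrier_matD[OF H(2)] by auto
  have Hid: "dim_row (mat_inv (H x i)) = d i" "dim_col (mat_inv (H x i)) = d i" for x i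
    unfolding mat_inv_def using carrier_matD[OF adj_mat(1)[OF H(2)]] by auto
  have N1c: "N1 x i \<in> carrier_mat (d i) (d i)" for x i unfolding N1_def using Hd Hid by (intro carrier_matI) auto
  have regN1: "regular_mat_at 0 (\<lambda>x. N1 x i)" if "i < n" for i unfolding N1_def
    by (intro regular_mat_at_mult regular_mat_at_const regular_mat_at_inv[OF H(1)[OF that] H(2) det0[OF that]] H(1)[OF that])
       (use Hd Hid carrier_matD[OF N0c[OF that]] in auto)
  have N10: "N1 0 i = N i" if "i < n" for i
  proof -
    note mi = mat_inv[OF H(2) det0[OF that]]
    have "N1 0 i = mat_inv (H 0 i) * (N0 i * H 0 i)" unfolding N1_def
      using Hd Hid carrier_matD[OF N0c[OF that]] by (simp add: mat_assoc)
    also have "N0 i * H 0 i = H 0 i * N i" unfolding H(3)[OF that] hN[OF that] ..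
    also have "mat_inv (H 0 i) * (H 0 i * N i) = (mat_inv (H 0 i) * H 0 i) * N i"
      using Hd Hid carrier_matD[OF Nc[OF that]] by (simp add: mat_assoc)
    finally show ?thesis unfolding mi(3) using Nc[OF that] by simp
  qed
  have "end_coords n d (N1 0) = end_coords n d N" by (rule end_coords_cong) (rule N10)
  hence ev4: "\<forall>\<^sub>F x in cofinite. p (end_coords n d (N1 x)) \<noteq> 0"
    using p(2) by (intro regular_at_nonzero_cofinite[of 0] regular_at_poly_fun[OF p(1)] end_coords_regular regN1 N1c) auto
  have "\<forall>\<^sub>F x in cofinite. N1 x \<in> nil_ends n A s t d f \<and> p (end_coords n d (N1 x)) \<noteq> 0 \<and>
      ample_cokernel (bdiag (N1 x)) (stack f (d k)) ?r"
    using ev2 ev3 ev4 H(4)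
  proof eventually_elim
    case (elim x)
    define G where "G i = mat_inv (H x i)" for i
    have GH: "H x i * G i = 1\<^sub>m (d i)" "G i * H x i = 1\<^sub>m (d i)" if "i < n" for i
      using mat_inv(2,3)[OF H(2)] elim(2) that unfolding G_def by blast+
    have Gc: "G i \<in> carrier_mat (d i) (d i)" for i unfolding G_def using Hid by (intro carrier_matI) auto
    note Gd = carrier_matD[OF Gc]
    have N1G: "N1 x i * G i = G i * N0 i" if "i < n" for i
    proof -
      have "N1 x i * G i = G i * (N0 i * (H x i * G i))"
        unfolding N1_def G_def[symmetric] using Gd Hd carrier_matD[OF N0c[OF that]] by (simp add: mat_assoc)
      thus ?thesis unfolding GH(1)[OF that] using carrier_matD[OF N0c[OF that]] by simp
    qed
    have GF: "G (t a) * F x a = f a * G (s a)" if a: "a \<in> A" for a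
    proof -
      note sn = s_less[OF a] and tn = t_less[OF a]
      note dims = Gd Hd carrier_matD[OF f[OF a]] carrier_matD[OF Fc[OF a]]
      have "G (t a) * F x a = G (t a) * (F x a * (H x (s a) * G (s a)))" unfolding GH(1)[OF sn] using dims by simp
      also have "\<dots> = G (t a) * ((F x a * H x (s a)) * G (s a))" using dims by (simp add: mat_assoc)
      also have "\<dots> = (G (t a) * H x (t a)) * (f a * G (s a))"
        unfolding bspec[OF elim(4) a, symmetric] using dims by (simp add: mat_assoc)
      finally show ?thesis unfolding GH(2)[OF tn] using dims by simp
    qed
    have "nilpotent_mat (d i) (N1 x i)" if i: "i < n" for i
    proof -
      obtain e where e: "N0 i ^\<^sub>m e = 0\<^sub>m (d i) (d i)" using N0(1)[OF i] unfolding nilpotent_mat_def by blast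
      have "similar_mat_wit (N1 x i) (N0 i) (G i) (H x i)"
        by (rule similar_mat_witI[OF GH(2,1)[OF that]]) (use N1c N0c[OF that] Gc H(2) in \<open>auto simp: N1_def G_def\<close>)
      hence "N1 x i ^\<^sub>m e = 0\<^sub>m (d i) (d i)" using similar_mat_wit_pow_id[of "N1 x i" "N0 i" "G i" "H x i" e] e Gd Hd by simp
      thus ?thesis unfolding nilpotent_mat_def using N1c by blast
    qed
    moreover have "N1 x (t a) * f a = f a * N1 x (s a)" if a: "a \<in> A" for a
    proof -
      note sn = s_less[OF a] and tn = t_less[OF a]
      have F0: "N0 (t a) * F x a = F x a * N0 (s a)" using FC[of x] a unfolding compat_reps_def by blast
      note dims = Gd Hd carrier_matD[OF f[OF a]] carrier_matD[OF Fc[OF a]] carrier_matD[OF N0c[OF sn]] carrier_matD[OF N0c[OF tn]]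
      have "N1 x (t a) * f a = G (t a) * (N0 (t a) * (H x (t a) * f a))"
        unfolding N1_def G_def[symmetric] using dims by (simp add: mat_assoc)
      also have "\<dots> = G (t a) * ((N0 (t a) * F x a) * H x (s a))" unfolding bspec[OF elim(4) a] using dims by (simp add: mat_assoc)
      also have "\<dots> = (G (t a) * F x a) * (N0 (s a) * H x (s a))" unfolding F0 using dims by (simp add: mat_assoc)
      also have "\<dots> = f a * N1 x (s a)" unfolding GF[OF a] N1_def G_def[symmetric] using dims by (simp add: mat_assoc)
      finally show ?thesis .
    qed
    ultimately have "N1 x \<in> nil_ends n A s t d f" unfolding nil_ends_def by blast
    moreover have "ample_cokernel (bdiag (N1 x)) (stack f (d k)) ?r"
      by (rule ample_conj[OF pa(3)[OF elim(1)], where P = G and Q = "H x"])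
         (use Fc f N0c N1c Gc H(2) GH(1) N1G GF in auto)
    ultimately show ?case using elim(3) by blast
  qed
  moreover have "(cofinite :: 'k filter) \<noteq> bot" using infinite_UNIV_alg_closed by simp
  ultimately obtain x where "N1 x \<in> nil_ends n A s t d f \<and> p (end_coords n d (N1 x)) \<noteq> 0 \<and>
      ample_cokernel (bdiag (N1 x)) (stack f (d k)) ?r" using eventually_happens by blast
  thus ?thesis using that by blast
qed

end

section \<open>The reflection functor\<close>

lemma solve_columns:
  fixes A B :: "'k::semiring_0 mat"
  assumes "A \<in> carrier_mat a b" "B \<in> carrier_mat a c" "\<And>j. j < c \<Longrightarrow> \<exists>v\<in>carrier_vec b. A *\<^sub>v v = col B j"
  obtains X where "X \<in> carrier_mat b c" "A * X = B"
proof -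
  obtain V where V: "\<And>j. j < c \<Longrightarrow> V j \<in> carrier_vec b \<and> A *\<^sub>v V j = col B j" using assms(3) by metis
  define X where "X = mat b c (\<lambda>(i, j). V j $ i)"
  have "A * X = B"
  proof (rule eq_matI)
    fix i j assume "i < dim_row B" "j < dim_col B"
    hence ij: "i < a" "j < c" using assms(2) by auto
    have "col X j = V j" using V[OF ij(2)] ij by (intro eq_vecI) (auto simp: X_def)
    hence "(A * X) $$ (i, j) = (A *\<^sub>v V j) $ i" using ij assms(1) by (simp add: X_def)
    thus "(A * X) $$ (i, j) = B $$ (i, j)" using V[OF ij(2)] ij assms(2) by simp
  qed (use assms in \<open>auto simp: X_def\<close>)
  thus ?thesis using that[of X] by (simp add: X_def)
qed

lemma zero_nil_ends:
  fixes f :: "'a \<Rightarrow> 'k::field mat"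
  assumes "rep A s t d f"
  shows "(\<lambda>i. 0\<^sub>m (d i) (d i)) \<in> nil_ends n A s t d f"
  unfolding nil_ends_def nilpotent_mat_def
proof (intro CollectI conjI allI impI ballI)
  fix i
  show "\<exists>e. (0\<^sub>m (d i) (d i) :: 'k mat) ^\<^sub>m e = 0\<^sub>m (d i) (d i)" by (rule exI[of _ 1]) simp
next
  fix a assume "a \<in> A"
  hence "f a \<in> carrier_mat (d (t a)) (d (s a))" using assms unfolding rep_def by blast
  thus "0\<^sub>m (d (t a)) (d (t a)) * f a = f a * 0\<^sub>m (d (s a)) (d (s a))" by simp
qed auto

context source_vertex
begin

lemma refl_Out: "a \<in> Out \<Longrightarrow> refl_src s t k a = t a" "a \<in> Out \<Longrightarrow> refl_tgt s t k a = k"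
  by (auto simp: refl_src_def refl_tgt_def)

lemma refl_not_Out: "a \<in> A \<Longrightarrow> s a \<noteq> k \<Longrightarrow> refl_src s t k a = s a" "a \<in> A \<Longrightarrow> s a \<noteq> k \<Longrightarrow> refl_tgt s t k a = t a"
  using t_neq by (auto simp: refl_src_def refl_tgt_def)

lemma nil_ends_iff:
  assumes "rep A s t d f" "\<And>i. i < n \<Longrightarrow> N i \<in> carrier_mat (d i) (d i)"
  shows "N \<in> nil_ends n A s t d f \<longleftrightarrow> (\<forall>i<n. nilpotent_mat (d i) (N i)) \<and>
    bdiag N * stack f (d k) = stack f (d k) * N k \<and> (\<forall>a\<in>A. s a \<noteq> k \<longrightarrow> N (t a) * f a = f a * N (s a))"
proof -
  have fc: "f a \<in> carrier_mat (d (t a)) (d k)" if "a \<in> Out" for a using assms(1) that unfolding rep_def by force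
  have Nt: "N (t a) \<in> carrier_mat (d (t a)) (d (t a))" if "a \<in> Out" for a using assms(2) t_less that by auto
  note Nk = assms(2)[OF k_less]
  have "bdiag N * stack f (d k) = stack f (d k) * N k \<longleftrightarrow> (\<forall>a\<in>Out. N (t a) * f a = f a * N k)"
  proof -
    have "bdiag N * stack f (d k) = stack (\<lambda>a. N (t a) * f a) (d k)" by (rule bdiag_stack[OF Nt fc])
    moreover have "stack f (d k) * N k = stack (\<lambda>a. f a * N k) (d k)" by (rule stack_mult[OF fc Nk])
    moreover have "stack (\<lambda>a. N (t a) * f a) (d k) = stack (\<lambda>a. f a * N k) (d k) \<longleftrightarrow> (\<forall>a\<in>Out. N (t a) * f a = f a * N k)"
      by (rule stack_eq_iff[OF mult_carrier_mat[OF Nt fc] mult_carrier_mat[OF fc Nk]])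
    ultimately show ?thesis by simp
  qed
  thus ?thesis unfolding nil_ends_def by auto
qed

lemma refl_nil_ends_iff:
  assumes rep: "rep A (refl_src s t k) (refl_tgt s t k) d' g" and d': "\<And>i. i < n \<Longrightarrow> i \<noteq> k \<Longrightarrow> d' i = d i"
    and g: "\<And>a. a \<in> A \<Longrightarrow> s a \<noteq> k \<Longrightarrow> g a = f a" and c: "\<And>i. i < n \<Longrightarrow> N i \<in> carrier_mat (d' i) (d' i)"
  shows "N \<in> nil_ends n A (refl_src s t k) (refl_tgt s t k) d' g \<longleftrightarrow> (\<forall>i<n. nilpotent_mat (d' i) (N i)) \<and>
    N k * flat g (d' k) = flat g (d' k) * bdiag N \<and> (\<forall>a\<in>A. s a \<noteq> k \<longrightarrow> N (t a) * f a = f a * N (s a))"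
proof -
  have dt: "d' (t a) = d (t a)" if "a \<in> Out" for a using d' t_less t_neq that by auto
  have gc: "g a \<in> carrier_mat (d' k) (d (t a))" if "a \<in> Out" for a
  proof -
    have "g a \<in> carrier_mat (d' (refl_tgt s t k a)) (d' (refl_src s t k a))" using rep that unfolding rep_def by blast
    thus ?thesis unfolding refl_Out[OF that] dt[OF that] .
  qed
  have Nt: "N (t a) \<in> carrier_mat (d (t a)) (d (t a))" if "a \<in> Out" for a
    using c[of "t a"] t_less dt[OF that] that by auto
  note Nk = c[OF k_less]
  have *: "N k * flat g (d' k) = flat g (d' k) * bdiag N \<longleftrightarrow> (\<forall>a\<in>Out. N k * g a = g a * N (t a))"
  proof -
    have "flat g (d' k) * bdiag N = flat (\<lambda>a. g a * N (t a)) (d' k)" by (rule flat_bdiag[OF Nt gc])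
    moreover have "N k * flat g (d' k) = flat (\<lambda>a. N k * g a) (d' k)" by (rule mult_flat[OF gc Nk])
    moreover have "flat (\<lambda>a. N k * g a) (d' k) = flat (\<lambda>a. g a * N (t a)) (d' k) \<longleftrightarrow> (\<forall>a\<in>Out. N k * g a = g a * N (t a))"
      by (rule flat_eq_iff[OF mult_carrier_mat[OF Nk gc] mult_carrier_mat[OF gc Nt]])
    ultimately show ?thesis by simp
  qed
  have "(\<forall>a\<in>A. N (refl_tgt s t k a) * g a = g a * N (refl_src s t k a)) \<longleftrightarrow>
      (\<forall>a\<in>Out. N k * g a = g a * N (t a)) \<and> (\<forall>a\<in>A. s a \<noteq> k \<longrightarrow> N (t a) * f a = f a * N (s a))"
    using refl_Out refl_not_Out g by (smt (verit) mem_Collect_eq)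
  thus ?thesis unfolding nil_ends_def * by auto
qed

lemma reflection_splitting:
  fixes f :: "'a \<Rightarrow> 'k::field mat"
  assumes refl: "is_reflection_minus n A s t k d f d' g" and rep: "rep A s t d f"
  obtains \<sigma> T where "\<sigma> \<in> carrier_mat m (d' k)" "T \<in> carrier_mat (d k) m"
    "flat g (d' k) * \<sigma> = 1\<^sub>m (d' k)" "flat g (d' k) * stack f (d k) = 0\<^sub>m (d' k) (d k)"
    "\<sigma> * flat g (d' k) + stack f (d k) * T = 1\<^sub>m m"
proof -
  let ?G = "flat g (d' k)" and ?\<Phi> = "stack f (d k)"
  define Gx where "Gx x = vec (d' k) (\<lambda>r. \<Sum>a\<in>Out. (g a *\<^sub>v x a) $ r)" for x
  have R: "rep A (refl_src s t k) (refl_tgt s t k) d' g" "\<And>i. i < n \<Longrightarrow> i \<noteq> k \<Longrightarrow> d' i = d i"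
    "\<And>w. w \<in> carrier_vec (d' k) \<Longrightarrow> \<exists>x. (\<forall>a\<in>Out. x a \<in> carrier_vec (d (t a))) \<and> Gx x = w"
    "\<And>x. \<forall>a\<in>Out. x a \<in> carrier_vec (d (t a)) \<Longrightarrow>
       (Gx x = 0\<^sub>v (d' k)) = (\<exists>v\<in>carrier_vec (d k). \<forall>a\<in>Out. x a = f a *\<^sub>v v)"
    using refl unfolding is_reflection_minus_def Let_def Gx_def by blast+
  have gc: "g a \<in> carrier_mat (d' k) (d (t a))" if "a \<in> Out" for a
  proof -
    have "g a \<in> carrier_mat (d' (refl_tgt s t k a)) (d' (refl_src s t k a))" using R(1) that unfolding rep_def by blast
    moreover have "d' (t a) = d (t a)" using R(2) t_less t_neq that by auto
    ultimately show ?thesis unfolding refl_Out[OF that] by simp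
  qed
  have fc: "f a \<in> carrier_mat (d (t a)) (d k)" if "a \<in> Out" for a using rep that unfolding rep_def by force
  define cat where "cat x = vec m (\<lambda>p. x (fst (\<kappa> p)) $ snd (\<kappa> p))" for x :: "'a \<Rightarrow> 'k vec"
  have cat [simp]: "cat x \<in> carrier_vec m" for x by (simp add: cat_def)
  have G_cat: "?G *\<^sub>v cat x = Gx x" if x: "\<forall>a\<in>Out. x a \<in> carrier_vec (d (t a))" for x
  proof (rule eq_vecI)
    fix r assume "r < dim_vec (Gx x)"
    hence r: "r < d' k" by (simp add: Gx_def)
    have "(?G *\<^sub>v cat x) $ r = (\<Sum>p<m. (\<lambda>a l. g a $$ (r, l) * x a $ l) (fst (\<kappa> p)) (snd (\<kappa> p)))"
      using r by (auto simp: flat_def cat_def scalar_prod_def atLeast0LessThan intro!: sum.cong)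
    also have "\<dots> = (\<Sum>a\<in>Out. \<Sum>l<d (t a). g a $$ (r, l) * x a $ l)" by (rule sum_\<kappa>)
    also have "\<dots> = (\<Sum>a\<in>Out. (g a *\<^sub>v x a) $ r)"
    proof (rule sum.cong[OF HOL.refl])
      fix a assume a: "a \<in> Out"
      show "(\<Sum>l<d (t a). g a $$ (r, l) * x a $ l) = (g a *\<^sub>v x a) $ r"
        using carrier_matD[OF gc[OF a]] carrier_vecD[OF bspec[OF x a]] r
        by (auto simp: scalar_prod_def atLeast0LessThan intro!: sum.cong)
    qed
    finally show "(?G *\<^sub>v cat x) $ r = Gx x $ r" using r by (simp add: Gx_def)
  qed (simp add: Gx_def)
  have \<Phi>_cat: "?\<Phi> *\<^sub>v v = cat (\<lambda>a. f a *\<^sub>v v)" if v: "v \<in> carrier_vec (d k)" for v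
  proof (rule eq_vecI)
    fix p assume "p < dim_vec (cat (\<lambda>a. f a *\<^sub>v v))"
    hence p: "p < m" by (simp add: cat_def)
    have "fst (\<kappa> p) \<in> Out" using \<kappa>_mem[OF p] by simp
    thus "(?\<Phi> *\<^sub>v v) $ p = cat (\<lambda>a. f a *\<^sub>v v) $ p"
      using p v carrier_matD[OF fc] \<kappa>_mem(3)[OF p] by (auto simp: cat_def stack_def scalar_prod_def intro!: sum.cong)
  qed (simp add: cat_def)
  have uncat: "\<exists>x. (\<forall>a\<in>Out. x a \<in> carrier_vec (d (t a))) \<and> cat x = y" if y: "y \<in> carrier_vec m" for y
  proof -
    define x where "x a = vec (d (t a)) (\<lambda>r. y $ (the_inv_into {..<m} \<kappa> (a, r)))" for a
    have inj: "inj_on \<kappa> {..<m}" using \<kappa> by (simp add: bij_betw_def)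
    have "cat x = y"
    proof (rule eq_vecI)
      fix p assume "p < dim_vec y"
      hence p: "p < m" using y by simp
      have "the_inv_into {..<m} \<kappa> (fst (\<kappa> p), snd (\<kappa> p)) = p" using the_inv_into_f_f[OF inj, of p] p by simp
      thus "cat x $ p = y $ p" using p \<kappa>_mem(3)[OF p] by (simp add: cat_def x_def)
    qed (use y in \<open>simp add: cat_def\<close>)
    thus ?thesis by (intro exI[of _ x]) (simp add: x_def)
  qed
  have "\<exists>y\<in>carrier_vec m. ?G *\<^sub>v y = col (1\<^sub>m (d' k)) j" if j: "j < d' k" for j
  proof -
    have "col (1\<^sub>m (d' k)) j \<in> carrier_vec (d' k)" using j by (simp add: carrier_vecI)
    then obtain x where "\<forall>a\<in>Out. x a \<in> carrier_vec (d (t a))" "Gx x = col (1\<^sub>m (d' k)) j" using R(3) by blast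
    thus ?thesis using G_cat[of x] cat[of x] by metis
  qed
  then obtain \<sigma> where \<sigma>: "\<sigma> \<in> carrier_mat m (d' k)" "?G * \<sigma> = 1\<^sub>m (d' k)"
    using solve_columns[of ?G "d' k" m "1\<^sub>m (d' k)" "d' k"] by auto
  have G\<Phi>: "?G * ?\<Phi> = 0\<^sub>m (d' k) (d k)"
  proof (rule eq_matI)
    fix i j assume "i < dim_row (0\<^sub>m (d' k) (d k) :: 'k mat)" "j < dim_col (0\<^sub>m (d' k) (d k) :: 'k mat)"
    hence ij: "i < d' k" "j < d k" by auto
    let ?v = "unit_vec (d k) j :: 'k vec"
    have x: "\<forall>a\<in>Out. f a *\<^sub>v ?v \<in> carrier_vec (d (t a))" using fc by (auto intro!: mult_mat_vec_carrier)
    have "Gx (\<lambda>a. f a *\<^sub>v ?v) = 0\<^sub>v (d' k)" unfolding R(4)[OF x] by (rule bexI[of _ ?v]) auto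
    hence "?G *\<^sub>v (?\<Phi> *\<^sub>v ?v) = 0\<^sub>v (d' k)" using \<Phi>_cat[of ?v] G_cat[OF x] by simp
    moreover have "?\<Phi> *\<^sub>v ?v = col ?\<Phi> j" using ij by (intro eq_vecI) auto
    ultimately have "(?G *\<^sub>v col ?\<Phi> j) $ i = 0" using ij by simp
    thus "(?G * ?\<Phi>) $$ (i, j) = 0\<^sub>m (d' k) (d k) $$ (i, j)" using ij by simp
  qed auto
  let ?E = "1\<^sub>m m - \<sigma> * ?G"
  have E: "?E \<in> carrier_mat m m" using \<sigma>(1) by (intro carrier_matI) auto
  have "?G * ?E = ?G - (?G * \<sigma>) * ?G" using \<sigma>(1) by (simp add: mat_ring)
  also have "\<dots> = 0\<^sub>m (d' k) m" unfolding \<sigma>(2) by (intro eq_matI) auto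
  finally have GE: "?G * ?E = 0\<^sub>m (d' k) m" .
  have "\<exists>v\<in>carrier_vec (d k). ?\<Phi> *\<^sub>v v = col ?E j" if j: "j < m" for j
  proof -
    have cE: "col ?E j \<in> carrier_vec m" by (rule col_carrier_vec[OF j E])
    obtain x where x: "\<forall>a\<in>Out. x a \<in> carrier_vec (d (t a))" "cat x = col ?E j" using uncat[OF cE] by blast
    have "?G *\<^sub>v col ?E j = col (?G * ?E) j" using col_mult2[OF _ E, of ?G "d' k" j] j by simp
    hence "Gx x = 0\<^sub>v (d' k)" using G_cat[OF x(1)] x(2) GE j by simp
    then obtain v where v: "v \<in> carrier_vec (d k)" "\<forall>a\<in>Out. x a = f a *\<^sub>v v" using R(4)[OF x(1)] by blast
    have "cat (\<lambda>a. f a *\<^sub>v v) = cat x"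
      unfolding cat_def using v(2) \<kappa>_mem by (intro eq_vecI) auto
    hence "?\<Phi> *\<^sub>v v = col ?E j" using \<Phi>_cat[OF v(1)] x(2) by simp
    thus ?thesis using v(1) by blast
  qed
  then obtain T where T: "T \<in> carrier_mat (d k) m" "?\<Phi> * T = ?E"
    using solve_columns[OF block_carrier(1) E] by blast
  have "\<sigma> * ?G + ?\<Phi> * T = 1\<^sub>m m" unfolding T(2) using \<sigma>(1) by (intro eq_matI) auto
  thus ?thesis using that \<sigma> T(1) G\<Phi> by blast
qed

lemma bdiag_poly_mat:
  assumes "\<And>a. a \<in> Out \<Longrightarrow> e (t a) = d (t a)"
  shows "poly_mat (\<lambda>y. bdiag (end_mats e y))"
proof (rule poly_matI[OF block_carrier(3)])
  fix p q assume pq: "p < m" "q < m"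
  note a = \<kappa>_mem[OF pq(1)] \<kappa>_mem[OF pq(2)]
  have e: "e (t (fst (\<kappa> p))) = d (t (fst (\<kappa> p)))" using assms a by auto
  have eq: "(\<lambda>y. bdiag (end_mats e y) $$ (p, q)) = (\<lambda>y. if fst (\<kappa> p) = fst (\<kappa> q)
      then y (t (fst (\<kappa> p)), snd (\<kappa> p), snd (\<kappa> q)) else 0)"
    using pq a e by (intro ext) (auto simp: bdiag_def end_mats_def)
  show "(\<lambda>y. bdiag (end_mats e y) $$ (p, q)) \<in> poly_fun" unfolding eq
    by (cases "fst (\<kappa> p) = fst (\<kappa> q)") (simp_all add: pf_var pf_const)
qed

lemma reflection_GenJF:
  fixes f :: "'a \<Rightarrow> 'k::alg_closed_field mat"
  assumes inter: "interlaced tt (adj_partition A s t \<nu> k) (\<nu> k)"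
    and rep: "rep A s t d f" and gen: "is_GenRep n A s t d f \<nu>" and jf: "is_GenJF n A s t d f \<nu>"
    and refl: "is_reflection_minus n A s t k d f d' g"
  shows "is_GenJF n A (refl_src s t k) (refl_tgt s t k) d' g (sigma_part A s t k tt \<nu>)"
proof -
  define \<Phi> where "\<Phi> = stack f (d k)"
  define G where "G = flat g (d' k)"
  define X where "X = nil_ends n A s t d f"
  define X' where "X' = nil_ends n A (refl_src s t k) (refl_tgt s t k) d' g"
  define \<mu> where "\<mu> = adj_partition A s t \<nu> k"
  define \<delta> where "\<delta> = pdiff tt \<mu> (\<nu> k)"
  let ?c = "end_coords n d :: (nat \<Rightarrow> 'k mat) \<Rightarrow> _" and ?c' = "end_coords n d' :: (nat \<Rightarrow> 'k mat) \<Rightarrow> _"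
  have repg: "rep A (refl_src s t k) (refl_tgt s t k) d' g" and d': "\<And>i. i < n \<Longrightarrow> i \<noteq> k \<Longrightarrow> d' i = d i"
    and gf: "\<And>a. a \<in> A \<Longrightarrow> s a \<noteq> k \<Longrightarrow> g a = f a"
    using refl unfolding is_reflection_minus_def by blast+
  have dt: "d' (t a) = d (t a)" if "a \<in> A" for a using d' t_less t_neq that by blast
  obtain U where U: "dense_open_in_via ?c X U" "\<And>N i. N \<in> U \<Longrightarrow> i < n \<Longrightarrow> jordan_type (N i) (\<nu> i)"
    using jf unfolding is_GenJF_def X_def by blast
  have UX: "U \<subseteq> X" and Uopen: "\<And>N. N \<in> U \<Longrightarrow> \<exists>p\<in>poly_fun. p (?c N) \<noteq> 0 \<and> (\<forall>z\<in>X. p (?c z) \<noteq> 0 \<longrightarrow> z \<in> U)"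
    and Udense: "\<And>V. open_in_via ?c X V \<Longrightarrow> V \<noteq> {} \<Longrightarrow> U \<inter> V \<noteq> {}"
    using U(1) unfolding dense_open_in_via_def open_in_via_iff by blast+
  have Xc: "N i \<in> carrier_mat (d i) (d i)" if "N \<in> X" "i < n" for N i
    using that unfolding X_def nil_ends_def nilpotent_mat_def by blast
  have X'c: "N i \<in> carrier_mat (d' i) (d' i)" if "N \<in> X'" "i < n" for N i
    using that unfolding X'_def nil_ends_def nilpotent_mat_def by blast
  have X_iff: "N \<in> X \<longleftrightarrow> (\<forall>i<n. nilpotent_mat (d i) (N i)) \<and>
      bdiag N * \<Phi> = \<Phi> * N k \<and> (\<forall>a\<in>A. s a \<noteq> k \<longrightarrow> N (t a) * f a = f a * N (s a))"
    if "\<And>i. i < n \<Longrightarrow> N i \<in> carrier_mat (d i) (d i)" for N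
    unfolding X_def \<Phi>_def by (rule nil_ends_iff[OF rep that])
  have X'_iff: "N \<in> X' \<longleftrightarrow> (\<forall>i<n. nilpotent_mat (d' i) (N i)) \<and>
      N k * G = G * bdiag N \<and> (\<forall>a\<in>A. s a \<noteq> k \<longrightarrow> N (t a) * f a = f a * N (s a))"
    if "\<And>i. i < n \<Longrightarrow> N i \<in> carrier_mat (d' i) (d' i)" for N
    unfolding X'_def G_def by (rule refl_nil_ends_iff[OF repg d' gf that])
  obtain \<sigma> T where \<sigma>: "\<sigma> \<in> carrier_mat m (d' k)" and T: "T \<in> carrier_mat (d k) m"
    and eqs: "G * \<sigma> = 1\<^sub>m (d' k)" "G * \<Phi> = 0\<^sub>m (d' k) (d k)" "\<sigma> * G + \<Phi> * T = 1\<^sub>m m"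
    using reflection_splitting[OF refl rep] unfolding G_def \<Phi>_def by blast
  have \<Phi>c: "\<Phi> \<in> carrier_mat m (d k)" and Gc: "G \<in> carrier_mat (d' k) m" by (simp_all add: \<Phi>_def G_def)
  have dims [simp]: "dim_row \<Phi> = m" "dim_col \<Phi> = d k" "dim_row G = d' k" "dim_col G = m"
    "dim_row \<sigma> = m" "dim_col \<sigma> = d' k" "dim_row T = d k" "dim_col T = m" using \<Phi>c Gc \<sigma> T by auto
  have Bd [simp]: "dim_row (bdiag N ^\<^sub>m j) = m" "dim_col (bdiag N ^\<^sub>m j) = m" for N :: "nat \<Rightarrow> 'k mat" and j by auto
  have Bnil: "\<exists>e. bdiag N ^\<^sub>m e = 0\<^sub>m m m" if "N \<in> X" for N
    using that t_less unfolding X_def nil_ends_def by (intro bdiag_nilpotent) auto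
  have X'nil: "\<exists>e. bdiag N ^\<^sub>m e = 0\<^sub>m m m" if "N \<in> X'" for N
  proof (rule bdiag_nilpotent)
    fix a assume "a \<in> Out"
    thus "nilpotent_mat (d (t a)) (N (t a))" using that t_less[of a] dt[of a] unfolding X'_def nil_ends_def by fastforce
  qed
  have "X \<noteq> {}" using zero_nil_ends[OF rep] unfolding X_def by blast
  moreover have "open_in_via ?c X X" unfolding open_in_via_iff
    by (intro conjI ballI bexI[of _ "\<lambda>_. 1"]) (auto intro: pf_const)
  ultimately obtain N0 where N0: "N0 \<in> U" using Udense by blast
  obtain N1 where N1: "N1 \<in> X" "ample_cokernel (bdiag N1) \<Phi> (excess \<delta>)"
    using generic_ample_endomorphism[OF rep _ _ gen inter pf_const[of 1], of N0] N0 UX U(2)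
    unfolding X_def \<Phi>_def \<delta>_def \<mu>_def by auto
  have part\<mu>: "partition \<mu>"
    using bdiag_jordan_type[of N0 \<nu>] N0 UX Xc U(2) t_less unfolding jordan_type_iff \<mu>_def by auto
  have part\<delta>: "partition \<delta>" unfolding \<delta>_def by (rule pdiff_partition[OF inter[folded \<mu>_def] part\<mu>])
  obtain e where "bdiag N1 ^\<^sub>m e = 0\<^sub>m m m" using Bnil[OF N1(1)] by blast
  then obtain T0 where T0: "T0 \<in> carrier_mat (d k) m" "T0 * \<Phi> = 1\<^sub>m (d k)"
    using ample_cokernel_injective[OF N1(2) block_carrier(3) \<Phi>c] by blast
  have dT0 [simp]: "dim_row T0 = d k" "dim_col T0 = m" using T0 by auto
  have T\<Phi>: "T * \<Phi> = 1\<^sub>m (d k)"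
  proof -
    have "(\<sigma> * G + \<Phi> * T) * \<Phi> = \<sigma> * (G * \<Phi>) + \<Phi> * (T * \<Phi>)" by (simp add: mat_ring)
    hence "\<Phi> = 0\<^sub>m m (d k) + \<Phi> * (T * \<Phi>)" unfolding eqs by simp
    moreover have "\<Phi> * (T * \<Phi>) \<in> carrier_mat m (d k)" by (intro carrier_matI) auto
    ultimately have "\<Phi> = \<Phi> * (T * \<Phi>)" using left_add_zero_mat by metis
    hence "T0 * \<Phi> = T0 * (\<Phi> * (T * \<Phi>))" by simp
    also have "\<dots> = (T0 * \<Phi>) * (T * \<Phi>)" by (simp add: mat_assoc)
    finally show ?thesis unfolding T0(2) by simp
  qed
  define ext where "ext N = N(k := G * bdiag N * \<sigma>)" for N
  define res where "res N = N(k := T * bdiag N * \<Phi>)" for N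
  have bupd: "bdiag (N(k := M)) = bdiag N" for N :: "nat \<Rightarrow> 'k mat" and M by (rule bdiag_cong) (use t_neq in auto)
  have ext_k: "ext N k = G * bdiag N * \<sigma>" "bdiag (ext N) = bdiag N" "i \<noteq> k \<Longrightarrow> ext N i = N i" for N i
    by (auto simp: ext_def bupd)
  have res_k: "res N k = T * bdiag N * \<Phi>" "bdiag (res N) = bdiag N" "i \<noteq> k \<Longrightarrow> res N i = N i" for N i
    by (auto simp: res_def bupd)
  have ext_comm: "ext N k * G = G * bdiag N" if "N \<in> X" for N
  proof -
    have XN: "bdiag N * \<Phi> = \<Phi> * N k" using X_iff[OF Xc[OF that]] that by blast
    have Nk: "dim_row (N k) = d k" "dim_col (N k) = d k" using Xc[OF that k_less] by auto
    have "G * bdiag N = G * bdiag N * (\<sigma> * G + \<Phi> * T)" unfolding eqs(3) by simp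
    also have "\<dots> = ext N k * G + G * ((bdiag N * \<Phi>) * T)" unfolding ext_k by (simp add: mat_ring)
    also have "G * ((bdiag N * \<Phi>) * T) = (G * \<Phi>) * (N k * T)" unfolding XN using Nk by (simp add: mat_assoc)
    also have "ext N k * G + (G * \<Phi>) * (N k * T) = ext N k * G" unfolding eqs(2) ext_k by (intro eq_matI) (auto simp: Nk)
    finally show ?thesis by simp
  qed
  have extX': "ext N \<in> X'" if N: "N \<in> X" for N
  proof -
    have c: "ext N i \<in> carrier_mat (d' i) (d' i)" if "i < n" for i
      using Xc[OF N that] d'[OF that] by (cases "i = k") (auto simp: ext_k intro!: carrier_matI)
    have "nilpotent_mat (d' i) (ext N i)" if i: "i < n" for i
    proof (cases "i = k")
      case True
      obtain e where e: "bdiag N ^\<^sub>m e = 0\<^sub>m m m" using Bnil[OF N] by blast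
      have ek: "ext N k \<in> carrier_mat (d' k) (d' k)" using c[OF k_less] .
      have "ext N k ^\<^sub>m e * G = G * bdiag N ^\<^sub>m e"
        by (rule pow_mat_intertwine[OF ek block_carrier(3) Gc ext_comm[OF N]])
      hence "ext N k ^\<^sub>m e * (G * \<sigma>) = 0\<^sub>m (d' k) (d' k)" unfolding e using ek by (subst mat_assoc[symmetric]) auto
      hence "ext N k ^\<^sub>m e = 0\<^sub>m (d' k) (d' k)" unfolding eqs(1) using ek by simp
      thus ?thesis unfolding nilpotent_mat_def True using ek by blast
    next
      case False
      have "nilpotent_mat (d i) (N i)" using N i unfolding X_def nil_ends_def by blast
      thus ?thesis using False d'[OF i] by (simp add: ext_k)
    qed
    moreover have "\<forall>a\<in>A. s a \<noteq> k \<longrightarrow> ext N (t a) * f a = f a * ext N (s a)"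
      using X_iff[OF Xc[OF N]] N t_neq by (simp add: ext_k)
    ultimately show ?thesis using X'_iff[OF c] ext_comm[OF N] by (simp add: ext_k)
  qed
  have res_comm: "bdiag N * \<Phi> = \<Phi> * res N k" if "N \<in> X'" for N
  proof -
    have NG: "N k * G = G * bdiag N" using X'_iff[OF X'c[OF that]] that by blast
    have Nk: "dim_row (N k) = d' k" "dim_col (N k) = d' k" using X'c[OF that k_less] by auto
    have "bdiag N * \<Phi> = (\<sigma> * G + \<Phi> * T) * (bdiag N * \<Phi>)" unfolding eqs(3) by simp
    also have "\<dots> = \<sigma> * ((G * bdiag N) * \<Phi>) + \<Phi> * res N k" unfolding res_k by (simp add: mat_ring)
    also have "(G * bdiag N) * \<Phi> = N k * (G * \<Phi>)" unfolding NG[symmetric] using Nk by (simp add: mat_assoc)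
    also have "\<sigma> * (N k * (G * \<Phi>)) + \<Phi> * res N k = \<Phi> * res N k" unfolding eqs(2) res_k using Nk by (intro eq_matI) auto
    finally show ?thesis .
  qed
  have resX: "res N \<in> X" if N: "N \<in> X'" for N
  proof -
    have c: "res N i \<in> carrier_mat (d i) (d i)" if "i < n" for i
      using X'c[OF N that] d'[OF that] by (cases "i = k") (auto simp: res_k intro!: carrier_matI)
    have "nilpotent_mat (d i) (res N i)" if i: "i < n" for i
    proof (cases "i = k")
      case True
      obtain e where e: "bdiag N ^\<^sub>m e = 0\<^sub>m m m" using X'nil[OF N] by blast
      have rk: "res N k \<in> carrier_mat (d k) (d k)" using c[OF k_less] .
      have "bdiag N ^\<^sub>m e * \<Phi> = \<Phi> * res N k ^\<^sub>m e"
        by (rule pow_mat_intertwine[OF block_carrier(3) rk \<Phi>c res_comm[OF N]])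
      hence "T * (\<Phi> * res N k ^\<^sub>m e) = 0\<^sub>m (d k) (d k)" unfolding e by (metis \<Phi>c T left_mult_zero_mat right_mult_zero_mat)
      hence "(T * \<Phi>) * res N k ^\<^sub>m e = 0\<^sub>m (d k) (d k)" using rk by (simp add: mat_assoc)
      hence "res N k ^\<^sub>m e = 0\<^sub>m (d k) (d k)" unfolding T\<Phi> using rk by simp
      thus ?thesis unfolding nilpotent_mat_def True using rk by blast
    next
      case False
      have "nilpotent_mat (d' i) (N i)" using N i unfolding X'_def nil_ends_def by blast
      thus ?thesis using False d'[OF i] by (simp add: res_k)
    qed
    moreover have "\<forall>a\<in>A. s a \<noteq> k \<longrightarrow> res N (t a) * f a = f a * res N (s a)"
      using X'_iff[OF X'c[OF N]] N t_neq by (simp add: res_k)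
    ultimately show ?thesis using X_iff[OF c] res_comm[OF N] by (simp add: res_k)
  qed
  have ext_res: "ext (res N) = N" if N: "N \<in> X'" for N
  proof -
    have NG: "N k * G = G * bdiag N" using X'_iff[OF X'c[OF N]] N by blast
    have Nk: "dim_row (N k) = d' k" "dim_col (N k) = d' k" using X'c[OF N k_less] by auto
    have "G * bdiag N * \<sigma> = N k * (G * \<sigma>)" unfolding NG[symmetric] using Nk by (simp add: mat_assoc)
    hence "G * bdiag N * \<sigma> = N k" unfolding eqs(1) using Nk by simp
    thus ?thesis by (auto simp: ext_def res_k fun_eq_iff)
  qed
  have res_ext: "res (ext N) = N" if N: "N \<in> X" for N
  proof -
    have XN: "bdiag N * \<Phi> = \<Phi> * N k" using X_iff[OF Xc[OF N]] N by blast
    have Nk: "dim_row (N k) = d k" "dim_col (N k) = d k" using Xc[OF N k_less] by auto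
    have "T * bdiag N * \<Phi> = T * (\<Phi> * N k)" unfolding XN[symmetric] by (simp add: mat_assoc)
    also have "\<dots> = (T * \<Phi>) * N k" using Nk by (simp add: mat_assoc)
    finally have "T * bdiag N * \<Phi> = N k" unfolding T\<Phi> using Nk by simp
    thus ?thesis by (auto simp: res_def ext_k fun_eq_iff)
  qed
  define \<rho> where "\<rho> y = ?c (res (end_mats d' y))" for y
  define \<rho>' where "\<rho>' y = ?c' (ext (end_mats d y))" for y
  have res_cong: "?c (res N) = ?c (res N')" if "\<And>i. i < n \<Longrightarrow> N i = N' i" for N N'
  proof (rule end_coords_cong)
    fix i assume "i < n"
    moreover have "bdiag N = bdiag N'" using that t_less by (intro bdiag_cong) auto
    ultimately show "res N i = res N' i" using that by (simp add: res_def)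
  qed
  have ext_cong: "?c' (ext N) = ?c' (ext N')" if "\<And>i. i < n \<Longrightarrow> N i = N' i" for N N'
  proof (rule end_coords_cong)
    fix i assume "i < n"
    moreover have "bdiag N = bdiag N'" using that t_less by (intro bdiag_cong) auto
    ultimately show "ext N i = ext N' i" using that by (simp add: ext_def)
  qed
  have \<rho>: "\<rho> (?c' N) = ?c (res N)" if "N \<in> X'" for N
    unfolding \<rho>_def by (rule res_cong) (rule end_mats_coords[where N = N and d = d', OF _ X'c[OF that]])
  have \<rho>': "\<rho>' (?c N) = ?c' (ext N)" if "N \<in> X" for N
    unfolding \<rho>'_def by (rule ext_cong) (rule end_mats_coords[where N = N and d = d, OF _ Xc[OF that]])
  have \<rho>_poly: "(\<lambda>y. \<rho> y v) \<in> poly_fun" for v unfolding \<rho>_def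
  proof (rule end_coords_poly_fun)
    have "poly_mat (\<lambda>y. T * bdiag (end_mats d' y) * \<Phi>)"
      by (intro poly_mat_mult[where ?x0.0 = "\<lambda>_. 0"] poly_mat_const bdiag_poly_mat) (use dt in auto)
    thus "poly_mat (\<lambda>y. res (end_mats d' y) i)" for i
      by (cases "i = k") (auto simp: res_k end_mats_poly_mat)
    show "res (end_mats d' y) i \<in> carrier_mat (d i) (d i)" if "i < n" for y i
      using d'[OF that] by (cases "i = k") (auto simp: res_k intro!: carrier_matI)
  qed
  have \<rho>'_poly: "(\<lambda>y. \<rho>' y v) \<in> poly_fun" for v unfolding \<rho>'_def
  proof (rule end_coords_poly_fun)
    have "poly_mat (\<lambda>y. G * bdiag (end_mats d y) * \<sigma>)"
      by (intro poly_mat_mult[where ?x0.0 = "\<lambda>_. 0"] poly_mat_const bdiag_poly_mat) auto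
    thus "poly_mat (\<lambda>y. ext (end_mats d y) i)" for i
      by (cases "i = k") (auto simp: ext_k end_mats_poly_mat)
    show "ext (end_mats d y) i \<in> carrier_mat (d' i) (d' i)" if "i < n" for y i
      using d'[OF that] by (cases "i = k") (auto simp: ext_k intro!: carrier_matI)
  qed
  define U' where "U' = {N \<in> X'. res N \<in> U \<and> (\<forall>j. excess \<delta> j \<le> mrank (N k ^\<^sub>m j))}"
  have types: "jordan_type (N i) (sigma_part A s t k tt \<nu> i)" if N: "N \<in> U'" and i: "i < n" for N i
  proof (cases "i = k")
    case False
    have "jordan_type (res N i) (\<nu> i)" using U(2) N i unfolding U'_def by blast
    thus ?thesis using False by (simp add: sigma_part_def res_k)
  next
    case True
    have NX: "N \<in> X'" and rU: "res N \<in> U" and ge: "\<And>j. excess \<delta> j \<le> mrank (N k ^\<^sub>m j)" using N by (auto simp: U'_def)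
    have NG: "N k * G = G * bdiag N" using X'_iff[OF X'c[OF NX]] NX by blast
    have rc: "res N k \<in> carrier_mat (d k) (d k)" using Xc[OF resX[OF NX] k_less] .
    obtain e where "N k ^\<^sub>m e = 0\<^sub>m (d' k) (d' k)"
      using NX k_less unfolding X'_def nil_ends_def nilpotent_mat_def by blast
    then obtain \<pi> where \<pi>: "jordan_type (N k) \<pi>" using nilpotent_jordan_type[OF X'c[OF NX k_less]] by blast
    have jk: "jordan_type (res N k) (\<nu> k)" using U(2)[OF rU k_less] .
    have "jordan_type (bdiag (res N)) \<mu>" unfolding \<mu>_def
      by (rule bdiag_jordan_type) (use Xc[OF resX[OF NX]] U(2)[OF rU] t_less in auto)
    hence jb: "jordan_type (bdiag N) \<mu>" by (simp add: res_k)
    have "excess (\<nu> k) j + excess \<pi> j \<le> excess \<mu> j" for j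
      using cokernel_rank_add[OF block_carrier(3) rc X'c[OF NX k_less] \<Phi>c T Gc \<sigma> res_comm[OF NX] NG T\<Phi> eqs(1,2), of j]
        jordan_shape_mrank jk \<pi> jb unfolding jordan_type_iff by metis
    hence "excess \<pi> j \<le> excess \<delta> j" for j unfolding \<delta>_def
      using excess_le_pdiff[OF inter[folded \<mu>_def] part\<mu>] jk \<pi> unfolding jordan_type_iff by blast
    moreover have "excess \<delta> j \<le> excess \<pi> j" for j
      using ge[of j] jordan_shape_mrank \<pi> unfolding jordan_type_iff by metis
    ultimately have "\<pi> = \<delta>"
      using \<pi> part\<delta> unfolding jordan_type_iff by (intro excess_inject) (auto intro: antisym)
    thus ?thesis using \<pi> True by (simp add: sigma_part_def \<delta>_def \<mu>_def)
  qed
  have "open_in_via ?c' X' U'" unfolding open_in_via_iff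
  proof (intro conjI ballI)
    show "U' \<subseteq> X'" by (auto simp: U'_def)
    fix N assume N: "N \<in> U'"
    hence NX: "N \<in> X'" and rU: "res N \<in> U" and ge: "\<And>j. excess \<delta> j \<le> mrank (N k ^\<^sub>m j)" by (auto simp: U'_def)
    obtain p where p: "p \<in> poly_fun" "p (?c (res N)) \<noteq> 0" "\<And>z. z \<in> X \<Longrightarrow> p (?c z) \<noteq> 0 \<Longrightarrow> z \<in> U" using Uopen[OF rU] by blast
    note Nk = X'c[OF NX k_less]
    have "\<forall>j. \<exists>L R. L \<in> carrier_mat (excess \<delta> j) (d' k) \<and> R \<in> carrier_mat (d' k) (excess \<delta> j) \<and>
        L * N k ^\<^sub>m j * R = 1\<^sub>m (excess \<delta> j)"
      using ge rkge_iff Nk unfolding rkge_def by (metis pow_mat_dim_square)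
    then obtain L R where LR: "\<And>j. L j \<in> carrier_mat (excess \<delta> j) (d' k)" "\<And>j. R j \<in> carrier_mat (d' k) (excess \<delta> j)"
        "\<And>j. L j * N k ^\<^sub>m j * R j = 1\<^sub>m (excess \<delta> j)" by metis
    define q where "q y = p (\<rho> y) * (\<Prod>j\<le>\<delta> 0. det (L j * end_mats d' y k ^\<^sub>m j * R j))" for y
    have "(\<lambda>y. det (L j * end_mats d' y k ^\<^sub>m j * R j)) \<in> poly_fun" for j
    proof (rule poly_fun_det[where ?x0.0 = "\<lambda>_. 0"])
      note c = carrier_matD[OF LR(1)[of j]] carrier_matD[OF LR(2)[of j]]
      have "poly_mat (\<lambda>y. end_mats d' y k ^\<^sub>m j)"
        by (rule poly_mat_pow[OF end_mats_poly_mat end_mats_carrier])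
      thus "poly_mat (\<lambda>y. L j * end_mats d' y k ^\<^sub>m j * R j)"
        by (intro poly_mat_mult[where ?x0.0 = "\<lambda>_. 0"] poly_mat_const) (use c in auto)
      show "L j * end_mats d' (\<lambda>_. 0) k ^\<^sub>m j * R j \<in> carrier_mat (excess \<delta> j) (excess \<delta> j)"
        using c by (intro carrier_matI) auto
    qed
    hence "q \<in> poly_fun" unfolding q_def by (intro pf_mult poly_fun_comp[OF p(1)] \<rho>_poly poly_fun_prod)
    moreover have "q (?c' N) \<noteq> 0"
      using p(2) LR(3) by (simp add: q_def \<rho>[OF NX] end_mats_coords[where N = N and d = d', OF k_less Nk])
    moreover have "z \<in> U'" if z: "z \<in> X'" "q (?c' z) \<noteq> 0" for z
    proof -
      note zk = X'c[OF z(1) k_less]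
      have "p (?c (res z)) \<noteq> 0" using z(2) by (simp add: q_def \<rho>[OF z(1)])
      hence "res z \<in> U" using p(3) resX[OF z(1)] by blast
      moreover have "excess \<delta> j \<le> mrank (z k ^\<^sub>m j)" for j
      proof (cases "j \<le> \<delta> 0")
        case True
        hence "det (L j * z k ^\<^sub>m j * R j) \<noteq> 0" using z(2) by (simp add: q_def end_mats_coords[where N = z and d = d', OF k_less zk])
        thus ?thesis using LR(1,2)[of j] zk by (intro rkgeI_det) auto
      next
        case False
        thus ?thesis using excess_eventually_zero[OF part\<delta>, of j] by simp
      qed
      ultimately show ?thesis using z(1) by (simp add: U'_def)
    qed
    ultimately show "\<exists>p\<in>poly_fun. p (?c' N) \<noteq> 0 \<and> (\<forall>z\<in>X'. p (?c' z) \<noteq> 0 \<longrightarrow> z \<in> U')" by blast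
  qed
  moreover have "U' \<inter> W \<noteq> {}" if W: "open_in_via ?c' X' W" "W \<noteq> {}" for W
  proof -
    obtain Z where Z: "Z \<in> W" using W(2) by blast
    hence ZX: "Z \<in> X'" using W(1) unfolding open_in_via_iff by blast
    obtain p where p: "p \<in> poly_fun" "p (?c' Z) \<noteq> 0" "\<And>z. z \<in> X' \<Longrightarrow> p (?c' z) \<noteq> 0 \<Longrightarrow> z \<in> W"
      using W(1) Z unfolding open_in_via_iff by blast
    have pp: "(\<lambda>y. p (\<rho>' y)) \<in> poly_fun" by (rule poly_fun_comp[OF p(1) \<rho>'_poly])
    have "open_in_via ?c X {N \<in> X. p (\<rho>' (?c N)) \<noteq> 0}" unfolding open_in_via_iff
      by (intro conjI ballI bexI[of _ "\<lambda>y. p (\<rho>' y)"]) (auto intro: pp)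
    moreover have "res Z \<in> {N \<in> X. p (\<rho>' (?c N)) \<noteq> 0}"
      using p(2) resX[OF ZX] \<rho>'[OF resX[OF ZX]] ext_res[OF ZX] by simp
    ultimately obtain N where N: "N \<in> U" "p (\<rho>' (?c N)) \<noteq> 0" using Udense by blast
    obtain pU where pU: "pU \<in> poly_fun" "pU (?c N) \<noteq> 0" "\<And>z. z \<in> X \<Longrightarrow> pU (?c z) \<noteq> 0 \<Longrightarrow> z \<in> U" using Uopen[OF N(1)] by blast
    have NX: "N \<in> nil_ends n A s t d f" using N(1) UX X_def by blast
    obtain N2 where N2: "N2 \<in> X" "pU (?c N2) * p (\<rho>' (?c N2)) \<noteq> 0" "ample_cokernel (bdiag N2) \<Phi> (excess \<delta>)"
    proof (rule generic_ample_endomorphism[OF rep NX U(2)[OF N(1)] gen inter pf_mult[OF pU(1) pp]])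
      show "pU (?c N) * p (\<rho>' (?c N)) \<noteq> 0" using pU(2) N(2) by simp
      fix N2 assume "N2 \<in> nil_ends n A s t d f" "pU (?c N2) * p (\<rho>' (?c N2)) \<noteq> 0"
        "ample_cokernel (bdiag N2) (stack f (d k)) (refl_excess \<nu> tt)"
      thus thesis using that unfolding X_def \<Phi>_def \<delta>_def \<mu>_def by blast
    qed
    have eX: "ext N2 \<in> X'" by (rule extX'[OF N2(1)])
    have "ext N2 \<in> W" using p(3)[OF eX] N2(2) \<rho>'[OF N2(1)] by simp
    moreover have "res (ext N2) \<in> U" using pU(3)[OF N2(1)] N2(2) res_ext[OF N2(1)] by simp
    moreover have "excess \<delta> j \<le> mrank (ext N2 k ^\<^sub>m j)" for j
      by (rule ample_cokernel_rank[OF N2(3) block_carrier(3) \<Phi>c T Gc \<sigma> X'c[OF eX k_less] eqs(3) ext_comm[OF N2(1)]])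
    ultimately show ?thesis using eX by (auto simp: U'_def)
  qed
  ultimately have "dense_open_in_via ?c' X' U'" unfolding dense_open_in_via_def by blast
  thus ?thesis using types unfolding is_GenJF_def X'_def by blast
qed

end

theorem theorem3p7:
  fixes n :: nat and A :: "'a set" and s t :: "'a \<Rightarrow> nat" and k tt :: nat
    and d :: "nat \<Rightarrow> nat" and \<nu> :: "nat \<Rightarrow> nat \<Rightarrow> nat"
    and f :: "'a \<Rightarrow> 'k::alg_closed_field mat"
  assumes "dynkin_quiver n A s t"
    and "k < n" and "is_source A t k"
    and "\<forall>i<n. partition_of (\<nu> i) (d i)"
    and "interlaced tt (adj_partition A s t \<nu> k) (\<nu> k)"
    and "rep A s t d f"
    and "is_GenRep n A s t d f \<nu>"
    and "is_GenJF n A s t d f \<nu>"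
  shows "\<forall>d' g. is_reflection_minus n A s t k d f d' g \<longrightarrow>
           is_GenJF n A (refl_src s t k) (refl_tgt s t k) d' g (sigma_part A s t k tt \<nu>)"
proof -
  have A: "finite A" "\<And>a. a \<in> A \<Longrightarrow> s a < n" "\<And>a. a \<in> A \<Longrightarrow> t a < n"
    using assms(1) unfolding dynkin_quiver_def quiver_def by blast+
  have "finite (SIGMA a:{a\<in>A. s a = k}. {..<d (t a)})" using A(1) by simp
  then obtain \<kappa> where "bij_betw \<kappa> {..<card (SIGMA a:{a\<in>A. s a = k}. {..<d (t a)})} (SIGMA a:{a\<in>A. s a = k}. {..<d (t a)})"
    using ex_bij_betw_nat_finite unfolding atLeast0LessThan by blast
  then interpret source_vertex n A s t k d \<kappa> "card (SIGMA a:{a\<in>A. s a = k}. {..<d (t a)})"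
    using A assms(2,3) unfolding is_source_def by unfold_locales blast+
  show ?thesis using reflection_GenJF[OF assms(5-8)] by blast
qed

end
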